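(* Let $g\ge 1$ and $k\ge 1$ be integers. Let $s_k$ denote the $k$th power sum of the eigenvalues of a random element of $USp(2g)$ (distributed according to Haar measure), and let $\mathcal{M}[s_k](z)=\sum_{n\ge 0}E[s_k^n]\frac{z^n}{n!}$ be its moment generating function. Then $$\mathcal{M}[s_k] = \det_{g\times g}\left(\mathcal{C}_k^{i+j-2}\right),$$ the determinant of the $g\times g$ matrix whose $(i,j)$ entry ($1\le i,j\le g$) is $\mathcal{C}_k^{i+j-2}(z)$, where for each integer $m\ge 0$ the series $\mathcal{C}_k^m(z)$ is given by $$\mathcal{C}_k^m = \sum_{j}\binom{m}{j}\bigl(\mathcal{B}_{(2j-m)/k}-\mathcal{B}_{(2j-m+2)/k}\bigr).$$
   Context: $USp(2g)$ is the compact Lie group of $2g\times 2g$ complex matrices that are both unitary and symplectic, with normalized Haar measure. The eigenvalues of a matrix in $USp(2g)$ are $e^{\pm i\theta_1},\ldots,e^{\pm i\theta_g}$ with $\theta_j\in[0,\pi]$, and the joint density of $(\theta_1,\ldots,\theta_g)$ under Haar measure is (Weyl) $$\mu=\frac{1}{g!}\Bigl(\prod_{j<l}(2\cos\theta_j-2\cos\theta_l)\Bigr)^2\prod_j\Bigl(\frac{2}{\pi}\sin^2\theta_j\,d\theta_j\Bigr).$$ The $k$th power sum is $s_k=\sum_{j=1}^g(e^{ki\theta_j}+e^{-ki\theta_j})=\sum_{j=1}^g 2\cos k\theta_j$. For $\nu\in\mathbb{Q}$ and integers $n\ge 0$, $B_\nu(n)=\binom{n}{(n+\nu)/2}$, where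 the binomial coefficient is taken to be zero when $(n+\nu)/2$ is not an integer in $[0,n]$ (in particular $B_\nu$ is identically zero for $\nu\notin\mathbb{Z}$), and $\mathcal{B}_\nu(z)=\sum_{n\ge 0}B_\nu(n)\frac{z^n}{n!}$. The sum over $j$ runs over all integers $j$ (only $0\le j\le m$ contribute). All identities are identities of formal power series in $z$. *)

theory Defs
  imports
    "Jordan_Normal_Form.Determinant"
    "HOL-Computational_Algebra.Formal_Power_Series"
    "HOL-Computational_Algebra.Fundamental_Theorem_Algebra"
    "HOL-Analysis.Analysis"
    "HOL-Probability.Probability_Measure"
begin

no_notation Matrix.vec_index (infixl "$" 100)

text \<open>
  The dimension \<open>g\<close> is \<open>CARD('g)\<close> for a finite type \<open>'g\<close>, so that \<open>'g + 'g\<close> indexes the rows and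
  columns of a \<open>2g \<times> 2g\<close> matrix in block form.
\<close>

definition conj_transpose :: "complex ^ 'n ^ 'm \<Rightarrow> complex ^ 'm ^ 'n" where
  "conj_transpose A = (\<chi> i j. cnj (A $ j $ i))"

text \<open>The block matrix with rows \<open>(0, I)\<close> and \<open>(-I, 0)\<close>.\<close>

definition symp_form :: "complex ^ ('g + 'g) ^ ('g::finite + 'g)" where
  "symp_form = (\<chi> i j. case (i, j) of
      (Inl a, Inr b) \<Rightarrow> if a = b then 1 else 0
    | (Inr a, Inl b) \<Rightarrow> if a = b then -1 else 0
    | _ \<Rightarrow> 0)"

definition USp :: "(complex ^ ('g + 'g) ^ ('g::finite + 'g)) set" where
  "USp = {A. conj_transpose A ** A = mat 1 \<and> transpose A ** symp_form ** A = symp_form}"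

text \<open>
  Normalized Haar measure on \<open>USp(2g)\<close>: a left-invariant Borel probability measure. Regularity is
  automatic, as \<open>USp(2g)\<close> is a compact metric space; right-invariance then follows too, since the
  group is compact.
\<close>

definition is_haar_USp :: "(complex ^ ('g + 'g) ^ ('g::finite + 'g)) measure \<Rightarrow> bool" where
  "is_haar_USp M \<longleftrightarrow>
     sets M = sets (restrict_space borel USp) \<and>
     prob_space M \<and>
     (\<forall>A\<in>USp. \<forall>S\<in>sets M. emeasure M ((\<lambda>B. A ** B) ` S) = emeasure M S)"

definition charpoly :: "complex ^ 'n ^ 'n::finite \<Rightarrow> complex poly" where
  "charpoly A = det (\<chi> i j. (if i = j then [:0, 1:] else 0) - [:A $ i $ j:])"

text \<open>The multiset of eigenvalues, with algebraic multiplicity.\<close>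

definition eigenvalues :: "complex ^ 'n ^ 'n::finite \<Rightarrow> complex multiset" where
  "eigenvalues A = proots (charpoly A)"

definition power_sum :: "nat \<Rightarrow> complex ^ 'n ^ 'n::finite \<Rightarrow> complex" where
  "power_sum k A = (\<Sum>z\<in>#eigenvalues A. z ^ k)"

definition moment_gf :: "'a measure \<Rightarrow> ('a \<Rightarrow> complex) \<Rightarrow> complex fps" where
  "moment_gf M X = Abs_fps (\<lambda>n. (LINT \<omega>|M. X \<omega> ^ n) / fact n)"

definition Bcoeff :: "rat \<Rightarrow> nat \<Rightarrow> nat" where
  "Bcoeff \<nu> n =
     (let q = (of_nat n + \<nu>) / 2
      in if q \<in> \<int> \<and> 0 \<le> q \<and> q \<le> of_nat n then n choose nat \<lfloor>q\<rfloor> else 0)"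

definition Bseries :: "rat \<Rightarrow> complex fps" where
  "Bseries \<nu> = Abs_fps (\<lambda>n. of_nat (Bcoeff \<nu> n) / fact n)"

definition Cseries :: "nat \<Rightarrow> nat \<Rightarrow> complex fps" where
  "Cseries k m =
     (\<Sum>j\<le>m. of_nat (m choose j) *
        (Bseries ((2 * of_nat j - of_nat m) / of_nat k)
         - Bseries ((2 * of_nat j - of_nat m + 2) / of_nat k)))"

end

theory Submission
  imports Defs "HOL-Probability.Infinite_Product_Measure" "Jordan_Normal_Form.Schur_Decomposition"
begin

no_notation Matrix.vec_index (infixl "$" 100)

text \<open>
  The moments are computed from Weyl's density for the eigenangles \<open>\<theta>\<close>, and the point of the proof is
  that Weyl's integration formula for power sums follows from the invariance of Haar measure by linear
  algebra, without a change of variables on the group.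

  Let \<open>E\<close> be the expectation under Haar measure of a polynomial \<open>F\<close> in the power sums.  Invariance under
  left translation along curves in the group gives an integration by parts formula
  (\<open>haar_integration_by_parts\<close>).  Applying it to \<open>trace (Y ** A ^ k) * F A\<close> in the direction \<open>X\<close> and
  summing over the Casimir tensor of the symplectic Lie algebra yields the loop equations
  \<open>E (K k * F + (\<Sum>j. v k j * \<partial> j F)) = 0\<close>, where \<open>v k j = 2 sin (k \<theta> j)\<close> and \<open>K k\<close> is an explicit
  polynomial in power sums (\<open>haar_loop\<close>).  On the torus, \<open>K k\<close> is exactly the divergence of the vector
  field \<open>v k\<close> with respect to Weyl's density (\<open>divergence_weyl_vf\<close>), so integration against that density
  satisfies the same equations.

  The loop equations have only one normalized solution (\<open>E_eq_wint\<close>).  They say that \<open>E\<close> annihilates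
  the values of the Laplacian of the torus weighted by Weyl's density.  This operator preserves the
  finite-dimensional spaces of symmetric functions of bounded degree, it is symmetric for the weighted
  scalar product, and its kernel consists of the constants.  Hence every symmetric function is a constant
  plus a Laplacian, and the constant is the normalized weighted integral.

  For expectations to be a functional on functions of \<open>\<theta>\<close>, the eigenvalues of every element of the
  group must come in pairs \<open>exp (\<plusminus> \<i> \<theta> j)\<close>.  They lie on the unit circle and are closed under
  conjugation; that \<open>-1\<close> has even multiplicity is equivalent to the determinant being one, which is
  proved by means of a Pfaffian (\<open>det_USp\<close>).

  What remains is classical.  Expanding the Weyl denominator as a Vandermonde determinant, Andreief's
  identity turns the weighted integral of the exponential generating function of a power sum into the
  determinant of one-dimensional integrals of
  \<open>(2 cos t) ^ (i + j) * exp (2 z cos (k t))\<close> against \<open>(2 sin t)\<^sup>2\<close>, and binomial expansion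
  evaluates these as the series \<open>Cseries k (i + j)\<close>.  The normalizing constant is obtained in the same way
  from the expansion of the Weyl denominator into sines, which are orthogonal.
\<close>

section \<open>Trigonometric polynomials on the torus\<close>
definition circle :: "real measure" where
  "circle = uniform_measure lborel {0..2 * pi}"

definition torus :: "nat \<Rightarrow> (nat \<Rightarrow> real) measure" where
  "torus g = Pi\<^sub>M {..<g} (\<lambda>_. circle)"

lemma prob_space_circle: "prob_space circle"
  unfolding circle_def by (rule prob_space_uniform_measure) auto

lemma sets_circle [measurable_cong, simp]: "sets circle = sets borel"
  by (simp add: circle_def)

lemma space_circle [simp]: "space circle = UNIV"
  by (simp add: circle_def)

interpretation circle: prob_space circle
  by (rule prob_space_circle)

interpretation tor: product_prob_space "\<lambda>_::nat. circle" I for I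
  by unfold_locales

lemma prob_space_torus: "prob_space (torus g)"
  unfolding torus_def by (rule prob_space_PiM) (rule prob_space_circle)

interpretation torus: prob_space "torus g" for g
  by (rule prob_space_torus)

lemma integral_circle:
  fixes f :: "real \<Rightarrow> real"
  assumes [measurable]: "f \<in> borel_measurable borel"
  shows "integral\<^sup>L circle f = (LINT t|lborel. f t * indicator {0..2*pi} t) / (2 * pi)"
proof -
  have *: "circle = density lborel (\<lambda>x. ennreal (indicator {0..2*pi} x / (2 * pi)))"
    unfolding circle_def uniform_measure_def
    by (intro arg_cong[where f="density lborel"] ext)
       (auto simp: indicator_def divide_ennreal[symmetric] ennreal_1[symmetric] simp del: ennreal_1)
  have "integral\<^sup>L circle f = (LINT t|lborel. (indicator {0..2*pi} t / (2 * pi)) * f t)"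
    unfolding * by (rule integral_real_density) auto
  also have "\<dots> = (LINT t|lborel. (f t * indicator {0..2*pi} t) / (2 * pi))"
    by (intro Bochner_Integration.integral_cong) auto
  finally show ?thesis by simp
qed

lemma integral_circle_deriv:
  fixes F f :: "real \<Rightarrow> real"
  assumes "\<And>t. (F has_real_derivative f t) (at t)" "continuous_on UNIV f" "F (2 * pi) = F 0"
  shows "integral\<^sup>L circle f = 0"
proof -
  have [measurable]: "f \<in> borel_measurable borel"
    using assms(2) by (rule borel_measurable_continuous_onI)
  have "(LINT t|lborel. f t * indicator {0..2*pi} t) = F (2 * pi) - F 0"
    using assms(1,2) by (intro integral_FTC_Icc_real) (auto simp: continuous_on_eq_continuous_at)
  with assms(3) show ?thesis by (simp add: integral_circle)
qed

text \<open>
  Generating the trigonometric polynomials as an algebra, rather than as finite Fourier sums, lets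
  every analytic property used below be proved by induction over sums and products.  The argument
  ranges over all sequences of angles, but only the first \<open>g\<close> of them matter.
\<close>

inductive_set trig :: "nat \<Rightarrow> ((nat \<Rightarrow> real) \<Rightarrow> real) set" for g where
  trig_const: "(\<lambda>_. c) \<in> trig g"
| trig_cos: "j < g \<Longrightarrow> (\<lambda>\<theta>. cos (of_int k * \<theta> j)) \<in> trig g"
| trig_sin: "j < g \<Longrightarrow> (\<lambda>\<theta>. sin (of_int k * \<theta> j)) \<in> trig g"
| trig_add: "f \<in> trig g \<Longrightarrow> h \<in> trig g \<Longrightarrow> (\<lambda>\<theta>. f \<theta> + h \<theta>) \<in> trig g"
| trig_mult: "f \<in> trig g \<Longrightarrow> h \<in> trig g \<Longrightarrow> (\<lambda>\<theta>. f \<theta> * h \<theta>) \<in> trig g"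

lemma trig_cmult: "f \<in> trig g \<Longrightarrow> (\<lambda>\<theta>. c * f \<theta>) \<in> trig g"
  by (intro trig_mult trig_const)

lemma trig_minus: "f \<in> trig g \<Longrightarrow> (\<lambda>\<theta>. - f \<theta>) \<in> trig g"
  using trig_cmult[of f g "-1"] by simp

lemma trig_diff: "f \<in> trig g \<Longrightarrow> h \<in> trig g \<Longrightarrow> (\<lambda>\<theta>. f \<theta> - h \<theta>) \<in> trig g"
  using trig_add[OF _ trig_minus, of f g h] by simp

lemma trig_sum: "(\<And>i. i \<in> A \<Longrightarrow> f i \<in> trig g) \<Longrightarrow> (\<lambda>\<theta>. \<Sum>i\<in>A. f i \<theta>) \<in> trig g"
  by (induction A rule: infinite_finite_induct) (auto intro: trig_const trig_add)

lemma trig_prod: "(\<And>i. i \<in> A \<Longrightarrow> f i \<in> trig g) \<Longrightarrow> (\<lambda>\<theta>. \<Prod>i\<in>A. f i \<theta>) \<in> trig g"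
  by (induction A rule: infinite_finite_induct) (auto intro: trig_const trig_mult)

lemma trig_power: "f \<in> trig g \<Longrightarrow> (\<lambda>\<theta>. f \<theta> ^ n) \<in> trig g"
  by (induction n) (auto intro: trig_const trig_mult)

lemma trig_sin1: "j < g \<Longrightarrow> (\<lambda>\<theta>. sin (\<theta> j)) \<in> trig g"
  using trig_sin[of j g 1] by simp

lemma trig_cos1: "j < g \<Longrightarrow> (\<lambda>\<theta>. cos (\<theta> j)) \<in> trig g"
  using trig_cos[of j g 1] by simp

lemmas trig_intros = trig_const trig_cos trig_sin trig_add trig_mult trig_minus trig_diff
  trig_sum trig_prod trig_power trig_sin1 trig_cos1

lemma trig_measurable [measurable]: "f \<in> trig g \<Longrightarrow> f \<in> borel_measurable (torus g)"
proof (induction rule: trig.induct)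
  have *: "j < g \<Longrightarrow> (\<lambda>\<theta>. \<theta> j) \<in> borel_measurable (torus g)" for j
    using measurable_component_singleton[of j "{..<g}" "\<lambda>_. circle"]
    by (simp add: torus_def cong: measurable_cong_sets)
  { case (trig_cos j k) with * show ?case by measurable }
  { case (trig_sin j k) with * show ?case by measurable }
qed auto

lemma trig_bounded: "f \<in> trig g \<Longrightarrow> \<exists>K. \<forall>\<theta>. \<bar>f \<theta>\<bar> \<le> K"
proof (induction rule: trig.induct)
  case (trig_const c) then show ?case by auto
next
  case (trig_cos j k) then show ?case by (intro exI[of _ 1]) auto
next
  case (trig_sin j k) then show ?case by (intro exI[of _ 1]) auto
next
  case (trig_add f h)
  then obtain K L where "\<forall>\<theta>. \<bar>f \<theta>\<bar> \<le> K" "\<forall>\<theta>. \<bar>h \<theta>\<bar> \<le> L" by auto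
  then show ?case by (intro exI[of _ "K+L"] allI order_trans[OF abs_triangle_ineq] add_mono) auto
next
  case (trig_mult f h)
  then obtain K L where *: "\<forall>\<theta>. \<bar>f \<theta>\<bar> \<le> K" "\<forall>\<theta>. \<bar>h \<theta>\<bar> \<le> L" by auto
  have "\<bar>f \<theta> * h \<theta>\<bar> \<le> K * L" for \<theta>
    unfolding abs_mult using * by (intro mult_mono) (auto intro: order_trans[OF abs_ge_zero])
  then show ?case by blast
qed

lemma trig_integrable: "f \<in> trig g \<Longrightarrow> integrable (torus g) f"
proof -
  assume f: "f \<in> trig g"
  then obtain K where "\<forall>\<theta>. \<bar>f \<theta>\<bar> \<le> K" using trig_bounded by blast
  then show ?thesis using f
    by (intro torus.integrable_const_bound[of _ K]) (auto simp: trig_measurable)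
qed

lemma trig_lipschitz:
  "f \<in> trig g \<Longrightarrow> \<exists>K\<ge>0. \<forall>\<theta> \<phi>. \<bar>f \<theta> - f \<phi>\<bar> \<le> K * (\<Sum>j<g. \<bar>\<theta> j - \<phi> j\<bar>)"
proof (induction rule: trig.induct)
  case (trig_const c) then show ?case by (intro exI[of _ 0]) auto
next
  case (trig_cos j k)
  have "\<bar>cos (of_int k * \<theta> j) - cos (of_int k * \<phi> j)\<bar> \<le> \<bar>of_int k\<bar> * (\<Sum>j<g. \<bar>\<theta> j - \<phi> j\<bar>)" for \<theta> \<phi> :: "nat \<Rightarrow> real"
  proof -
    have c: "\<bar>cos a - cos b\<bar> \<le> \<bar>a - b\<bar>" for a b :: real
    proof -
      have "\<bar>cos a - cos b\<bar> = 2 * \<bar>sin ((a + b) / 2)\<bar> * \<bar>sin ((b - a) / 2)\<bar>"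
        by (simp add: cos_diff_cos abs_mult)
      also have "\<dots> \<le> 2 * 1 * \<bar>(b - a) / 2\<bar>"
        by (intro mult_mono abs_sin_le_one abs_sin_x_le_abs_x) auto
      finally show ?thesis by simp
    qed
    have "\<bar>cos (of_int k * \<theta> j) - cos (of_int k * \<phi> j)\<bar> \<le> \<bar>of_int k * \<theta> j - of_int k * \<phi> j\<bar>"
      by (rule c)
    also have "\<dots> = \<bar>of_int k\<bar> * \<bar>\<theta> j - \<phi> j\<bar>"
      by (simp add: abs_mult[symmetric] right_diff_distrib)
    also have "\<dots> \<le> \<bar>of_int k\<bar> * (\<Sum>j<g. \<bar>\<theta> j - \<phi> j\<bar>)"
      using trig_cos by (intro mult_left_mono member_le_sum) auto
    finally show ?thesis .
  qed
  then show ?case by (intro exI[of _ "\<bar>of_int k\<bar>"]) auto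
next
  case (trig_sin j k)
  have "\<bar>sin (of_int k * \<theta> j) - sin (of_int k * \<phi> j)\<bar> \<le> \<bar>of_int k\<bar> * (\<Sum>j<g. \<bar>\<theta> j - \<phi> j\<bar>)" for \<theta> \<phi> :: "nat \<Rightarrow> real"
  proof -
    have c: "\<bar>sin a - sin b\<bar> \<le> \<bar>a - b\<bar>" for a b :: real
    proof -
      have "\<bar>sin a - sin b\<bar> = 2 * \<bar>sin ((a - b) / 2)\<bar> * \<bar>cos ((a + b) / 2)\<bar>"
        by (simp add: sin_diff_sin abs_mult)
      also have "\<dots> \<le> 2 * \<bar>(a - b) / 2\<bar> * 1"
        by (intro mult_mono abs_cos_le_one abs_sin_x_le_abs_x order_refl) auto
      finally show ?thesis by simp
    qed
    have "\<bar>sin (of_int k * \<theta> j) - sin (of_int k * \<phi> j)\<bar> \<le> \<bar>of_int k * \<theta> j - of_int k * \<phi> j\<bar>"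
      by (rule c)
    also have "\<dots> = \<bar>of_int k\<bar> * \<bar>\<theta> j - \<phi> j\<bar>"
      by (simp add: abs_mult[symmetric] right_diff_distrib)
    also have "\<dots> \<le> \<bar>of_int k\<bar> * (\<Sum>j<g. \<bar>\<theta> j - \<phi> j\<bar>)"
      using trig_sin by (intro mult_left_mono member_le_sum) auto
    finally show ?thesis .
  qed
  then show ?case by (intro exI[of _ "\<bar>of_int k\<bar>"]) auto
next
  case (trig_add f h)
  then obtain K L where *: "K \<ge> 0" "L \<ge> 0"
    "\<forall>\<theta> \<phi>. \<bar>f \<theta> - f \<phi>\<bar> \<le> K * (\<Sum>j<g. \<bar>\<theta> j - \<phi> j\<bar>)"
    "\<forall>\<theta> \<phi>. \<bar>h \<theta> - h \<phi>\<bar> \<le> L * (\<Sum>j<g. \<bar>\<theta> j - \<phi> j\<bar>)" by auto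
  have "\<bar>f \<theta> + h \<theta> - (f \<phi> + h \<phi>)\<bar> \<le> (K + L) * (\<Sum>j<g. \<bar>\<theta> j - \<phi> j\<bar>)" for \<theta> \<phi>
    using *(3,4)[rule_format, of \<theta> \<phi>] by (auto simp: distrib_right abs_le_iff)
  with * show ?case by (intro exI[of _ "K+L"]) auto
next
  case (trig_mult f h)
  then obtain K L where *: "K \<ge> 0" "L \<ge> 0"
    "\<forall>\<theta> \<phi>. \<bar>f \<theta> - f \<phi>\<bar> \<le> K * (\<Sum>j<g. \<bar>\<theta> j - \<phi> j\<bar>)"
    "\<forall>\<theta> \<phi>. \<bar>h \<theta> - h \<phi>\<bar> \<le> L * (\<Sum>j<g. \<bar>\<theta> j - \<phi> j\<bar>)" by auto
  obtain A where A: "\<And>\<theta>. \<bar>f \<theta>\<bar> \<le> A" using trig_bounded[OF trig_mult(1)] by auto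
  obtain B where B: "\<And>\<theta>. \<bar>h \<theta>\<bar> \<le> B" using trig_bounded[OF trig_mult(2)] by auto
  have AB: "A \<ge> 0" "B \<ge> 0" using A[of undefined] B[of undefined] by linarith+
  have "\<bar>f \<theta> * h \<theta> - f \<phi> * h \<phi>\<bar> \<le> (A * L + B * K) * (\<Sum>j<g. \<bar>\<theta> j - \<phi> j\<bar>)" for \<theta> \<phi>
  proof -
    have "\<bar>f \<theta> * h \<theta> - f \<phi> * h \<phi>\<bar> = \<bar>f \<theta> * (h \<theta> - h \<phi>) + h \<phi> * (f \<theta> - f \<phi>)\<bar>"
      by (simp add: algebra_simps)
    also have "\<dots> \<le> \<bar>f \<theta>\<bar> * \<bar>h \<theta> - h \<phi>\<bar> + \<bar>h \<phi>\<bar> * \<bar>f \<theta> - f \<phi>\<bar>"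
      by (metis abs_mult abs_triangle_ineq)
    also have "\<dots> \<le> A * (L * (\<Sum>j<g. \<bar>\<theta> j - \<phi> j\<bar>)) + B * (K * (\<Sum>j<g. \<bar>\<theta> j - \<phi> j\<bar>))"
      using *(3,4) A B AB by (intro add_mono mult_mono) auto
    finally show ?thesis by (simp add: algebra_simps)
  qed
  with * AB show ?case by (intro exI[of _ "A*L+B*K"]) auto
qed

text \<open>
  Continuity in the product topology, in a form that mentions only the coordinates below \<open>g\<close>.
\<close>

lemma trig_near:
  assumes "f \<in> trig g" "e > 0"
  shows "\<exists>d>0. \<forall>\<phi>. (\<forall>j<g. \<bar>\<phi> j - \<theta> j\<bar> < d) \<longrightarrow> \<bar>f \<phi> - f \<theta>\<bar> < e"
proof -
  obtain K where K: "K \<ge> 0" "\<And>\<theta> \<phi>. \<bar>f \<theta> - f \<phi>\<bar> \<le> K * (\<Sum>j<g. \<bar>\<theta> j - \<phi> j\<bar>)"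
    using trig_lipschitz[OF assms(1)] by auto
  define d where "d = e / (K * real g + 1)"
  have d: "d > 0" using assms K by (auto simp: d_def intro!: divide_pos_pos add_nonneg_pos)
  have "\<bar>f \<phi> - f \<theta>\<bar> < e" if "\<forall>j<g. \<bar>\<phi> j - \<theta> j\<bar> < d" for \<phi>
  proof -
    have "(\<Sum>j<g. \<bar>\<phi> j - \<theta> j\<bar>) \<le> (\<Sum>j<g. d)" using that by (intro sum_mono) (auto intro: less_imp_le)
    then have "\<bar>f \<phi> - f \<theta>\<bar> \<le> K * (real g * d)"
      using K(2)[of \<phi> \<theta>] K(1) by (simp add: order_trans mult_left_mono)
    also have "\<dots> < (K * real g + 1) * d" using d by (simp add: algebra_simps)
    also have "\<dots> = e" using K by (simp add: d_def add_nonneg_eq_0_iff)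
    finally show ?thesis .
  qed
  with d show ?thesis by blast
qed

lemma trig_periodic:
  assumes "f \<in> trig g" "\<And>j. j < g \<Longrightarrow> \<exists>n::int. \<theta> j = \<phi> j + 2 * pi * of_int n"
  shows "f \<theta> = f \<phi>"
  using assms(1)
proof induction
  case (trig_cos j k)
  obtain n :: int where n: "\<theta> j = \<phi> j + 2 * pi * of_int n" using assms(2)[OF trig_cos] by auto
  have "of_int k * \<theta> j = of_int k * \<phi> j + of_int (k * n) * (2 * pi)" by (simp add: n algebra_simps)
  then show ?case using cos.plus_of_int[of "of_int k * \<phi> j" "k * n"] by (simp add: algebra_simps)
next
  case (trig_sin j k)
  obtain n :: int where n: "\<theta> j = \<phi> j + 2 * pi * of_int n" using assms(2)[OF trig_sin] by auto
  have "of_int k * \<theta> j = of_int k * \<phi> j + of_int (k * n) * (2 * pi)" by (simp add: n algebra_simps)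
  then show ?case using sin.plus_of_int[of "of_int k * \<phi> j" "k * n"] by (simp add: algebra_simps)
qed auto

text \<open>
  Partial derivative in the coordinate \<open>j\<close>.
\<close>

definition pd :: "nat \<Rightarrow> ((nat \<Rightarrow> real) \<Rightarrow> real) \<Rightarrow> (nat \<Rightarrow> real) \<Rightarrow> real" where
  "pd j f \<theta> = deriv (\<lambda>t. f (\<theta>(j := t))) (\<theta> j)"

lemma pdI:
  assumes "\<And>\<theta>. ((\<lambda>t. f (\<theta>(j := t))) has_real_derivative f' \<theta>) (at (\<theta> j))"
  shows "pd j f = f'"
  using assms by (auto simp: pd_def fun_eq_iff intro: DERIV_imp_deriv)

lemma trig_has_pd:
  "f \<in> trig g \<Longrightarrow> \<exists>f'\<in>trig g. \<forall>\<theta>. ((\<lambda>t. f (\<theta>(j := t))) has_real_derivative f' \<theta>) (at (\<theta> j))"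
proof (induction rule: trig.induct)
  case (trig_const c) then show ?case by (intro bexI[of _ "\<lambda>_. 0"]) (auto intro: trig_intros)
next
  case (trig_cos i k)
  show ?case
  proof (cases "i = j")
    case True
    then show ?thesis using trig_cos
      by (intro bexI[of _ "\<lambda>\<theta>. - of_int k * sin (of_int k * \<theta> j)"])
         (auto intro!: trig_intros derivative_eq_intros)
  next
    case False
    then show ?thesis using trig_cos
      by (intro bexI[of _ "\<lambda>\<theta>. 0"]) (auto intro!: trig_intros derivative_eq_intros)
  qed
next
  case (trig_sin i k)
  show ?case
  proof (cases "i = j")
    case True
    then show ?thesis using trig_sin
      by (intro bexI[of _ "\<lambda>\<theta>. of_int k * cos (of_int k * \<theta> j)"])
         (auto intro!: trig_intros derivative_eq_intros)
  next
    case False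
    then show ?thesis using trig_sin
      by (intro bexI[of _ "\<lambda>\<theta>. 0"]) (auto intro!: trig_intros derivative_eq_intros)
  qed
next
  case (trig_add f h)
  then obtain f' h' where "f' \<in> trig g" "h' \<in> trig g"
    "\<forall>\<theta>. ((\<lambda>t. f (\<theta>(j := t))) has_real_derivative f' \<theta>) (at (\<theta> j))"
    "\<forall>\<theta>. ((\<lambda>t. h (\<theta>(j := t))) has_real_derivative h' \<theta>) (at (\<theta> j))" by blast
  then show ?case
    by (intro bexI[of _ "\<lambda>\<theta>. f' \<theta> + h' \<theta>"] allI DERIV_add trig_intros) blast+
next
  case (trig_mult f h)
  then obtain f' h' where *: "f' \<in> trig g" "h' \<in> trig g"
    "\<forall>\<theta>. ((\<lambda>t. f (\<theta>(j := t))) has_real_derivative f' \<theta>) (at (\<theta> j))"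
    "\<forall>\<theta>. ((\<lambda>t. h (\<theta>(j := t))) has_real_derivative h' \<theta>) (at (\<theta> j))" by blast
  have "((\<lambda>t. f (\<theta>(j := t)) * h (\<theta>(j := t))) has_real_derivative f' \<theta> * h \<theta> + h' \<theta> * f \<theta>) (at (\<theta> j))" for \<theta>
    using DERIV_mult[OF *(3)[rule_format, of \<theta>] *(4)[rule_format, of \<theta>]] by simp
  then show ?case using * trig_mult(1,2)
    by (intro bexI[of _ "\<lambda>\<theta>. f' \<theta> * h \<theta> + h' \<theta> * f \<theta>"] trig_intros) blast+
qed

lemma pd_trig: "f \<in> trig g \<Longrightarrow> pd j f \<in> trig g"
  using trig_has_pd[of f g j] pdI by metis

lemma has_pd: "f \<in> trig g \<Longrightarrow> ((\<lambda>t. f (\<theta>(j := t))) has_real_derivative pd j f \<theta>) (at (\<theta> j))"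
  using trig_has_pd[of f g j] pdI by metis

lemma has_pd': "f \<in> trig g \<Longrightarrow> ((\<lambda>t. f (\<theta>(j := t))) has_real_derivative pd j f (\<theta>(j := t))) (at t)"
  using has_pd[of f g "\<theta>(j:=t)" j] by simp

lemma pd_const [simp]: "pd j (\<lambda>_. c) = (\<lambda>_. 0)"
  by (rule pdI) auto

lemma pd_add: "f \<in> trig g \<Longrightarrow> h \<in> trig g \<Longrightarrow> pd j (\<lambda>\<theta>. f \<theta> + h \<theta>) \<theta> = pd j f \<theta> + pd j h \<theta>"
  by (rule fun_cong[OF pdI]) (auto intro!: DERIV_add has_pd)

lemma pd_mult: "f \<in> trig g \<Longrightarrow> h \<in> trig g \<Longrightarrow> pd j (\<lambda>\<theta>. f \<theta> * h \<theta>) \<theta> = pd j f \<theta> * h \<theta> + f \<theta> * pd j h \<theta>"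
proof (rule fun_cong[OF pdI])
  fix \<theta> assume *: "f \<in> trig g" "h \<in> trig g"
  show "((\<lambda>t. f (\<theta>(j := t)) * h (\<theta>(j := t))) has_real_derivative
      pd j f \<theta> * h \<theta> + f \<theta> * pd j h \<theta>) (at (\<theta> j))"
    using DERIV_mult[OF has_pd[OF *(1), of \<theta> j] has_pd[OF *(2), of \<theta> j]]
    by (simp add: algebra_simps del: fun_upd_apply)
qed

lemma pd_cmult: "f \<in> trig g \<Longrightarrow> pd j (\<lambda>\<theta>. c * f \<theta>) \<theta> = c * pd j f \<theta>"
  by (subst pd_mult) (auto intro: trig_const)

lemma pd_sum:
  assumes "\<And>i. i \<in> A \<Longrightarrow> f i \<in> trig g"
  shows "pd j (\<lambda>\<theta>. \<Sum>i\<in>A. f i \<theta>) \<theta> = (\<Sum>i\<in>A. pd j (f i) \<theta>)"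
  using assms
proof (induction A rule: infinite_finite_induct)
  case (insert x F)
  then have "pd j (\<lambda>\<theta>. f x \<theta> + (\<Sum>i\<in>F. f i \<theta>)) \<theta> = pd j (f x) \<theta> + pd j (\<lambda>\<theta>. \<Sum>i\<in>F. f i \<theta>) \<theta>"
    by (intro pd_add trig_sum) auto
  with insert show ?case by simp
qed simp_all

lemma pd_cos: "pd j (\<lambda>\<theta>. cos (of_int k * \<theta> i)) = (\<lambda>\<theta>. if i = j then - of_int k * sin (of_int k * \<theta> j) else 0)"
  by (rule pdI) (auto intro!: derivative_eq_intros)

lemma pd_sin: "pd j (\<lambda>\<theta>. sin (of_int k * \<theta> i)) = (\<lambda>\<theta>. if i = j then of_int k * cos (of_int k * \<theta> j) else 0)"
  by (rule pdI) (auto intro!: derivative_eq_intros)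

text \<open>
  Fubini isolates the coordinate \<open>j\<close>, in which the integral of a derivative is a difference of
  boundary values; these agree because trigonometric polynomials are periodic.
\<close>

lemma integral_pd:
  assumes f: "f \<in> trig g" and j: "j < g"
  shows "integral\<^sup>L (torus g) (pd j f) = 0"
proof -
  have eq: "{..<g} = insert j ({..<g} - {j})" using j by auto
  have int: "integrable (Pi\<^sub>M (insert j ({..<g} - {j})) (\<lambda>_. circle)) (pd j f)"
    using trig_integrable[OF pd_trig[OF f]] unfolding torus_def eq[symmetric] .
  have "integral\<^sup>L (torus g) (pd j f) =
     (LINT \<theta>|Pi\<^sub>M ({..<g} - {j}) (\<lambda>_. circle). LINT t|circle. pd j f (\<theta>(j := t)))"
    unfolding torus_def using tor.product_integral_insert[OF _ _ int] unfolding eq[symmetric] by simp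
  moreover have "(LINT t|circle. pd j f (\<theta>(j := t))) = 0" for \<theta>
  proof (rule integral_circle_deriv)
    show "((\<lambda>t. f (\<theta>(j := t))) has_real_derivative pd j f (\<theta>(j := t))) (at t)" for t
      by (rule has_pd'[OF f])
    have "isCont (\<lambda>t. pd j f (\<theta>(j := t))) t" for t
      by (rule DERIV_isCont[OF has_pd'[OF pd_trig[OF f]]])
    then show "continuous_on UNIV (\<lambda>t. pd j f (\<theta>(j := t)))"
      by (simp add: continuous_on_eq_continuous_at)
    show "f (\<theta>(j := 2 * pi)) = f (\<theta>(j := 0))"
      by (rule trig_periodic[OF f]) (auto intro: exI[of _ 1] exI[of _ 0])
  qed
  ultimately show ?thesis by (simp del: fun_upd_apply)
qed

lemma trig_const_if_pd_0:
  assumes f: "f \<in> trig g" and "\<And>j \<theta>. j < g \<Longrightarrow> pd j f \<theta> = 0"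
  shows "f \<theta> = f \<phi>"
proof -
  have step: "f (\<theta>(j := t)) = f \<theta>" if "j < g" for \<theta> j t
  proof -
    have "\<forall>t. ((\<lambda>t. f (\<theta>(j := t))) has_real_derivative 0) (at t)"
      using has_pd'[OF f, of \<theta> j] assms(2)[OF that] by simp
    then have "f (\<theta>(j := t)) = f (\<theta>(j := \<theta> j))"
      by (rule DERIV_isconst_all)
    then show ?thesis by simp
  qed
  have "n \<le> g \<Longrightarrow> f (\<lambda>j. if j < n then \<phi> j else \<theta> j) = f \<theta>" for n
  proof (induction n)
    case (Suc n)
    have "(\<lambda>j. if j < Suc n then \<phi> j else \<theta> j) = (\<lambda>j. if j < n then \<phi> j else \<theta> j)(n := \<phi> n)"
      by (auto simp: fun_eq_iff less_Suc_eq)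
    with Suc step[of n] show ?case by simp
  qed simp
  from this[of g] have "f (\<lambda>j. if j < g then \<phi> j else \<theta> j) = f \<theta>" by simp
  moreover have "f (\<lambda>j. if j < g then \<phi> j else \<theta> j) = f \<phi>"
    by (rule trig_periodic[OF f]) (auto intro: exI[of _ 0])
  ultimately show ?thesis by simp
qed

lemma integral_circle_indicator_pos:
  assumes "0 \<le> a" "a < b" "b \<le> 2 * pi"
  shows "integral\<^sup>L circle (indicator {a..b}) > (0::real)"
proof -
  have "integral\<^sup>L circle (indicator {a..b}) = (LINT t|lborel. indicator {a..b} t * indicator {0..2*pi} t) / (2 * pi)"
    by (rule integral_circle) auto
  also have "(\<lambda>t. indicator {a..b} t * indicator {0..2*pi} t) = (indicator {a..b} :: real \<Rightarrow> real)"
    using assms by (auto simp: fun_eq_iff indicator_def)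
  finally show ?thesis using assms by simp
qed

text \<open>
  If \<open>f\<close> were positive at an interior point, it would by continuity dominate a positive multiple of
  the indicator of a small box there, and a box has positive measure because the measure is a product.
\<close>

lemma trig_zero_if_integral_0:
  assumes f: "f \<in> trig g" and nonneg: "\<And>\<theta>. f \<theta> \<ge> 0" and int0: "integral\<^sup>L (torus g) f = 0"
    and th: "\<And>j. j < g \<Longrightarrow> 0 < \<theta> j \<and> \<theta> j < 2 * pi"
  shows "f \<theta> = 0"
proof (rule ccontr)
  assume "f \<theta> \<noteq> 0"
  with nonneg[of \<theta>] have pos: "f \<theta> > 0" by linarith
  obtain d where d: "d > 0" "\<And>\<phi>. (\<forall>j<g. \<bar>\<phi> j - \<theta> j\<bar> < d) \<Longrightarrow> \<bar>f \<phi> - f \<theta>\<bar> < f \<theta> / 2"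
    using trig_near[OF f, of "f \<theta> / 2" \<theta>] pos by auto
  define b where "b j = min (\<theta> j + d / 2) (2 * pi)" for j
  define B where "B j = (indicator {\<theta> j..b j} :: real \<Rightarrow> real)" for j
  have [measurable]: "B j \<in> borel_measurable borel" for j by (simp add: B_def)
  have [measurable]: "j < g \<Longrightarrow> (\<lambda>\<theta>. \<theta> j) \<in> borel_measurable (torus g)" for j
    using measurable_component_singleton[of j "{..<g}" "\<lambda>_. circle"]
    by (simp add: torus_def cong: measurable_cong_sets)
  have le: "f \<theta> / 2 * (\<Prod>j<g. B j (\<phi> j)) \<le> f \<phi>" for \<phi>
  proof (cases "\<forall>j<g. \<phi> j \<in> {\<theta> j..b j}")
    case True
    then have "\<bar>f \<phi> - f \<theta>\<bar> < f \<theta> / 2" using d(1) by (intro d(2)) (auto simp: b_def)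
    then have "f \<theta> / 2 \<le> f \<phi>" by linarith
    moreover have "(\<Prod>j<g. B j (\<phi> j)) = 1" using True by (intro prod.neutral) (auto simp: B_def)
    ultimately show ?thesis by simp
  next
    case False
    then have h0: "(\<Prod>j<g. B j (\<phi> j)) = 0" by (intro prod_zero) (auto simp: B_def indicator_def)
    show ?thesis using nonneg[of \<phi>] by (simp only: h0 mult_zero_right)
  qed
  have intBj: "integrable circle (B j)" for j
  proof (rule circle.integrable_const_bound)
    show "AE t in circle. norm (B j t) \<le> 1" by (simp add: B_def)
  qed (simp add: measurable_cong_sets[OF sets_circle refl])
  have intB: "integrable (torus g) (\<lambda>\<phi>. \<Prod>j<g. B j (\<phi> j))"
  proof (rule torus.integrable_const_bound)
    have "\<bar>B j t\<bar> \<le> 1" for j t by (auto simp: B_def indicator_def)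
    then have "norm (\<Prod>j<g. B j (\<phi> j)) \<le> 1" for \<phi>
      unfolding real_norm_def abs_prod by (intro prod_le_1) simp_all
    then show "AE \<phi> in torus g. norm (\<Prod>j<g. B j (\<phi> j)) \<le> 1" by simp
  qed measurable
  have "integral\<^sup>L (torus g) (\<lambda>\<phi>. \<Prod>j<g. B j (\<phi> j)) = (\<Prod>j<g. integral\<^sup>L circle (B j))"
    unfolding torus_def
    by (rule tor.product_integral_prod) (auto intro: intBj)
  also have "\<dots> > 0"
    unfolding B_def using th d(1) by (intro prod_pos integral_circle_indicator_pos ballI)
      (auto simp: b_def intro: less_imp_le)
  finally have "0 < f \<theta> / 2 * integral\<^sup>L (torus g) (\<lambda>\<phi>. \<Prod>j<g. B j (\<phi> j))" using pos by simp
  also have "\<dots> = integral\<^sup>L (torus g) (\<lambda>\<phi>. f \<theta> / 2 * (\<Prod>j<g. B j (\<phi> j)))" by simp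
  also have "\<dots> \<le> integral\<^sup>L (torus g) f"
    using intB le by (intro integral_mono trig_integrable[OF f]) auto
  finally show False using int0 by simp
qed

section \<open>Power sums and the Weyl density\<close>
definition psum :: "nat \<Rightarrow> int \<Rightarrow> (nat \<Rightarrow> real) \<Rightarrow> real" where
  "psum g k \<theta> = (\<Sum>j<g. 2 * cos (of_int k * \<theta> j))"

text \<open>
  Weyl's density up to a constant: the square of the Weyl denominator of type C.
\<close>

definition weyl :: "nat \<Rightarrow> (nat \<Rightarrow> real) \<Rightarrow> real" where
  "weyl g \<theta> = (\<Prod>a<g. (2 * sin (\<theta> a))^2) * (\<Prod>a<g. \<Prod>b<a. (2 * cos (\<theta> a) - 2 * cos (\<theta> b))^2)"

text \<open>
  The vector field with components \<open>vf k j\<close> is \<open>-1/k\<close> times the gradient of \<open>psum g k\<close>.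
\<close>

definition vf :: "nat \<Rightarrow> nat \<Rightarrow> (nat \<Rightarrow> real) \<Rightarrow> real" where
  "vf k j \<theta> = 2 * sin (of_int (int k) * \<theta> j)"

text \<open>
  This polynomial in power sums is the divergence of the vector field \<open>vf k\<close> with respect to the
  density \<open>weyl g\<close>; see \<open>divergence_weyl_vf\<close>.  The same polynomial arises from the Casimir element
  acting on traces of matrix powers (\<open>casimir_second_order\<close>), and this coincidence is what identifies
  the distribution of the eigenangles.
\<close>

definition loop :: "nat \<Rightarrow> nat \<Rightarrow> (nat \<Rightarrow> real) \<Rightarrow> real" where
  "loop g k \<theta> = (\<Sum>i<k. psum g (2 * int i - int k) \<theta> + psum g (int i) \<theta> * psum g (int k - int i) \<theta>)"

lemma psum_trig: "psum g k \<in> trig g"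
  unfolding psum_def[abs_def] by (intro trig_intros) auto

lemma weyl_trig: "weyl g \<in> trig g"
  unfolding weyl_def[abs_def] by (intro trig_intros) auto

lemma vf_trig: "j < g \<Longrightarrow> vf k j \<in> trig g"
  unfolding vf_def[abs_def] by (intro trig_intros) auto

lemma loop_trig: "loop g k \<in> trig g"
  unfolding loop_def[abs_def] by (intro trig_intros psum_trig)

lemma weyl_nonneg: "weyl g \<theta> \<ge> 0"
  unfolding weyl_def by (intro mult_nonneg_nonneg prod_nonneg) auto

lemma pd_psum: "j < g \<Longrightarrow> pd j (psum g (int k)) \<theta> = - real k * vf k j \<theta>"
proof -
  assume j: "j < g"
  have "pd j (psum g (int k)) \<theta> = (\<Sum>i<g. pd j (\<lambda>\<theta>. 2 * cos (of_int (int k) * \<theta> i)) \<theta>)"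
    unfolding psum_def[abs_def] by (rule pd_sum[of _ _ g]) (intro trig_intros, simp)
  also have "\<dots> = (\<Sum>i<g. 2 * (if i = j then - of_int (int k) * sin (of_int (int k) * \<theta> j) else 0))"
    by (intro sum.cong refl, subst pd_cmult[of _ g]) (auto simp: pd_cos[of _ "int k", simplified] intro!: trig_cos[of _ _ "int k", simplified])
  also have "\<dots> = - real k * vf k j \<theta>"
    using j by (simp add: vf_def if_distrib[of "\<lambda>x. 2 * x"] cong: if_cong)
  finally show ?thesis .
qed

lemma pd_vf: "pd j (vf k j) \<theta> = real k * (2 * cos (of_int (int k) * \<theta> j))"
  unfolding vf_def[abs_def] using pd_cmult[of "\<lambda>\<theta>. sin (of_int (int k) * \<theta> j)" "Suc j" j 2 \<theta>]
  by (simp add: pd_sin[of j "int k", simplified] trig_sin[of j "Suc j" "int k", simplified])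

lemma pd_prod_log:
  assumes "finite A" "\<And>i. i \<in> A \<Longrightarrow> f i \<in> trig g" "\<And>i. i \<in> A \<Longrightarrow> pd j (f i) \<theta> = u i * f i \<theta>"
  shows "pd j (\<lambda>\<theta>. \<Prod>i\<in>A. f i \<theta>) \<theta> = (\<Sum>i\<in>A. u i) * (\<Prod>i\<in>A. f i \<theta>)"
  using assms
proof (induction A rule: finite_induct)
  case (insert x F)
  then have "pd j (\<lambda>\<theta>. f x \<theta> * (\<Prod>i\<in>F. f i \<theta>)) \<theta> =
      pd j (f x) \<theta> * (\<Prod>i\<in>F. f i \<theta>) + f x \<theta> * pd j (\<lambda>\<theta>. \<Prod>i\<in>F. f i \<theta>) \<theta>"
    by (intro pd_mult trig_prod) auto
  with insert show ?case by (simp add: algebra_simps)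
qed simp

lemma pd_square_log:
  assumes "f \<in> trig g" "f \<theta> \<noteq> 0"
  shows "pd j (\<lambda>\<theta>. (f \<theta>)^2) \<theta> = (2 * pd j f \<theta> / f \<theta>) * (f \<theta>)^2"
  using pd_mult[OF assms(1,1), of j \<theta>] assms(2) by (simp add: power2_eq_square)

text \<open>
  The logarithmic derivative of \<open>weyl g\<close> in the coordinate \<open>j\<close>, as a formal sum over the factors.
\<close>

definition logder :: "nat \<Rightarrow> nat \<Rightarrow> (nat \<Rightarrow> real) \<Rightarrow> real" where
  "logder g j \<theta> = (\<Sum>a<g. 2 * (if a = j then cos (\<theta> a) / sin (\<theta> a) else 0)) +
     (\<Sum>a<g. \<Sum>b<a. 2 * ((if b = j then 2 * sin (\<theta> b) else 0) - (if a = j then 2 * sin (\<theta> a) else 0))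
        / (2 * cos (\<theta> a) - 2 * cos (\<theta> b)))"

lemma weyl_nonzero_iff:
  "weyl g \<theta> \<noteq> 0 \<longleftrightarrow> (\<forall>a<g. sin (\<theta> a) \<noteq> 0) \<and> (\<forall>a<g. \<forall>b<a. cos (\<theta> a) \<noteq> cos (\<theta> b))"
  by (auto simp: weyl_def)

lemma pd_weyl:
  assumes "weyl g \<theta> \<noteq> 0"
  shows "pd j (weyl g) \<theta> = logder g j \<theta> * weyl g \<theta>"
proof -
  have nz: "\<And>a. a < g \<Longrightarrow> sin (\<theta> a) \<noteq> 0" "\<And>a b. a < g \<Longrightarrow> b < a \<Longrightarrow> cos (\<theta> a) \<noteq> cos (\<theta> b)"
    using assms by (auto simp: weyl_nonzero_iff)
  have s: "pd j (\<lambda>\<theta>. (2 * sin (\<theta> a))^2) \<theta> = 2 * (if a = j then cos (\<theta> a) / sin (\<theta> a) else 0) * (2 * sin (\<theta> a))^2"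
    if "a < g" for a
  proof -
    have "pd j (\<lambda>\<theta>. 2 * sin (\<theta> a)) \<theta> = 2 * (if a = j then cos (\<theta> a) else 0)"
      using pd_cmult[OF trig_sin1[OF that], of j 2 \<theta>] pd_sin[of j 1 a] by simp
    note d = this
    have "pd j (\<lambda>\<theta>. (2 * sin (\<theta> a))^2) \<theta> =
        (2 * pd j (\<lambda>\<theta>. 2 * sin (\<theta> a)) \<theta> / (2 * sin (\<theta> a))) * (2 * sin (\<theta> a))^2"
      using nz(1)[OF that] that
      by (intro pd_square_log[of "\<lambda>\<theta>. 2 * sin (\<theta> a)" g]) (auto intro!: trig_intros)
    also have "2 * pd j (\<lambda>\<theta>. 2 * sin (\<theta> a)) \<theta> / (2 * sin (\<theta> a)) = 2 * (if a = j then cos (\<theta> a) / sin (\<theta> a) else 0)"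
      unfolding d by simp
    finally show ?thesis .
  qed
  have c: "pd j (\<lambda>\<theta>. (2 * cos (\<theta> a) - 2 * cos (\<theta> b))^2) \<theta> =
     (2 * ((if b = j then 2 * sin (\<theta> b) else 0) - (if a = j then 2 * sin (\<theta> a) else 0))
        / (2 * cos (\<theta> a) - 2 * cos (\<theta> b))) * (2 * cos (\<theta> a) - 2 * cos (\<theta> b))^2"
    if "a < g" "b < a" for a b
  proof -
    have b: "b < g" using that by simp
    have "pd j (\<lambda>\<theta>. 2 * cos (\<theta> a) - 2 * cos (\<theta> b)) \<theta> =
        pd j (\<lambda>\<theta>. 2 * cos (\<theta> a) + (-2) * cos (\<theta> b)) \<theta>" by simp
    also have "\<dots> = 2 * pd j (\<lambda>\<theta>. cos (\<theta> a)) \<theta> + (-2) * pd j (\<lambda>\<theta>. cos (\<theta> b)) \<theta>"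
      using that b
      by (simp only: pd_add[OF trig_cmult trig_cmult, OF trig_cos1 trig_cos1] pd_cmult[OF trig_cos1[of a g]] pd_cmult[OF trig_cos1[of b g]])
    also have "\<dots> = (if b = j then 2 * sin (\<theta> b) else 0) - (if a = j then 2 * sin (\<theta> a) else 0)"
      using pd_cos[of j 1 a] pd_cos[of j 1 b] by simp
    finally have d: "pd j (\<lambda>\<theta>. 2 * cos (\<theta> a) - 2 * cos (\<theta> b)) \<theta> = \<dots>" .
    have "pd j (\<lambda>\<theta>. (2 * cos (\<theta> a) - 2 * cos (\<theta> b))^2) \<theta> =
        (2 * pd j (\<lambda>\<theta>. 2 * cos (\<theta> a) - 2 * cos (\<theta> b)) \<theta> / (2 * cos (\<theta> a) - 2 * cos (\<theta> b)))
          * (2 * cos (\<theta> a) - 2 * cos (\<theta> b))^2"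
      using nz(2)[OF that] that b
      by (intro pd_square_log[of "\<lambda>\<theta>. 2 * cos (\<theta> a) - 2 * cos (\<theta> b)" g]) (auto intro!: trig_intros)
    then show ?thesis unfolding d .
  qed
  have 1: "pd j (\<lambda>\<theta>. \<Prod>a<g. (2 * sin (\<theta> a))^2) \<theta> =
     (\<Sum>a<g. 2 * (if a = j then cos (\<theta> a) / sin (\<theta> a) else 0)) * (\<Prod>a<g. (2 * sin (\<theta> a))^2)"
    by (rule pd_prod_log[of _ _ g]) (simp_all only: finite_lessThan lessThan_iff s trig_power trig_cmult trig_sin1)
  have 2: "pd j (\<lambda>\<theta>. \<Prod>a<g. \<Prod>b<a. (2 * cos (\<theta> a) - 2 * cos (\<theta> b))^2) \<theta> =
     (\<Sum>a<g. \<Sum>b<a. 2 * ((if b = j then 2 * sin (\<theta> b) else 0) - (if a = j then 2 * sin (\<theta> a) else 0))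
        / (2 * cos (\<theta> a) - 2 * cos (\<theta> b))) * (\<Prod>a<g. \<Prod>b<a. (2 * cos (\<theta> a) - 2 * cos (\<theta> b))^2)"
    by (intro pd_prod_log[of _ _ g] finite_lessThan; ((rule c; auto) | (intro trig_intros; auto)))
  have "pd j (weyl g) \<theta> = pd j (\<lambda>\<theta>. \<Prod>a<g. (2 * sin (\<theta> a))^2) \<theta> * (\<Prod>a<g. \<Prod>b<a. (2 * cos (\<theta> a) - 2 * cos (\<theta> b))^2)
     + (\<Prod>a<g. (2 * sin (\<theta> a))^2) * pd j (\<lambda>\<theta>. \<Prod>a<g. \<Prod>b<a. (2 * cos (\<theta> a) - 2 * cos (\<theta> b))^2) \<theta>"
    unfolding weyl_def[abs_def] by (rule pd_mult) (auto intro!: trig_intros)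
  then show ?thesis unfolding 1 2 logder_def weyl_def by (simp only: distrib_right distrib_left mult_ac)
qed

section \<open>The divergence of the gradient of a power sum\<close>

lemma cos_cos_2: "2 * cos x * (2 * cos y) = 2 * cos (x + y) + 2 * cos (x - y :: real)"
  by (simp add: cos_add cos_diff)

lemma sin_sin_2: "2 * sin x * (2 * sin y) = 2 * cos (x - y) - 2 * cos (x + y :: real)"
  by (simp add: cos_add cos_diff)

text \<open>
  Multiplying each term by \<open>sin t\<close> turns it into a difference of two consecutive sines.
\<close>

lemma sin_cos_telescope:
  "2 * sin (real k * t) * cos t = sin t * (\<Sum>i<k. 2 * cos ((2 * real i - real k) * t))"
proof -
  define f where "f i = sin ((2 * real i - 1 - real k) * t)" for i
  have "sin t * (2 * cos ((2 * real i - real k) * t)) = f (Suc i) - f i" for i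
  proof -
    have "f (Suc i) = sin ((2 * real i - real k) * t + t)" "f i = sin ((2 * real i - real k) * t - t)"
      by (simp_all add: f_def algebra_simps)
    then show ?thesis by (simp add: sin_add sin_diff)
  qed
  then have "sin t * (\<Sum>i<k. 2 * cos ((2 * real i - real k) * t)) = f k - f 0"
    by (simp add: sum_distrib_left sum_lessThan_telescope)
  also have "f k = sin (real k * t - t)" by (simp add: f_def algebra_simps)
  also have "f 0 = - sin (real k * t + t)"
    unfolding f_def sin_minus[symmetric] by (simp add: algebra_simps)
  finally show ?thesis by (simp add: sin_add sin_diff)
qed

text \<open>
  The contribution of one pair of angles to \<open>\<Sum>i<k. psum g i * psum g (k - i)\<close>.
\<close>

definition tsum :: "nat \<Rightarrow> real \<Rightarrow> real \<Rightarrow> real" where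
  "tsum k s t = (\<Sum>i<k. 2 * cos (real i * s) * (2 * cos ((real k - real i) * t)))"

lemma tsum_diag: "tsum k t t = real k * (2 * cos (real k * t)) + (\<Sum>i<k. 2 * cos ((2 * real i - real k) * t))"
proof -
  have "2 * cos (real i * t) * (2 * cos ((real k - real i) * t)) = 2 * cos (real k * t) + 2 * cos ((2 * real i - real k) * t)" for i
    unfolding cos_cos_2 by (simp add: algebra_simps)
  then show ?thesis by (simp add: tsum_def sum.distrib)
qed

text \<open>
  By the product formula for cosines, multiplication by \<open>2 cos s - 2 cos t\<close> turns the \<open>i\<close>-th summand
  into differences of consecutive members of two sequences.
\<close>

lemma tsum_telescope:
  "(2 * cos s - 2 * cos t) * tsum k s t =
     2 * cos (real k * s) * (2 * cos t) - 2 * (2 * cos ((real k + 1) * t))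
     + 2 * cos s * (2 * cos (real k * t)) - 2 * (2 * cos ((real k - 1) * s))"
proof -
  define u where "u i = 2 * cos (real i * s) * (2 * cos ((real k + 1 - real i) * t))" for i
  define w where "w i = 2 * cos ((real i - 1) * s) * (2 * cos ((real k - real i) * t))" for i
  have "(2 * cos s - 2 * cos t) * (2 * cos (real i * s) * (2 * cos ((real k - real i) * t)))
     = (u (Suc i) - u i) - (w (Suc i) - w i)" for i
  proof -
    have e: "2 * cos s * (2 * cos (real i * s)) = 2 * cos ((real i + 1) * s) + 2 * cos ((real i - 1) * s)"
      unfolding cos_cos_2 by (subst cos_minus[of "s - real i * s", symmetric]) (simp add: algebra_simps)
    have e': "2 * cos t * (2 * cos ((real k - real i) * t)) = 2 * cos ((real k + 1 - real i) * t) + 2 * cos ((real k - 1 - real i) * t)"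
      unfolding cos_cos_2 by (subst cos_minus[of "t - (real k - real i) * t", symmetric]) (simp add: algebra_simps)
    have "(2 * cos s - 2 * cos t) * (2 * cos (real i * s) * (2 * cos ((real k - real i) * t))) =
      (2 * cos s * (2 * cos (real i * s))) * (2 * cos ((real k - real i) * t)) -
      2 * cos (real i * s) * (2 * cos t * (2 * cos ((real k - real i) * t)))" by (simp add: algebra_simps)
    also have "\<dots> = (u (Suc i) - u i) - (w (Suc i) - w i)"
      unfolding e e' u_def w_def by (simp add: algebra_simps)
    finally show ?thesis .
  qed
  then have "(2 * cos s - 2 * cos t) * tsum k s t = (\<Sum>i<k. (u (Suc i) - u i)) - (\<Sum>i<k. w (Suc i) - w i)"
    by (simp add: tsum_def sum_distrib_left sum_subtractf)
  also have "\<dots> = (u k - u 0) - (w k - w 0)" by (simp only: sum_lessThan_telescope)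
  finally show ?thesis by (simp add: u_def w_def)
qed

text \<open>
  Two angles enter the logarithmic derivative of the density through the pole
  \<open>1 / (2 cos s - 2 cos t)\<close>.  After symmetrization the pole cancels against the numerator on the right,
  and a polynomial in power sums is left.
\<close>

lemma tsum_offdiag:
  "(2 * cos s - 2 * cos t) * (tsum k s t + tsum k t s) =
     2 * (2 * sin t * (2 * sin (real k * t)) - 2 * sin s * (2 * sin (real k * s)))"
proof -
  have a: "2 * sin x * (2 * sin (real k * x)) = 2 * cos ((real k - 1) * x) - 2 * cos ((real k + 1) * x)" for x
    unfolding sin_sin_2 by (subst cos_minus[of "x - real k * x", symmetric]) (simp add: algebra_simps)
  have "(2 * cos s - 2 * cos t) * (tsum k s t + tsum k t s) =
     (2 * cos s - 2 * cos t) * tsum k s t - (2 * cos t - 2 * cos s) * tsum k t s" by (simp add: algebra_simps)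
  then show ?thesis unfolding tsum_telescope a by (simp add: algebra_simps)
qed

lemma sum_square_split:
  fixes F :: "nat \<Rightarrow> nat \<Rightarrow> real"
  shows "(\<Sum>a<g. \<Sum>b<g. F a b) = (\<Sum>a<g. F a a) + (\<Sum>a<g. \<Sum>b<a. F a b + F b a)"
  by (induction g) (simp_all add: sum.distrib)

text \<open>
  The factors \<open>sin\<close> of the density give the diagonal terms and the differences of cosines the
  off-diagonal terms of the double sum behind \<open>psum g i * psum g (k - i)\<close>.
\<close>

lemma sum_logder_vf:
  assumes "weyl g \<theta> \<noteq> 0"
  shows "(\<Sum>j<g. logder g j \<theta> * vf k j \<theta>) + real k * psum g (int k) \<theta> = loop g k \<theta>"
proof -
  have nz: "\<And>a. a < g \<Longrightarrow> sin (\<theta> a) \<noteq> 0" "\<And>a b. a < g \<Longrightarrow> b < a \<Longrightarrow> cos (\<theta> a) \<noteq> cos (\<theta> b)"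
    using assms by (auto simp: weyl_nonzero_iff)
  have if_sum: "(\<Sum>j<g. (if a = j then x else 0) * y j) = x * y a" if "a < g" for a x and y :: "nat \<Rightarrow> real"
    using that by (simp add: if_distrib[of "\<lambda>x. x * _"] cong: if_cong)
  have A: "(\<Sum>j<g. (\<Sum>a<g. 2 * (if a = j then cos (\<theta> a) / sin (\<theta> a) else 0)) * vf k j \<theta>)
      = 2 * (\<Sum>a<g. \<Sum>i<k. 2 * cos ((2 * real i - real k) * \<theta> a))"
  proof -
    have "(\<Sum>j<g. (\<Sum>a<g. 2 * (if a = j then cos (\<theta> a) / sin (\<theta> a) else 0)) * vf k j \<theta>)
       = (\<Sum>a<g. 2 * (\<Sum>j<g. (if a = j then cos (\<theta> a) / sin (\<theta> a) else 0) * vf k j \<theta>))"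
      unfolding sum_distrib_right sum_distrib_left by (subst sum.swap) (simp add: mult_ac)
    also have "\<dots> = (\<Sum>a<g. 2 * (\<Sum>i<k. 2 * cos ((2 * real i - real k) * \<theta> a)))"
    proof (intro sum.cong refl)
      fix a assume a: "a \<in> {..<g}"
      have "cos (\<theta> a) / sin (\<theta> a) * vf k a \<theta> = (2 * sin (real k * \<theta> a) * cos (\<theta> a)) / sin (\<theta> a)"
        by (simp add: vf_def)
      also have "\<dots> = (\<Sum>i<k. 2 * cos ((2 * real i - real k) * \<theta> a))"
        unfolding sin_cos_telescope using nz(1) a by simp
      finally show "2 * (\<Sum>j<g. (if a = j then cos (\<theta> a) / sin (\<theta> a) else 0) * vf k j \<theta>) =
         2 * (\<Sum>i<k. 2 * cos ((2 * real i - real k) * \<theta> a))" using a by (simp add: if_sum)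
    qed
    finally show ?thesis by (simp add: sum_distrib_left)
  qed
  have B: "(\<Sum>j<g. (\<Sum>a<g. \<Sum>b<a. 2 * ((if b = j then 2 * sin (\<theta> b) else 0) - (if a = j then 2 * sin (\<theta> a) else 0))
        / (2 * cos (\<theta> a) - 2 * cos (\<theta> b))) * vf k j \<theta>)
     = (\<Sum>a<g. \<Sum>b<a. tsum k (\<theta> a) (\<theta> b) + tsum k (\<theta> b) (\<theta> a))"
  proof -
    have "(\<Sum>j<g. (\<Sum>a<g. \<Sum>b<a. 2 * ((if b = j then 2 * sin (\<theta> b) else 0) - (if a = j then 2 * sin (\<theta> a) else 0))
        / (2 * cos (\<theta> a) - 2 * cos (\<theta> b))) * vf k j \<theta>)
      = (\<Sum>j<g. \<Sum>a<g. \<Sum>b<a. 2 / (2 * cos (\<theta> a) - 2 * cos (\<theta> b)) * (((if b = j then 2 * sin (\<theta> b) else 0)) * vf k j \<theta>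
         - ((if a = j then 2 * sin (\<theta> a) else 0)) * vf k j \<theta>))"
      unfolding sum_distrib_right by (intro sum.cong refl) (simp add: algebra_simps diff_divide_distrib)
    also have "\<dots> = (\<Sum>a<g. \<Sum>j<g. \<Sum>b<a. 2 / (2 * cos (\<theta> a) - 2 * cos (\<theta> b)) * (((if b = j then 2 * sin (\<theta> b) else 0)) * vf k j \<theta>
         - ((if a = j then 2 * sin (\<theta> a) else 0)) * vf k j \<theta>))"
      by (rule sum.swap)
    also have "\<dots> = (\<Sum>a<g. \<Sum>b<a. \<Sum>j<g. 2 / (2 * cos (\<theta> a) - 2 * cos (\<theta> b)) * (((if b = j then 2 * sin (\<theta> b) else 0)) * vf k j \<theta>
         - ((if a = j then 2 * sin (\<theta> a) else 0)) * vf k j \<theta>))"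
      by (intro sum.cong refl sum.swap)
    also have "\<dots> = (\<Sum>a<g. \<Sum>b<a. 2 / (2 * cos (\<theta> a) - 2 * cos (\<theta> b)) * (2 * sin (\<theta> b) * vf k b \<theta> - 2 * sin (\<theta> a) * vf k a \<theta>))"
      by (intro sum.cong refl) (auto simp only: sum_distrib_left[symmetric] sum_subtractf if_sum lessThan_iff less_trans)
    also have "\<dots> = (\<Sum>a<g. \<Sum>b<a. tsum k (\<theta> a) (\<theta> b) + tsum k (\<theta> b) (\<theta> a))"
    proof (intro sum.cong refl)
      fix a b assume "a \<in> {..<g}" "b \<in> {..<a}"
      then have nz: "2 * cos (\<theta> a) - 2 * cos (\<theta> b) \<noteq> 0" using nz(2) by auto
      have eq: "x / D * Y = T" if "D * T = x * Y" "D \<noteq> 0" for x D Y T :: real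
        using that by (simp add: field_simps)
      show "2 / (2 * cos (\<theta> a) - 2 * cos (\<theta> b)) * (2 * sin (\<theta> b) * vf k b \<theta> - 2 * sin (\<theta> a) * vf k a \<theta>) =
         tsum k (\<theta> a) (\<theta> b) + tsum k (\<theta> b) (\<theta> a)"
        using tsum_offdiag[of "\<theta> a" "\<theta> b" k] nz by (intro eq) (simp_all add: vf_def)
    qed
    finally show ?thesis .
  qed
  have C: "(\<Sum>i<k. psum g (int i) \<theta> * psum g (int k - int i) \<theta>) = (\<Sum>a<g. \<Sum>b<g. tsum k (\<theta> a) (\<theta> b))"
  proof -
    have "(\<Sum>i<k. psum g (int i) \<theta> * psum g (int k - int i) \<theta>) =
      (\<Sum>i<k. \<Sum>a<g. \<Sum>b<g. 2 * cos (real i * \<theta> a) * (2 * cos ((real k - real i) * \<theta> b)))"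
      by (simp add: psum_def sum_product)
    also have "\<dots> = (\<Sum>a<g. \<Sum>i<k. \<Sum>b<g. 2 * cos (real i * \<theta> a) * (2 * cos ((real k - real i) * \<theta> b)))"
      by (rule sum.swap)
    also have "\<dots> = (\<Sum>a<g. \<Sum>b<g. tsum k (\<theta> a) (\<theta> b))"
      unfolding tsum_def by (intro sum.cong refl sum.swap)
    finally show ?thesis .
  qed
  have D: "(\<Sum>i<k. psum g (2 * int i - int k) \<theta>) = (\<Sum>a<g. \<Sum>i<k. 2 * cos ((2 * real i - real k) * \<theta> a))"
    unfolding psum_def by (subst sum.swap) simp
  have E: "(\<Sum>a<g. tsum k (\<theta> a) (\<theta> a)) = real k * psum g (int k) \<theta> + (\<Sum>a<g. \<Sum>i<k. 2 * cos ((2 * real i - real k) * \<theta> a))"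
    by (simp add: tsum_diag sum.distrib psum_def sum_distrib_left)
  show ?thesis
    unfolding logder_def distrib_right sum.distrib A B loop_def C D
    unfolding sum_square_split[of "\<lambda>a b. tsum k (\<theta> a) (\<theta> b)"] E by (simp add: sum.distrib)
qed

section \<open>Density of the regular points\<close>

text \<open>
  Move along the line with direction \<open>(1, 2, ..., g)\<close>.  None of the functions \<open>\<theta> a\<close>,
  \<open>\<theta> a + \<theta> b\<close>, \<open>\<theta> a - \<theta> b\<close> is constant on that line, so each factor of the density
  vanishes for only countably many parameters, whereas an interval is uncountable.
\<close>

lemma ex_regular_near:
  assumes "e > 0"
  shows "\<exists>\<phi>. weyl g \<phi> \<noteq> 0 \<and> (\<forall>j<g. \<theta> j < \<phi> j \<and> \<phi> j < \<theta> j + e)"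
proof -
  define \<phi> where "\<phi> t j = \<theta> j + t * (real j + 1)" for t j
  have cnt: "countable {t. sin (a + t * b) = 0}" if "b \<noteq> 0" for a b :: real
  proof (rule countable_subset)
    show "{t. sin (a + t * b) = 0} \<subseteq> range (\<lambda>n::int. (of_int n * pi - a) / b)"
    proof
      fix t assume "t \<in> {t. sin (a + t * b) = 0}"
      then obtain n :: int where "a + t * b = of_int n * pi" by (auto simp: sin_zero_iff_int2)
      then have "t = (of_int n * pi - a) / b" using that by (simp add: field_simps)
      then show "t \<in> range (\<lambda>n::int. (of_int n * pi - a) / b)" by blast
    qed
  qed simp
  have "{t. weyl g (\<phi> t) = 0} \<subseteq> (\<Union>a<g. {t. sin (\<theta> a + t * (real a + 1)) = 0}) \<union>
     (\<Union>a<g. \<Union>b<a. {t. sin ((\<theta> a + \<theta> b) / 2 + t * ((real a + real b + 2) / 2)) = 0} \<union>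
        {t. sin ((\<theta> b - \<theta> a) / 2 + t * ((real b - real a) / 2)) = 0})" (is "_ \<subseteq> ?B")
  proof
    fix t assume "t \<in> {t. weyl g (\<phi> t) = 0}"
    then consider a where "a < g" "sin (\<phi> t a) = 0" | a b where "a < g" "b < a" "cos (\<phi> t a) = cos (\<phi> t b)"
      using weyl_nonzero_iff[of g "\<phi> t"] by auto
    then show "t \<in> ?B"
    proof cases
      case 1 then show ?thesis by (auto simp: \<phi>_def)
    next
      case 2
      have "cos (\<phi> t a) - cos (\<phi> t b) = 2 * sin ((\<phi> t a + \<phi> t b) / 2) * sin ((\<phi> t b - \<phi> t a) / 2)"
        by (rule cos_diff_cos)
      moreover have "(\<phi> t a + \<phi> t b) / 2 = (\<theta> a + \<theta> b) / 2 + t * ((real a + real b + 2) / 2)"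
        "(\<phi> t b - \<phi> t a) / 2 = (\<theta> b - \<theta> a) / 2 + t * ((real b - real a) / 2)"
        by (simp_all add: \<phi>_def field_simps)
      ultimately show ?thesis using 2 by auto
    qed
  qed
  moreover have "countable ?B" by (intro countable_Un countable_UN cnt) auto
  ultimately have "countable {t. weyl g (\<phi> t) = 0}" by (rule countable_subset)
  moreover have "uncountable {0<..<e / (real g + 1)}" using assms by (intro uncountable_open_interval[THEN iffD2]) auto
  ultimately have "\<not> {0<..<e / (real g + 1)} \<subseteq> {t. weyl g (\<phi> t) = 0}" using countable_subset by blast
  then obtain t where "t \<in> {0<..<e / (real g + 1)}" "t \<notin> {t. weyl g (\<phi> t) = 0}" by blast
  then have t: "0 < t" "t < e / (real g + 1)" "weyl g (\<phi> t) \<noteq> 0" by auto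
  have "t * (real j + 1) < e" if "j < g" for j
  proof -
    have "t * (real j + 1) \<le> t * (real g + 1)" using t that by (intro mult_left_mono) auto
    also have "\<dots> < e" using t by (simp add: field_simps)
    finally show ?thesis .
  qed
  with t show ?thesis by (intro exI[of _ "\<phi> t"]) (auto simp: \<phi>_def)
qed

lemma trig_zero_if_regular_zero:
  assumes f: "f \<in> trig g" and z: "\<And>\<theta>. weyl g \<theta> \<noteq> 0 \<Longrightarrow> f \<theta> = 0"
  shows "f \<theta> = 0"
proof (rule ccontr)
  assume "f \<theta> \<noteq> 0"
  then obtain d where d: "d > 0" "\<forall>\<phi>. (\<forall>j<g. \<bar>\<phi> j - \<theta> j\<bar> < d) \<longrightarrow> \<bar>f \<phi> - f \<theta>\<bar> < \<bar>f \<theta>\<bar>"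
    using trig_near[OF f, of "\<bar>f \<theta>\<bar>" \<theta>] by auto
  obtain \<phi> where \<phi>: "weyl g \<phi> \<noteq> 0" "\<forall>j<g. \<theta> j < \<phi> j \<and> \<phi> j < \<theta> j + d"
    using ex_regular_near[OF d(1)] by blast
  have "\<bar>f \<phi> - f \<theta>\<bar> < \<bar>f \<theta>\<bar>" using \<phi>(2) by (intro d(2)[rule_format]) auto
  with z[OF \<phi>(1)] show False by simp
qed

text \<open>
  A zero integral first gives \<open>weyl g * f\<^sup>2 = 0\<close> inside the cube.  If \<open>f\<close> were nonzero somewhere, then
  by periodicity and continuity it would be nonzero at a regular point inside the cube.
\<close>

lemma trig_zero_if_weighted_square_0:
  assumes f: "f \<in> trig g" and z: "integral\<^sup>L (torus g) (\<lambda>\<theta>. weyl g \<theta> * (f \<theta>)^2) = 0"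
  shows "f \<theta> = 0"
proof (rule ccontr)
  assume nz: "f \<theta> \<noteq> 0"
  \<comment> \<open>the representative of \<open>\<theta>\<close> in the fundamental cube\<close>
  define \<psi> where "\<psi> j = \<theta> j - 2 * pi * of_int \<lfloor>\<theta> j / (2 * pi)\<rfloor>" for j
  have r: "0 \<le> \<psi> j" "\<psi> j < 2 * pi" for j
    unfolding \<psi>_def using floor_divide_lower[of "2*pi" "\<theta> j"] floor_divide_upper[of "2*pi" "\<theta> j"]
    by (auto simp: algebra_simps)
  have "f \<theta> = f \<psi>"
    by (rule trig_periodic[OF f]) (auto simp: \<psi>_def)
  with nz have nz: "f \<psi> \<noteq> 0" by simp
  then obtain d where d: "d > 0" "\<forall>\<phi>. (\<forall>j<g. \<bar>\<phi> j - \<psi> j\<bar> < d) \<longrightarrow> \<bar>f \<phi> - f \<psi>\<bar> < \<bar>f \<psi>\<bar>"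
    using trig_near[OF f, of "\<bar>f \<psi>\<bar>" \<psi>] by auto
  \<comment> \<open>small enough to stay inside the cube, where \<open>\<psi>\<close> may lie on the lower boundary\<close>
  define e where "e = Min (insert d ((\<lambda>j. 2 * pi - \<psi> j) ` {..<g}))"
  have e: "e > 0" "e \<le> d" "\<And>j. j < g \<Longrightarrow> e \<le> 2 * pi - \<psi> j"
    unfolding e_def using d(1) r by (auto simp: Min_gr_iff)
  obtain \<phi> where \<phi>: "weyl g \<phi> \<noteq> 0" "\<forall>j<g. \<psi> j < \<phi> j \<and> \<phi> j < \<psi> j + e"
    using ex_regular_near[OF e(1)] by blast
  have "\<bar>f \<phi> - f \<psi>\<bar> < \<bar>f \<psi>\<bar>" using \<phi>(2) e(2) by (intro d(2)[rule_format]) (auto simp: abs_less_iff) 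
  then have "f \<phi> \<noteq> 0" by auto
  moreover have "weyl g \<phi> * (f \<phi>)^2 = 0"
  proof (rule trig_zero_if_integral_0[OF _ _ z])
    show "(\<lambda>\<theta>. weyl g \<theta> * (f \<theta>)^2) \<in> trig g" by (intro trig_intros weyl_trig f)
    show "0 \<le> weyl g \<theta> * (f \<theta>)^2" for \<theta> using weyl_nonneg by simp
    show "j < g \<Longrightarrow> 0 < \<phi> j \<and> \<phi> j < 2 * pi" for j
      using \<phi>(2) e(3)[of j] r(1)[of j] by (smt (verit))
  qed
  ultimately show False using \<phi>(1) by simp
qed

text \<open>
  At a regular point this is the product rule together with \<open>sum_logder_vf\<close>; both sides are
  trigonometric polynomials, so density of the regular points extends it to the whole torus.
\<close>

lemma divergence_weyl_vf:
  "(\<Sum>j<g. pd j (\<lambda>\<theta>. weyl g \<theta> * vf k j \<theta>) \<theta>) = weyl g \<theta> * loop g k \<theta>"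
proof -
  have "(\<Sum>j<g. pd j (\<lambda>\<theta>. weyl g \<theta> * vf k j \<theta>) \<theta>) - weyl g \<theta> * loop g k \<theta> = 0"
  proof (rule trig_zero_if_regular_zero[where f = "\<lambda>\<theta>. (\<Sum>j<g. pd j (\<lambda>\<theta>. weyl g \<theta> * vf k j \<theta>) \<theta>) - weyl g \<theta> * loop g k \<theta>"])
    show "(\<lambda>\<theta>. (\<Sum>j<g. pd j (\<lambda>\<theta>. weyl g \<theta> * vf k j \<theta>) \<theta>) - weyl g \<theta> * loop g k \<theta>) \<in> trig g"
      by (intro trig_intros pd_trig weyl_trig loop_trig vf_trig) auto
  next
    fix \<theta> assume nz: "weyl g \<theta> \<noteq> 0"
    have "(\<Sum>j<g. pd j (\<lambda>\<theta>. weyl g \<theta> * vf k j \<theta>) \<theta>) =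
      (\<Sum>j<g. weyl g \<theta> * (logder g j \<theta> * vf k j \<theta> + real k * (2 * cos (of_int (int k) * \<theta> j))))"
      by (intro sum.cong refl, subst pd_mult[OF weyl_trig vf_trig])
         (auto simp: pd_weyl[OF nz] pd_vf algebra_simps)
    also have "\<dots> = weyl g \<theta> * ((\<Sum>j<g. logder g j \<theta> * vf k j \<theta>) + real k * psum g (int k) \<theta>)"
      by (simp only: sum_distrib_left[symmetric] sum.distrib psum_def)
    finally show "(\<Sum>j<g. pd j (\<lambda>\<theta>. weyl g \<theta> * vf k j \<theta>) \<theta>) - weyl g \<theta> * loop g k \<theta> = 0"
      by (simp add: sum_logder_vf[OF nz])
  qed
  then show ?thesis by simp
qed

section \<open>Symmetric functions and their Laplacian\<close>

text \<open>
  The index \<open>n\<close> bounds the degree when \<open>psum g l\<close> has degree \<open>l\<close>.  It is carried along because the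
  functions of bounded degree form a finite-dimensional space that the Laplacian preserves.
\<close>

inductive symf :: "nat \<Rightarrow> nat \<Rightarrow> ((nat \<Rightarrow> real) \<Rightarrow> real) \<Rightarrow> bool" for g where
  symf_const: "symf g n (\<lambda>_. c)"
| symf_psum: "l \<le> n \<Longrightarrow> symf g n (psum g (int l))"
| symf_add: "symf g n f \<Longrightarrow> symf g n h \<Longrightarrow> symf g n (\<lambda>\<theta>. f \<theta> + h \<theta>)"
| symf_mult: "symf g n f \<Longrightarrow> symf g m h \<Longrightarrow> symf g (n + m) (\<lambda>\<theta>. f \<theta> * h \<theta>)"

lemma symf_trig: "symf g n f \<Longrightarrow> f \<in> trig g"
  by (induction rule: symf.induct) (auto intro: trig_intros psum_trig)

lemma symf_cmult: "symf g n f \<Longrightarrow> symf g n (\<lambda>\<theta>. c * f \<theta>)"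
  using symf_mult[OF symf_const[of g 0 c], of n f] by simp

lemma symf_diff: "symf g n f \<Longrightarrow> symf g n h \<Longrightarrow> symf g n (\<lambda>\<theta>. f \<theta> - h \<theta>)"
  using symf_add[OF _ symf_cmult, of g n f h "-1"] by simp

lemma symf_sum: "(\<And>i. i \<in> A \<Longrightarrow> symf g n (f i)) \<Longrightarrow> symf g n (\<lambda>\<theta>. \<Sum>i\<in>A. f i \<theta>)"
  by (induction A rule: infinite_finite_induct) (auto intro: symf_const symf_add)

lemma symf_mono: "symf g n f \<Longrightarrow> n \<le> m \<Longrightarrow> symf g m f"
  using symf_mult[OF symf_const[of g "m - n" 1], of n f] by simp

lemma symf_power: "symf g n f \<Longrightarrow> symf g (n * k) (\<lambda>\<theta>. f \<theta> ^ k)"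
  by (induction k) (auto intro: symf_const symf_mult)

lemma psum_minus: "psum g (- k) = psum g k"
  by (simp add: psum_def fun_eq_iff)

lemma symf_psum_int: "\<bar>k\<bar> \<le> int n \<Longrightarrow> symf g n (psum g k)"
  using symf_psum[of "nat \<bar>k\<bar>" n g] by (cases "k \<ge> 0") (auto simp: psum_minus)

lemma symf_loop: "symf g k (loop g k)"
  unfolding loop_def[abs_def]
proof (intro symf_sum symf_add)
  fix i assume i: "i \<in> {..<k}"
  show "symf g k (psum g (2 * int i - int k))" using i by (intro symf_psum_int) auto
  show "symf g k (\<lambda>\<theta>. psum g (int i) \<theta> * psum g (int k - int i) \<theta>)"
    using symf_mult[OF symf_psum_int[of "int i" i] symf_psum_int[of "int k - int i" "k - i"]] i by simp
qed

text \<open>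
  The scalar product of two gradients (the carre du champ).
\<close>

definition grad :: "nat \<Rightarrow> ((nat \<Rightarrow> real) \<Rightarrow> real) \<Rightarrow> ((nat \<Rightarrow> real) \<Rightarrow> real) \<Rightarrow> (nat \<Rightarrow> real) \<Rightarrow> real" where
  "grad g f u \<theta> = (\<Sum>j<g. pd j f \<theta> * pd j u \<theta>)"

lemma grad_trig: "f \<in> trig g \<Longrightarrow> u \<in> trig g \<Longrightarrow> grad g f u \<in> trig g"
  unfolding grad_def[abs_def] by (intro trig_intros pd_trig)

lemma grad_commute: "grad g f u = grad g u f"
  by (simp add: grad_def fun_eq_iff mult.commute)

lemma grad_const: "grad g f (\<lambda>_. c) = (\<lambda>_. 0)"
  by (simp add: grad_def fun_eq_iff)

lemma grad_add: "u \<in> trig g \<Longrightarrow> w \<in> trig g \<Longrightarrow>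
   grad g f (\<lambda>\<theta>. u \<theta> + w \<theta>) = (\<lambda>\<theta>. grad g f u \<theta> + grad g f w \<theta>)"
  by (simp add: grad_def fun_eq_iff pd_add distrib_left sum.distrib)

lemma grad_mult: "u \<in> trig g \<Longrightarrow> w \<in> trig g \<Longrightarrow>
   grad g f (\<lambda>\<theta>. u \<theta> * w \<theta>) = (\<lambda>\<theta>. grad g f u \<theta> * w \<theta> + u \<theta> * grad g f w \<theta>)"
  by (simp add: grad_def fun_eq_iff pd_mult distrib_left sum.distrib sum_distrib_left sum_distrib_right mult_ac)

text \<open>
  The space of symmetric functions is closed under \<open>grad\<close> because of this formula.
\<close>

lemma grad_psum: "grad g (psum g (int k)) (psum g (int l)) =
   (\<lambda>\<theta>. real (k * l) * (psum g (int k - int l) \<theta> - psum g (int k + int l) \<theta>))"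
proof
  fix \<theta>
  have "grad g (psum g (int k)) (psum g (int l)) \<theta> = (\<Sum>j<g. real (k * l) * (vf k j \<theta> * vf l j \<theta>))"
    unfolding grad_def by (intro sum.cong) (auto simp: pd_psum)
  also have "\<dots> = real (k * l) * (\<Sum>j<g. 2 * cos (of_int (int k - int l) * \<theta> j) - 2 * cos (of_int (int k + int l) * \<theta> j))"
    unfolding sum_distrib_left vf_def sin_sin_2 by (simp add: algebra_simps)
  finally show "grad g (psum g (int k)) (psum g (int l)) \<theta> = real (k * l) * (psum g (int k - int l) \<theta> - psum g (int k + int l) \<theta>)"
    by (simp add: psum_def sum_subtractf)
qed

lemma symf_grad_psum: "symf g n u \<Longrightarrow> symf g (k + n) (grad g (psum g (int k)) u)"
proof (induction rule: symf.induct)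
  case (symf_const n c) show ?case unfolding grad_const by (rule symf.symf_const)
next
  case (symf_psum l n)
  show ?case unfolding grad_psum
    by (intro symf_cmult symf_diff symf_psum_int) (use symf_psum in auto)
next
  case (symf_add n f h)
  then show ?case by (simp add: grad_add symf_trig symf.symf_add)
next
  case (symf_mult n f m h)
  have "symf g (k + n + m) (\<lambda>\<theta>. grad g (psum g (int k)) f \<theta> * h \<theta>)"
    by (rule symf.symf_mult[OF symf_mult.IH(1) symf_mult.hyps(2)])
  moreover have "symf g (n + (k + m)) (\<lambda>\<theta>. f \<theta> * grad g (psum g (int k)) h \<theta>)"
    by (rule symf.symf_mult[OF symf_mult.hyps(1) symf_mult.IH(2)])
  ultimately have "symf g (k + (n + m)) (\<lambda>\<theta>. grad g (psum g (int k)) f \<theta> * h \<theta> + f \<theta> * grad g (psum g (int k)) h \<theta>)"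
    by (intro symf.symf_add) (simp_all add: ac_simps)
  then show ?case using symf_mult.hyps by (simp add: grad_mult symf_trig)
qed

lemma symf_grad: "symf g n f \<Longrightarrow> symf g m u \<Longrightarrow> symf g (n + m) (grad g f u)"
proof (induction rule: symf.induct)
  case (symf_const n c) show ?case unfolding grad_commute[of g "\<lambda>_. c"] grad_const by (rule symf.symf_const)
next
  case (symf_psum l n)
  show ?case by (rule symf_mono[OF symf_grad_psum[OF symf_psum(2)]]) (use symf_psum in auto)
next
  case (symf_add n f h)
  then show ?case unfolding grad_commute[of g _ u] by (simp add: grad_add symf_trig symf.symf_add)
next
  case (symf_mult n f m' h)
  have IH: "symf g (n + m) (grad g u f)" "symf g (m' + m) (grad g u h)"
    using symf_mult unfolding grad_commute[of g u] by auto
  have "symf g (n + m + m') (\<lambda>\<theta>. grad g u f \<theta> * h \<theta>)"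
    by (rule symf.symf_mult[OF IH(1) symf_mult.hyps(2)])
  moreover have "symf g (n + (m' + m)) (\<lambda>\<theta>. f \<theta> * grad g u h \<theta>)"
    by (rule symf.symf_mult[OF symf_mult.hyps(1) IH(2)])
  ultimately have "symf g (n + m' + m) (\<lambda>\<theta>. grad g u f \<theta> * h \<theta> + f \<theta> * grad g u h \<theta>)"
    by (intro symf.symf_add) (simp_all add: ac_simps)
  then show ?case using symf_mult.hyps unfolding grad_commute[of g _ u] by (simp add: grad_mult symf_trig)
qed

text \<open>
  The positive Laplacian of the weighted torus is \<open>- (1 / weyl) * div (weyl * grad f)\<close>.  It is
  expressed as a relation, multiplied out by the density, because the density vanishes at the points
  that are not regular; the value \<open>h\<close> is nevertheless determined by \<open>f\<close>.
\<close>

definition lap :: "nat \<Rightarrow> ((nat \<Rightarrow> real) \<Rightarrow> real) \<Rightarrow> ((nat \<Rightarrow> real) \<Rightarrow> real) \<Rightarrow> bool" where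
  "lap g f h \<longleftrightarrow> f \<in> trig g \<and> h \<in> trig g \<and>
     (\<forall>\<theta>. weyl g \<theta> * h \<theta> = - (\<Sum>j<g. pd j (\<lambda>\<theta>. weyl g \<theta> * pd j f \<theta>) \<theta>))"

definition wint :: "nat \<Rightarrow> ((nat \<Rightarrow> real) \<Rightarrow> real) \<Rightarrow> real" where
  "wint g f = integral\<^sup>L (torus g) (\<lambda>\<theta>. weyl g \<theta> * f \<theta>)"

lemma wint_add: "f \<in> trig g \<Longrightarrow> h \<in> trig g \<Longrightarrow> wint g (\<lambda>\<theta>. f \<theta> + h \<theta>) = wint g f + wint g h"
  unfolding wint_def distrib_left
  by (intro Bochner_Integration.integral_add trig_integrable trig_intros weyl_trig)

lemma wint_cmult: "wint g (\<lambda>\<theta>. c * f \<theta>) = c * wint g f"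
proof -
  have "(\<lambda>\<theta>. weyl g \<theta> * (c * f \<theta>)) = (\<lambda>\<theta>. c * (weyl g \<theta> * f \<theta>))" by (simp add: mult_ac fun_eq_iff)
  then show ?thesis unfolding wint_def by simp
qed

lemma wint_const: "wint g (\<lambda>\<theta>. c) = c * wint g (\<lambda>_. 1)"
  using wint_cmult[of g c "\<lambda>_. 1"] by simp

lemma wint_1_pos: "wint g (\<lambda>_. 1) > 0"
proof -
  have "wint g (\<lambda>_. 1) \<noteq> 0"
    using trig_zero_if_weighted_square_0[of "\<lambda>_. 1" g undefined] by (auto simp: wint_def intro: trig_const)
  moreover have "wint g (\<lambda>_. 1) \<ge> 0" unfolding wint_def
    by (intro integral_nonneg_AE) (simp add: weyl_nonneg)
  ultimately show ?thesis by simp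
qed

text \<open>
  Green's formula: integrate the divergence of \<open>weyl * u * grad f\<close>.
\<close>

lemma wint_lap:
  assumes "lap g f h" "u \<in> trig g"
  shows "wint g (\<lambda>\<theta>. h \<theta> * u \<theta>) = wint g (grad g f u)"
proof -
  have f: "f \<in> trig g" and h: "h \<in> trig g"
    and eq: "\<And>\<theta>. weyl g \<theta> * h \<theta> = - (\<Sum>j<g. pd j (\<lambda>\<theta>. weyl g \<theta> * pd j f \<theta>) \<theta>)"
    using assms(1) by (auto simp: lap_def)
  have wt: "(\<lambda>\<theta>. weyl g \<theta> * pd j f \<theta>) \<in> trig g" for j by (intro trig_intros weyl_trig pd_trig f)
  have "0 = (\<Sum>j<g. integral\<^sup>L (torus g) (pd j (\<lambda>\<theta>. (weyl g \<theta> * pd j f \<theta>) * u \<theta>)))"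
    by (intro sum.neutral[symmetric] ballI integral_pd trig_mult wt assms(2)) auto
  also have "\<dots> = integral\<^sup>L (torus g) (\<lambda>\<theta>. \<Sum>j<g. pd j (\<lambda>\<theta>. (weyl g \<theta> * pd j f \<theta>) * u \<theta>) \<theta>)"
    by (intro Bochner_Integration.integral_sum[symmetric] trig_integrable pd_trig trig_mult wt assms(2))
  also have "(\<lambda>\<theta>. \<Sum>j<g. pd j (\<lambda>\<theta>. (weyl g \<theta> * pd j f \<theta>) * u \<theta>) \<theta>) =
      (\<lambda>\<theta>. weyl g \<theta> * grad g f u \<theta> - weyl g \<theta> * (h \<theta> * u \<theta>))"
  proof
    fix \<theta>
    have "(\<Sum>j<g. pd j (\<lambda>\<theta>. (weyl g \<theta> * pd j f \<theta>) * u \<theta>) \<theta>) =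
       (\<Sum>j<g. pd j (\<lambda>\<theta>. weyl g \<theta> * pd j f \<theta>) \<theta> * u \<theta> + weyl g \<theta> * (pd j f \<theta> * pd j u \<theta>))"
      by (intro sum.cong refl, subst pd_mult[OF wt assms(2)]) simp
    also have "\<dots> = (\<Sum>j<g. pd j (\<lambda>\<theta>. weyl g \<theta> * pd j f \<theta>) \<theta>) * u \<theta> + weyl g \<theta> * grad g f u \<theta>"
      by (simp add: sum.distrib sum_distrib_left sum_distrib_right grad_def)
    also have "(\<Sum>j<g. pd j (\<lambda>\<theta>. weyl g \<theta> * pd j f \<theta>) \<theta>) = - (weyl g \<theta> * h \<theta>)" by (simp add: eq)
    finally show "(\<Sum>j<g. pd j (\<lambda>\<theta>. (weyl g \<theta> * pd j f \<theta>) * u \<theta>) \<theta>) =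
       weyl g \<theta> * grad g f u \<theta> - weyl g \<theta> * (h \<theta> * u \<theta>)" by simp
  qed
  also have "integral\<^sup>L (torus g) \<dots> = wint g (grad g f u) - wint g (\<lambda>\<theta>. h \<theta> * u \<theta>)"
    unfolding wint_def
    by (intro Bochner_Integration.integral_diff trig_integrable trig_mult weyl_trig grad_trig f h assms(2))
  finally show ?thesis by simp
qed

lemma lap_const: "lap g (\<lambda>_. c) (\<lambda>_. 0)"
  by (simp add: lap_def trig_const)

lemma lap_add:
  assumes "lap g f h" "lap g f' h'"
  shows "lap g (\<lambda>\<theta>. f \<theta> + f' \<theta>) (\<lambda>\<theta>. h \<theta> + h' \<theta>)"
proof -
  have t: "f \<in> trig g" "f' \<in> trig g" "h \<in> trig g" "h' \<in> trig g" using assms by (auto simp: lap_def)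
  have "pd j (\<lambda>\<theta>. weyl g \<theta> * pd j (\<lambda>\<theta>. f \<theta> + f' \<theta>) \<theta>) \<theta> =
    pd j (\<lambda>\<theta>. weyl g \<theta> * pd j f \<theta>) \<theta> + pd j (\<lambda>\<theta>. weyl g \<theta> * pd j f' \<theta>) \<theta>" for j \<theta>
    unfolding pd_add[OF t(1,2)] distrib_left
    by (intro pd_add[where g = g] trig_mult weyl_trig pd_trig t)
  then show ?thesis using assms t
    by (simp add: lap_def trig_add sum.distrib distrib_left)
qed

lemma lap_mult:
  assumes "lap g f h" "lap g f' h'"
  shows "lap g (\<lambda>\<theta>. f \<theta> * f' \<theta>) (\<lambda>\<theta>. f \<theta> * h' \<theta> + f' \<theta> * h \<theta> - 2 * grad g f f' \<theta>)"
proof -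
  have t: "f \<in> trig g" "f' \<in> trig g" "h \<in> trig g" "h' \<in> trig g" using assms by (auto simp: lap_def)
  have wt: "(\<lambda>\<theta>. weyl g \<theta> * pd j f \<theta>) \<in> trig g" "(\<lambda>\<theta>. weyl g \<theta> * pd j f' \<theta>) \<in> trig g" for j
    by (rule trig_mult[OF weyl_trig pd_trig], rule t)+
  have *: "pd j (\<lambda>\<theta>. weyl g \<theta> * pd j (\<lambda>\<theta>. f \<theta> * f' \<theta>) \<theta>) \<theta> =
    f' \<theta> * pd j (\<lambda>\<theta>. weyl g \<theta> * pd j f \<theta>) \<theta> + f \<theta> * pd j (\<lambda>\<theta>. weyl g \<theta> * pd j f' \<theta>) \<theta>
      + 2 * weyl g \<theta> * (pd j f \<theta> * pd j f' \<theta>)" for j \<theta>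
  proof -
    have e: "(\<lambda>\<theta>. weyl g \<theta> * pd j (\<lambda>\<theta>. f \<theta> * f' \<theta>) \<theta>) =
      (\<lambda>\<theta>. (weyl g \<theta> * pd j f \<theta>) * f' \<theta> + (weyl g \<theta> * pd j f' \<theta>) * f \<theta>)"
      by (simp add: fun_eq_iff pd_mult[OF t(1,2)] algebra_simps)
    have "pd j (\<lambda>\<theta>. weyl g \<theta> * pd j (\<lambda>\<theta>. f \<theta> * f' \<theta>) \<theta>) \<theta> =
       pd j (\<lambda>\<theta>. (weyl g \<theta> * pd j f \<theta>) * f' \<theta>) \<theta> + pd j (\<lambda>\<theta>. (weyl g \<theta> * pd j f' \<theta>) * f \<theta>) \<theta>"
      unfolding e by (rule pd_add[OF trig_mult[OF wt(1) t(2)] trig_mult[OF wt(2) t(1)]])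
    also have "pd j (\<lambda>\<theta>. (weyl g \<theta> * pd j f \<theta>) * f' \<theta>) \<theta> =
       pd j (\<lambda>\<theta>. weyl g \<theta> * pd j f \<theta>) \<theta> * f' \<theta> + (weyl g \<theta> * pd j f \<theta>) * pd j f' \<theta>"
      by (rule pd_mult[OF wt(1) t(2)])
    also have "pd j (\<lambda>\<theta>. (weyl g \<theta> * pd j f' \<theta>) * f \<theta>) \<theta> =
       pd j (\<lambda>\<theta>. weyl g \<theta> * pd j f' \<theta>) \<theta> * f \<theta> + (weyl g \<theta> * pd j f' \<theta>) * pd j f \<theta>"
      by (rule pd_mult[OF wt(2) t(1)])
    finally show ?thesis by (simp add: algebra_simps)
  qed
  have "weyl g \<theta> * (f \<theta> * h' \<theta> + f' \<theta> * h \<theta> - 2 * grad g f f' \<theta>) =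
     - (\<Sum>j<g. pd j (\<lambda>\<theta>. weyl g \<theta> * pd j (\<lambda>\<theta>. f \<theta> * f' \<theta>) \<theta>) \<theta>)" for \<theta>
  proof -
    have "(\<Sum>j<g. pd j (\<lambda>\<theta>. weyl g \<theta> * pd j (\<lambda>\<theta>. f \<theta> * f' \<theta>) \<theta>) \<theta>) =
      f' \<theta> * (\<Sum>j<g. pd j (\<lambda>\<theta>. weyl g \<theta> * pd j f \<theta>) \<theta>) + f \<theta> * (\<Sum>j<g. pd j (\<lambda>\<theta>. weyl g \<theta> * pd j f' \<theta>) \<theta>)
      + 2 * weyl g \<theta> * grad g f f' \<theta>"
      unfolding * by (simp add: sum.distrib sum_distrib_left grad_def)
    moreover have "(\<Sum>j<g. pd j (\<lambda>\<theta>. weyl g \<theta> * pd j f \<theta>) \<theta>) = - (weyl g \<theta> * h \<theta>)"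
      "(\<Sum>j<g. pd j (\<lambda>\<theta>. weyl g \<theta> * pd j f' \<theta>) \<theta>) = - (weyl g \<theta> * h' \<theta>)"
      using assms by (auto simp: lap_def)
    ultimately show ?thesis by (simp add: algebra_simps)
  qed
  then show ?thesis unfolding lap_def
    by (intro conjI allI trig_intros grad_trig t) auto
qed

lemma lap_cmult: "lap g f h \<Longrightarrow> lap g (\<lambda>\<theta>. c * f \<theta>) (\<lambda>\<theta>. c * h \<theta>)"
  using lap_mult[OF lap_const[of g c], of f h] by (simp add: grad_commute[of g "\<lambda>_. c"] grad_const)

lemma lap_sum: "(\<And>i. i \<in> A \<Longrightarrow> lap g (f i) (h i)) \<Longrightarrow> lap g (\<lambda>\<theta>. \<Sum>i\<in>A. f i \<theta>) (\<lambda>\<theta>. \<Sum>i\<in>A. h i \<theta>)"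
  by (induction A rule: infinite_finite_induct) (auto intro: lap_const lap_add)

lemma lap_psum: "lap g (psum g (int k)) (\<lambda>\<theta>. real k * loop g k \<theta>)"
proof -
  have "pd j (\<lambda>\<theta>. weyl g \<theta> * pd j (psum g (int k)) \<theta>) \<theta> = - real k * pd j (\<lambda>\<theta>. weyl g \<theta> * vf k j \<theta>) \<theta>"
    if "j < g" for j \<theta>
  proof -
    have "(\<lambda>\<theta>. weyl g \<theta> * pd j (psum g (int k)) \<theta>) = (\<lambda>\<theta>. - real k * (weyl g \<theta> * vf k j \<theta>))"
      using that by (simp add: pd_psum fun_eq_iff)
    then show ?thesis using pd_cmult[OF trig_mult[OF weyl_trig vf_trig[OF that]], of j "- real k"] by simp
  qed
  then have "(\<Sum>j<g. pd j (\<lambda>\<theta>. weyl g \<theta> * pd j (psum g (int k)) \<theta>) \<theta>) = - real k * (weyl g \<theta> * loop g k \<theta>)" for \<theta>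
    by (simp add: divergence_weyl_vf[symmetric] sum_distrib_left)
  then show ?thesis unfolding lap_def by (intro conjI allI trig_intros psum_trig loop_trig) simp
qed

text \<open>
  Pairing with \<open>f\<close> itself shows that the weighted integral of \<open>\<bar>grad f\<bar>\<^sup>2\<close> is zero.
\<close>

lemma lap_0_const:
  assumes "lap g f (\<lambda>_. 0)" shows "f \<theta> = f \<phi>"
proof (rule trig_const_if_pd_0[where g = g and f = f])
  show f: "f \<in> trig g" using assms by (simp add: lap_def)
  fix j \<theta> assume j: "j < g"
  have "wint g (grad g f f) = 0" using wint_lap[OF assms f] wint_const[of g 0] by simp
  moreover have "wint g (grad g f f) = (\<Sum>j<g. integral\<^sup>L (torus g) (\<lambda>\<theta>. weyl g \<theta> * (pd j f \<theta>)^2))"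
    unfolding wint_def grad_def sum_distrib_left power2_eq_square
    by (intro Bochner_Integration.integral_sum trig_integrable trig_mult weyl_trig pd_trig f)
  ultimately have "integral\<^sup>L (torus g) (\<lambda>\<theta>. weyl g \<theta> * (pd j f \<theta>)^2) = 0"
    using j by (subst (asm) eq_commute, simp, subst (asm) sum_nonneg_eq_0_iff)
      (auto intro!: integral_nonneg_AE simp: weyl_nonneg)
  then show "pd j f \<theta> = 0" by (rule trig_zero_if_weighted_square_0[OF pd_trig[OF f]])
qed

section \<open>Linear dependence in bounded degree\<close>

text \<open>
  Gaussian elimination: a homogeneous linear system with more unknowns (in \<open>I\<close>) than equations (in
  \<open>B\<close>) has a nontrivial solution.
\<close>

lemma homogeneous_system:
  fixes a :: "'i \<Rightarrow> 'b \<Rightarrow> real"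
  assumes "finite B" "finite I" "card B < card I"
  shows "\<exists>c. (\<exists>i\<in>I. c i \<noteq> 0) \<and> (\<forall>b\<in>B. (\<Sum>i\<in>I. c i * a i b) = 0)"
  using assms
proof (induction B arbitrary: I a rule: finite_induct)
  case empty
  then have "I \<noteq> {}" by auto
  then show ?case by (intro exI[of _ "\<lambda>_. 1"]) auto
next
  case (insert b B)
  show ?case
  proof (cases "\<forall>i\<in>I. a i b = 0")
    case True
    obtain c where "\<exists>i\<in>I. c i \<noteq> 0" "\<forall>b\<in>B. (\<Sum>i\<in>I. c i * a i b) = 0"
      using insert.IH[of I a] insert.prems insert.hyps by auto
    with True show ?thesis by (intro exI[of _ c]) auto
  next
    case False
    then obtain p where p: "p \<in> I" "a p b \<noteq> 0" by auto
    \<comment> \<open>eliminate the unknown with index \<open>p\<close> from the equation \<open>b\<close>\<close>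
  define a' where "a' i x = a i x - a i b / a p b * a p x" for i x
    have "card B < card (I - {p})" using insert.prems insert.hyps p by (simp add: card_Diff_singleton)
    then obtain c where c: "\<exists>i\<in>I-{p}. c i \<noteq> 0" "\<forall>x\<in>B. (\<Sum>i\<in>I-{p}. c i * a' i x) = 0"
      using insert.IH[of "I-{p}" a'] insert.prems by auto
    define c' where "c' = c(p := - (\<Sum>i\<in>I-{p}. c i * a i b) / a p b)"
    have split: "(\<Sum>i\<in>I. c' i * a i x) = (\<Sum>i\<in>I-{p}. c i * a' i x)" for x
    proof -
      have "(\<Sum>i\<in>I. c' i * a i x) = c' p * a p x + (\<Sum>i\<in>I-{p}. c' i * a i x)"
        using insert.prems p by (simp add: sum.remove)
      also have "(\<Sum>i\<in>I-{p}. c' i * a i x) = (\<Sum>i\<in>I-{p}. c i * a i x)"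
        by (intro sum.cong) (auto simp: c'_def)
      also have "c' p * a p x + \<dots> = (\<Sum>i\<in>I-{p}. c i * a i x) - (\<Sum>i\<in>I-{p}. c i * a i b * (a p x / a p b))"
        by (simp add: c'_def sum_distrib_right sum_divide_distrib)
      also have "\<dots> = (\<Sum>i\<in>I-{p}. c i * a' i x)"
        by (simp add: a'_def sum_subtractf[symmetric] algebra_simps)
      finally show ?thesis .
    qed
    have "(\<Sum>i\<in>I-{p}. c i * a' i b) = 0" using p by (simp add: a'_def)
    then show ?thesis using c split by (intro exI[of _ c']) (auto simp: c'_def)
  qed
qed

definition pmon :: "nat \<Rightarrow> nat list \<Rightarrow> (nat \<Rightarrow> real) \<Rightarrow> real" where
  "pmon g ls \<theta> = (\<Prod>l\<leftarrow>ls. psum g (int l) \<theta>)"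

text \<open>
  Indices of monomials.  The bound is deliberately crude, since only finiteness matters.
\<close>

definition parts :: "nat \<Rightarrow> nat list set" where
  "parts n = {ls. set ls \<subseteq> {..n} \<and> length ls \<le> n}"

definition pspan :: "nat \<Rightarrow> nat \<Rightarrow> ((nat \<Rightarrow> real) \<Rightarrow> real) set" where
  "pspan g n = {f. \<exists>c. f = (\<lambda>\<theta>. \<Sum>ls\<in>parts n. c ls * pmon g ls \<theta>)}"

lemma finite_parts: "finite (parts n)"
  unfolding parts_def by (rule finite_lists_length_le) simp

lemma pspan_sum_pmon: "finite S \<Longrightarrow> S \<subseteq> parts n \<Longrightarrow> (\<lambda>\<theta>. \<Sum>ls\<in>S. c ls * pmon g ls \<theta>) \<in> pspan g n"
  unfolding pspan_def using finite_parts[of n]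
  by (auto intro!: exI[of _ "\<lambda>ls. if ls \<in> S then c ls else 0"] simp: fun_eq_iff sum.inter_restrict[symmetric] Int_absorb1 if_distrib[of "\<lambda>x. x * _"] cong: if_cong)

lemma pspan_pmon: "ls \<in> parts n \<Longrightarrow> (\<lambda>\<theta>. c * pmon g ls \<theta>) \<in> pspan g n"
  using pspan_sum_pmon[of "{ls}" n "\<lambda>_. c" g] by simp

lemma pspan_add: "f \<in> pspan g n \<Longrightarrow> h \<in> pspan g n \<Longrightarrow> (\<lambda>\<theta>. f \<theta> + h \<theta>) \<in> pspan g n"
proof -
  assume "f \<in> pspan g n" "h \<in> pspan g n"
  then obtain c d where "f = (\<lambda>\<theta>. \<Sum>ls\<in>parts n. c ls * pmon g ls \<theta>)" "h = (\<lambda>\<theta>. \<Sum>ls\<in>parts n. d ls * pmon g ls \<theta>)"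
    by (auto simp: pspan_def)
  then show ?thesis unfolding pspan_def
    by (intro CollectI exI[of _ "\<lambda>ls. c ls + d ls"]) (simp add: distrib_right sum.distrib)
qed

lemma pspan_0: "(\<lambda>_. 0) \<in> pspan g n"
  by (auto simp: pspan_def intro!: exI[of _ "\<lambda>_. 0"])

lemma pspan_sum: "(\<And>i. i \<in> A \<Longrightarrow> f i \<in> pspan g n) \<Longrightarrow> (\<lambda>\<theta>. \<Sum>i\<in>A. f i \<theta>) \<in> pspan g n"
  by (induction A rule: infinite_finite_induct) (auto intro: pspan_0 pspan_add)

lemma symf_pspan: "symf g n f \<Longrightarrow> f \<in> pspan g n"
proof (induction rule: symf.induct)
  case (symf_const n c)
  show ?case using pspan_pmon[of "[]" n c g] by (simp add: parts_def pmon_def)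
next
  case (symf_psum l n)
  show ?case
  proof (cases "l = 0")
    case True
    then have "psum g (int l) = (\<lambda>_. 2 * real g)" by (simp add: psum_def fun_eq_iff)
    then show ?thesis using pspan_pmon[of "[]" n "2 * real g" g] by (simp add: parts_def pmon_def)
  next
    case False
    then show ?thesis using pspan_pmon[of "[l]" n 1 g] symf_psum by (simp add: parts_def pmon_def)
  qed
next
  case (symf_add n f h) then show ?case by (intro pspan_add)
next
  case (symf_mult n f m h)
  then obtain c d where eq: "f = (\<lambda>\<theta>. \<Sum>ls\<in>parts n. c ls * pmon g ls \<theta>)" "h = (\<lambda>\<theta>. \<Sum>ls\<in>parts m. d ls * pmon g ls \<theta>)"
    by (auto simp: pspan_def)
  have "(\<lambda>\<theta>. f \<theta> * h \<theta>) = (\<lambda>\<theta>. \<Sum>a\<in>parts n. \<Sum>b\<in>parts m. (c a * d b) * pmon g (a @ b) \<theta>)"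
    unfolding eq sum_product by (simp add: pmon_def mult_ac)
  also have "\<dots> \<in> pspan g (n + m)"
    by (intro pspan_sum pspan_pmon) (auto simp: parts_def)
  finally show ?case .
qed

lemma ex_least_nonzero:
  fixes c :: "nat \<Rightarrow> real"
  assumes "i0 \<le> d" "c i0 \<noteq> 0"
  shows "\<exists>m\<le>d. c m \<noteq> 0 \<and> (\<forall>i<m. c i = 0)"
  using assms exists_least_iff[of "\<lambda>i. c i \<noteq> 0"] by (meson not_le order_trans less_imp_le)

text \<open>
  A dependence among the \<open>F i\<close>, from which the leading zero coefficients have been dropped.
\<close>

lemma pspan_dependent:
  assumes "\<And>i::nat. F i \<in> pspan g n"
  shows "\<exists>d m c. m \<le> d \<and> c m \<noteq> 0 \<and> (\<forall>\<theta>. (\<Sum>i\<in>{m..d}. c i * F i \<theta>) = (0::real))"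
proof -
  have "\<forall>i. \<exists>a. F i = (\<lambda>\<theta>. \<Sum>ls\<in>parts n. a ls * pmon g ls \<theta>)"
    using assms by (simp add: pspan_def)
  from choice[OF this] obtain a where "\<forall>i. F i = (\<lambda>\<theta>. \<Sum>ls\<in>parts n. a i ls * pmon g ls \<theta>)"
    by (elim exE) (rule that)
  then have a: "F i = (\<lambda>\<theta>. \<Sum>ls\<in>parts n. a i ls * pmon g ls \<theta>)" for i by (rule spec)
  define d where "d = card (parts n)"
  obtain c i0 where c: "i0 \<le> d" "c i0 \<noteq> 0" "\<forall>ls\<in>parts n. (\<Sum>i\<in>{..d}. c i * a i ls) = 0"
    using homogeneous_system[OF finite_parts[of n], of "{..d}" a] by (auto simp: d_def)
  obtain m where m: "m \<le> d" "c m \<noteq> 0" "\<forall>i<m. c i = 0" using ex_least_nonzero[of i0 d c, OF c(1,2)] by auto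
  have "(\<Sum>i\<in>{m..d}. c i * F i \<theta>) = 0" for \<theta>
  proof -
    have "(\<Sum>i\<in>{m..d}. c i * F i \<theta>) = (\<Sum>i\<le>d. c i * F i \<theta>)"
      by (rule sum.mono_neutral_left) (use m(3) in \<open>auto simp: not_le\<close>)
    also have "\<dots> = (\<Sum>ls\<in>parts n. (\<Sum>i\<le>d. c i * a i ls) * pmon g ls \<theta>)"
      unfolding a sum_distrib_left sum_distrib_right by (subst sum.swap) (simp add: mult_ac)
    also have "\<dots> = 0" using c(3) by simp
    finally show ?thesis .
  qed
  then have "m \<le> d \<and> c m \<noteq> 0 \<and> (\<forall>\<theta>. (\<Sum>i\<in>{m..d}. c i * F i \<theta>) = 0)" using m by simp
  then show ?thesis by (intro exI)
qed

section \<open>Functionals that satisfy the loop equations\<close>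

text \<open>
  The loop equations \<open>E_loop\<close> hold for the Weyl density, by \<open>divergence_weyl_vf\<close> and the
  vanishing of integrals of derivatives, and for Haar measure, by \<open>haar_loop\<close> below.
\<close>

locale loop_functional =
  fixes g :: nat and E :: "((nat \<Rightarrow> real) \<Rightarrow> real) \<Rightarrow> real"
  assumes E_add: "\<And>n f h. symf g n f \<Longrightarrow> symf g n h \<Longrightarrow> E (\<lambda>\<theta>. f \<theta> + h \<theta>) = E f + E h"
    and E_cmult: "\<And>n f c. symf g n f \<Longrightarrow> E (\<lambda>\<theta>. c * f \<theta>) = c * E f"
    and E_1: "E (\<lambda>_. 1) = 1"
    and E_loop: "\<And>k n f. k \<ge> 1 \<Longrightarrow> symf g n f \<Longrightarrow>
      E (\<lambda>\<theta>. loop g k \<theta> * f \<theta> + (\<Sum>j<g. vf k j \<theta> * pd j f \<theta>)) = 0"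
begin

lemma E_const: "E (\<lambda>_. c) = c"
  using E_cmult[of 0 "\<lambda>_. 1" c] E_1 by (simp add: symf_const)

lemma E_sum: "finite A \<Longrightarrow> (\<And>i. i \<in> A \<Longrightarrow> symf g n (f i)) \<Longrightarrow> E (\<lambda>\<theta>. \<Sum>i\<in>A. f i \<theta>) = (\<Sum>i\<in>A. E (f i))"
proof (induction A rule: finite_induct)
  case (insert x A)
  then have "E (\<lambda>\<theta>. f x \<theta> + (\<Sum>i\<in>A. f i \<theta>)) = E (f x) + E (\<lambda>\<theta>. \<Sum>i\<in>A. f i \<theta>)"
    by (intro E_add[of n] symf_sum) auto
  with insert show ?case by simp
qed (simp add: E_const)

text \<open>
  The last property says that \<open>E\<close> satisfies Green's formula.  It is stated with a second function
  \<open>u\<close> because only in this form does it pass to products in the induction; the case \<open>u = 1\<close> shows that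
  \<open>E\<close> annihilates Laplacians.
\<close>

lemma ex_lap:
  "symf g n f \<Longrightarrow> \<exists>h. symf g n h \<and> lap g f h \<and>
     (\<forall>m u. symf g m u \<longrightarrow> E (\<lambda>\<theta>. h \<theta> * u \<theta> - grad g f u \<theta>) = 0)"
proof (induction rule: symf.induct)
  case (symf_const n c)
  show ?case
    by (intro exI[of _ "\<lambda>_. 0"]) (auto simp: symf.symf_const lap_const grad_commute[of g "\<lambda>_. c"] grad_const E_const)
next
  case (symf_psum l n)
  have "E (\<lambda>\<theta>. real l * loop g l \<theta> * u \<theta> - grad g (psum g (int l)) u \<theta>) = 0" if u: "symf g m u" for m u
  proof (cases "l = 0")
    case True
    then have "psum g (int l) = (\<lambda>_. 2 * real g)" by (simp add: psum_def fun_eq_iff)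
    with True show ?thesis by (simp add: grad_commute[of g "\<lambda>_. 2 * real g"] grad_const E_const)
  next
    case False
    have "symf g (l + m) (\<lambda>\<theta>. real l * loop g l \<theta> * u \<theta> - grad g (psum g (int l)) u \<theta>)"
      by (intro symf_diff symf_mult symf_cmult symf_loop u symf_grad_psum)
    moreover have eq: "(\<lambda>\<theta>. real l * loop g l \<theta> * u \<theta> - grad g (psum g (int l)) u \<theta>) =
      (\<lambda>\<theta>. real l * (loop g l \<theta> * u \<theta> + (\<Sum>j<g. vf l j \<theta> * pd j u \<theta>)))"
      by (auto simp: fun_eq_iff grad_def pd_psum distrib_left sum_distrib_left mult_ac sum_negf)
    ultimately have A: "symf g (l + m) (\<lambda>\<theta>. real l * (loop g l \<theta> * u \<theta> + (\<Sum>j<g. vf l j \<theta> * pd j u \<theta>)))"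
      by (simp only: eq)
    then have "symf g (l + m) (\<lambda>\<theta>. loop g l \<theta> * u \<theta> + (\<Sum>j<g. vf l j \<theta> * pd j u \<theta>))"
      using symf_cmult[OF A, of "1 / real l"] False by simp
    then show ?thesis unfolding eq using E_cmult E_loop[of l m u] False u by simp
  qed
  moreover have "symf g n (\<lambda>\<theta>. real l * loop g l \<theta>)"
    by (rule symf_mono[OF symf_cmult[OF symf_loop] symf_psum])
  ultimately show ?case using lap_psum by (intro exI[of _ "\<lambda>\<theta>. real l * loop g l \<theta>"]) auto
next
  case (symf_add n f f')
  then obtain h h' where h: "symf g n h" "lap g f h" "\<And>m u. symf g m u \<Longrightarrow> E (\<lambda>\<theta>. h \<theta> * u \<theta> - grad g f u \<theta>) = 0"
    and h': "symf g n h'" "lap g f' h'" "\<And>m u. symf g m u \<Longrightarrow> E (\<lambda>\<theta>. h' \<theta> * u \<theta> - grad g f' u \<theta>) = 0" by auto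
  have "E (\<lambda>\<theta>. (h \<theta> + h' \<theta>) * u \<theta> - grad g (\<lambda>\<theta>. f \<theta> + f' \<theta>) u \<theta>) = 0" if u: "symf g m u" for m u
  proof -
    have e: "(\<lambda>\<theta>. (h \<theta> + h' \<theta>) * u \<theta> - grad g (\<lambda>\<theta>. f \<theta> + f' \<theta>) u \<theta>) =
       (\<lambda>\<theta>. (h \<theta> * u \<theta> - grad g f u \<theta>) + (h' \<theta> * u \<theta> - grad g f' u \<theta>))"
      unfolding grad_commute[of g _ u] grad_add[OF symf_trig[OF symf_add.hyps(1)] symf_trig[OF symf_add.hyps(2)]]
      by (simp add: fun_eq_iff algebra_simps)
    have "E (\<lambda>\<theta>. (h \<theta> * u \<theta> - grad g f u \<theta>) + (h' \<theta> * u \<theta> - grad g f' u \<theta>)) =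
        E (\<lambda>\<theta>. h \<theta> * u \<theta> - grad g f u \<theta>) + E (\<lambda>\<theta>. h' \<theta> * u \<theta> - grad g f' u \<theta>)"
      by (intro E_add[of "n + m"] symf_diff symf_mult symf_grad u h(1) h'(1) symf_add.hyps)
    then show ?thesis unfolding e using h(3)[OF u] h'(3)[OF u] by simp
  qed
  note 2 = this
  show ?case
  proof (rule exI[of _ "\<lambda>\<theta>. h \<theta> + h' \<theta>"], intro conjI allI impI)
    show "symf g n (\<lambda>\<theta>. h \<theta> + h' \<theta>)" by (rule symf.symf_add[OF h(1) h'(1)])
    show "lap g (\<lambda>\<theta>. f \<theta> + f' \<theta>) (\<lambda>\<theta>. h \<theta> + h' \<theta>)" by (rule lap_add[OF h(2) h'(2)])
    fix m u assume u: "symf g m u"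
    show "E (\<lambda>\<theta>. (h \<theta> + h' \<theta>) * u \<theta> - grad g (\<lambda>\<theta>. f \<theta> + f' \<theta>) u \<theta>) = 0"
      by (rule 2[OF u])
  qed
next
  case (symf_mult n f n' f')
  then obtain h h' where h: "symf g n h" "lap g f h" "\<And>m u. symf g m u \<Longrightarrow> E (\<lambda>\<theta>. h \<theta> * u \<theta> - grad g f u \<theta>) = 0"
    and h': "symf g n' h'" "lap g f' h'" "\<And>m u. symf g m u \<Longrightarrow> E (\<lambda>\<theta>. h' \<theta> * u \<theta> - grad g f' u \<theta>) = 0" by auto
  note ff = symf_trig[OF symf_mult.hyps(1)] symf_trig[OF symf_mult.hyps(2)]
  let ?h = "\<lambda>\<theta>. f \<theta> * h' \<theta> + f' \<theta> * h \<theta> - 2 * grad g f f' \<theta>"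
  have 1: "symf g (n + n') ?h"
  proof (intro symf_diff symf.symf_add symf_cmult symf_grad symf_mult.hyps)
    show "symf g (n + n') (\<lambda>\<theta>. f \<theta> * h' \<theta>)" by (rule symf.symf_mult[OF symf_mult.hyps(1) h'(1)])
    show "symf g (n + n') (\<lambda>\<theta>. f' \<theta> * h \<theta>)"
      using symf.symf_mult[OF symf_mult.hyps(2) h(1)] by (simp add: add.commute)
  qed
  have 2: "E (\<lambda>\<theta>. ?h \<theta> * u \<theta> - grad g (\<lambda>\<theta>. f \<theta> * f' \<theta>) u \<theta>) = 0" if u: "symf g m u" for m u
  proof -
    note ut = symf_trig[OF u]
    have e: "(\<lambda>\<theta>. ?h \<theta> * u \<theta> - grad g (\<lambda>\<theta>. f \<theta> * f' \<theta>) u \<theta>) =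
       (\<lambda>\<theta>. (h \<theta> * (f' \<theta> * u \<theta>) - grad g f (\<lambda>\<theta>. f' \<theta> * u \<theta>) \<theta>) +
         (h' \<theta> * (f \<theta> * u \<theta>) - grad g f' (\<lambda>\<theta>. f \<theta> * u \<theta>) \<theta>))"
      unfolding grad_mult[OF ff(2) ut] grad_mult[OF ff(1) ut]
      unfolding grad_commute[of g "\<lambda>\<theta>. f \<theta> * f' \<theta>" u] grad_mult[OF ff]
      unfolding grad_commute[of g u f] grad_commute[of g u f'] grad_commute[of g f' f]
      by (simp add: fun_eq_iff algebra_simps)
    have "E (\<lambda>\<theta>. (h \<theta> * (f' \<theta> * u \<theta>) - grad g f (\<lambda>\<theta>. f' \<theta> * u \<theta>) \<theta>) +
         (h' \<theta> * (f \<theta> * u \<theta>) - grad g f' (\<lambda>\<theta>. f \<theta> * u \<theta>) \<theta>)) = E (\<lambda>\<theta>. h \<theta> * (f' \<theta> * u \<theta>) - grad g f (\<lambda>\<theta>. f' \<theta> * u \<theta>) \<theta>) +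
        E (\<lambda>\<theta>. h' \<theta> * (f \<theta> * u \<theta>) - grad g f' (\<lambda>\<theta>. f \<theta> * u \<theta>) \<theta>)"
    proof (intro E_add[of "n + (n' + m)"])
      show "symf g (n + (n' + m)) (\<lambda>\<theta>. h \<theta> * (f' \<theta> * u \<theta>) - grad g f (\<lambda>\<theta>. f' \<theta> * u \<theta>) \<theta>)"
        by (intro symf_diff symf.symf_mult symf_grad u h(1) symf_mult.hyps)
      have "symf g (n' + (n + m)) (\<lambda>\<theta>. h' \<theta> * (f \<theta> * u \<theta>) - grad g f' (\<lambda>\<theta>. f \<theta> * u \<theta>) \<theta>)"
        by (intro symf_diff symf.symf_mult symf_grad u h'(1) symf_mult.hyps)
      then show "symf g (n + (n' + m)) (\<lambda>\<theta>. h' \<theta> * (f \<theta> * u \<theta>) - grad g f' (\<lambda>\<theta>. f \<theta> * u \<theta>) \<theta>)"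
        by (simp add: add.left_commute)
    qed
    then show ?thesis unfolding e using h(3)[OF symf.symf_mult[OF symf_mult.hyps(2) u]] h'(3)[OF symf.symf_mult[OF symf_mult.hyps(1) u]] by simp
  qed
  have 3: "lap g (\<lambda>\<theta>. f \<theta> * f' \<theta>) ?h" by (rule lap_mult[OF h(2) h'(2)])
  show ?case
  proof (rule exI[of _ ?h], intro conjI allI impI)
    show "symf g (n + n') ?h" by (rule 1)
    show "lap g (\<lambda>\<theta>. f \<theta> * f' \<theta>) ?h" by (rule 3)
    fix m u assume u: "symf g m u"
    show "E (\<lambda>\<theta>. ?h \<theta> * u \<theta> - grad g (\<lambda>\<theta>. f \<theta> * f' \<theta>) u \<theta>) = 0" by (rule 2[OF u])
  qed
qed

text \<open>
  \<open>E\<close> and the normalized Weyl integral agree on \<open>1\<close> and both annihilate Laplacians, so it is enough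
  to write \<open>f\<close> as a constant plus Laplacians.  The iterated Laplacians \<open>F i\<close> of \<open>f\<close> stay in a
  finite-dimensional space, hence satisfy a linear relation.  If the relation starts with \<open>F m\<close>, it is
  the \<open>m\<close>-fold Laplacian of a combination \<open>H 0\<close> that starts with \<open>F 0 = f\<close>.  A Laplacian has
  integral zero, so a constant Laplacian is zero and its argument is constant; going down from
  \<open>H m = 0\<close> shows that \<open>H 0\<close> is constant.
\<close>

theorem E_eq_wint:
  assumes f: "symf g n f"
  shows "E f * wint g (\<lambda>_. 1) = wint g f"
proof -
  have "\<exists>h. symf g n h \<and> lap g f h \<and> E h = 0" if "symf g n f" for f
  proof -
    from ex_lap[OF that] obtain h where h: "symf g n h" "lap g f h"
      "\<forall>m u. symf g m u \<longrightarrow> E (\<lambda>\<theta>. h \<theta> * u \<theta> - grad g f u \<theta>) = 0" by blast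
    have "E (\<lambda>\<theta>. h \<theta> * 1 - grad g f (\<lambda>_. 1) \<theta>) = 0"
      by (rule h(3)[rule_format, OF symf_const[of g 0 1]])
    with h show ?thesis by (auto simp: grad_const)
  qed
  then obtain L where L: "\<And>f. symf g n f \<Longrightarrow> symf g n (L f) \<and> lap g f (L f) \<and> E (L f) = 0" by metis
  define F where "F i = (L ^^ i) f" for i
  have F: "symf g n (F i)" for i by (induction i) (auto simp: F_def f L)
  have lapF: "lap g (F i) (F (Suc i))" and EF: "E (F (Suc i)) = 0" for i
    using L[OF F[of i]] by (auto simp: F_def)
  have WF: "wint g (F (Suc i)) = 0" for i
    using wint_lap[OF lapF[of i] trig_const[of 1]] wint_const[of g 0] by (simp add: grad_const)
  have "\<exists>d m c. m \<le> d \<and> c m \<noteq> 0 \<and> (\<forall>\<theta>. (\<Sum>i\<in>{m..d}. c i * F i \<theta>) = 0)"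
    by (rule pspan_dependent, rule symf_pspan, rule F)
  then obtain d m c where dc: "m \<le> d \<and> c m \<noteq> 0 \<and> (\<forall>\<theta>. (\<Sum>i\<in>{m..d}. c i * F i \<theta>) = 0)"
    by (elim exE) (rule that)
  note m = conjunct1[OF dc] conjunct1[OF conjunct2[OF dc]]
  define H where "H t \<theta> = (\<Sum>i\<in>{m..d}. c i * F (i - m + t) \<theta>)" for t \<theta>
  have lapH: "lap g (H t) (H (Suc t))" for t
    unfolding H_def[abs_def] using lap_sum[OF lap_cmult[OF lapF]] by simp
  have Hm: "H m \<theta> = 0" for \<theta>
  proof -
    have "H m \<theta> = (\<Sum>i\<in>{m..d}. c i * F i \<theta>)" unfolding H_def by (intro sum.cong) auto
    then show ?thesis using conjunct2[OF conjunct2[OF dc]] by simp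
  qed
  have "t \<le> m \<Longrightarrow> \<exists>\<kappa>. \<forall>\<theta>. H (m - t) \<theta> = \<kappa>" for t
  proof (induction t)
    case 0 then show ?case using Hm by auto
  next
    case (Suc t)
    then obtain \<kappa> where "\<forall>\<theta>. H (m - t) \<theta> = \<kappa>" by auto
    moreover have s: "Suc (m - Suc t) = m - t" using Suc by auto
    ultimately have eq: "H (Suc (m - Suc t)) = (\<lambda>_. \<kappa>)" by auto
    have "wint g (H (Suc (m - Suc t))) = 0"
      using wint_lap[OF lapH[of "m - Suc t"] trig_const[of 1]] wint_const[of g 0] by (simp add: grad_const)
    then have "\<kappa> = 0" unfolding eq using wint_const[of g \<kappa>] wint_1_pos[of g] by simp
    then have "lap g (H (m - Suc t)) (\<lambda>_. 0)" using lapH[of "m - Suc t"] eq by simp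
    then show ?case using lap_0_const by blast
  qed
  from this[of m] obtain \<kappa> where \<kappa>: "H 0 = (\<lambda>_. \<kappa>)" by auto
  have H0: "H 0 = (\<lambda>\<theta>. \<Sum>i\<in>{m..d}. c i * F (i - m) \<theta>)" by (simp add: H_def fun_eq_iff)
  have split: "(\<Sum>i\<in>{m..d}. c i * x (i - m)) = c m * x 0" if "\<And>i. x (Suc i) = 0" for x :: "nat \<Rightarrow> real"
  proof -
    have "(\<Sum>i\<in>{m..d}. c i * x (i - m)) = (\<Sum>i\<in>{m}. c i * x (i - m))"
      using m(1) that by (intro sum.mono_neutral_right) (auto simp: gr0_conv_Suc dest!: le_neq_implies_less less_imp_Suc_add)
    then show ?thesis by simp
  qed
  have "\<kappa> = E (H 0)" by (simp add: \<kappa> E_const)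
  also have "\<dots> = (\<Sum>i\<in>{m..d}. c i * E (F (i - m)))"
    unfolding H0 by (subst E_sum[of _ n]) (auto intro!: symf_cmult F simp: E_cmult[OF F])
  also have "\<dots> = c m * E f" using split[of "\<lambda>i. E (F i)"] EF by (simp add: F_def)
  finally have 1: "\<kappa> = c m * E f" .
  have wsum: "finite A \<Longrightarrow> wint g (\<lambda>\<theta>. \<Sum>i\<in>A. c i * F (i - m) \<theta>) = (\<Sum>i\<in>A. c i * wint g (F (i - m)))" for A
    by (induction A rule: finite_induct)
       (auto simp: wint_const[of g 0] wint_add[OF trig_cmult[OF symf_trig[OF F]] trig_sum[OF trig_cmult[OF symf_trig[OF F]]]] wint_cmult)
  have "\<kappa> * wint g (\<lambda>_. 1) = wint g (H 0)" by (simp add: \<kappa> wint_const[of g \<kappa>])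
  also have "\<dots> = (\<Sum>i\<in>{m..d}. c i * wint g (F (i - m)))" unfolding H0 by (rule wsum) simp
  also have "\<dots> = c m * wint g f" using split[of "\<lambda>i. wint g (F i)"] WF by (simp add: F_def)
  finally show ?thesis using 1 m(2) by simp
qed

end

section \<open>Traces of powers and eigenvalues\<close>
definition enum_index :: "nat \<Rightarrow> 'n::finite" where
  "enum_index = (SOME e. bij_betw e {0..<CARD('n)} UNIV)"

lemma bij_enum_index: "bij_betw (enum_index :: nat \<Rightarrow> 'n::finite) {0..<CARD('n)} UNIV"
proof -
  have "\<exists>e. bij_betw e {0..<CARD('n)} (UNIV :: 'n set)" by (rule ex_bij_betw_nat_finite) simp
  then show ?thesis unfolding enum_index_def by (rule someI_ex)
qed

text \<open>
  Triangularization needs an ordering of the indices; \<open>jmat\<close> transports a matrix with a finite index type to that setting.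
\<close>

definition jmat :: "'a ^ 'n ^ 'n::finite \<Rightarrow> 'a Matrix.mat" where
  "jmat A = Matrix.mat CARD('n) CARD('n) (\<lambda>(i, j). A $ enum_index i $ enum_index j)"

lemma jmat_carrier: "jmat (A :: 'a ^ 'n ^ 'n::finite) \<in> carrier_mat CARD('n) CARD('n)"
  by (simp add: jmat_def)

lemma sum_enum_index: "(\<Sum>i\<in>(UNIV::'n::finite set). f i) = (\<Sum>i = 0..<CARD('n). f (enum_index i))"
  by (rule sum.reindex_bij_betw[OF bij_enum_index, symmetric])

lemma det_jmat:
  fixes A :: "'a::comm_ring_1 ^ 'n ^ 'n::finite"
  shows "Determinant.det (jmat A) = det A"
proof -
  let ?N = "{0..<CARD('n)}" and ?e = "enum_index :: nat \<Rightarrow> 'n"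
  note b = bij_enum_index[where 'n = 'n]
  have inj: "inj_on ?e ?N" using b by (simp add: bij_betw_def)
  have "det A = (\<Sum>p | p permutes ?N. signof p * (\<Prod>i = 0..<CARD('n). jmat A $$ (i, p i)))"
    unfolding Determinants.det_def
  proof (rule sum.reindex_bij_witness[where i = "map_permutation ?N ?e" and j = "map_permutation UNIV (inv_into ?N ?e)"])
    fix p assume "p \<in> {p. p permutes (UNIV :: 'n set)}"
    then have p: "p permutes UNIV" by simp
    have b': "bij_betw (inv_into ?N ?e) UNIV ?N" by (rule bij_betw_inv_into[OF b])
    show 1: "map_permutation ?N ?e (map_permutation UNIV (inv_into ?N ?e) p) = p"
      by (rule map_permutation_compose_inv[OF b' p]) (use b in \<open>auto simp: bij_betw_def f_inv_into_f\<close>)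
    let ?q = "map_permutation UNIV (inv_into ?N ?e) p"
    show q: "?q \<in> {p. p permutes ?N}" using map_permutation_permutes[OF b' p] by simp
    have s: "sign ?q = sign p" by (rule sign_map_permutation) (use p b' in \<open>auto simp: bij_betw_def\<close>)
    have "(\<Prod>i\<in>UNIV. A $ i $ p i) = (\<Prod>i = 0..<CARD('n). A $ ?e i $ p (?e i))"
      by (rule prod.reindex_bij_betw[OF b, symmetric])
    also have "\<dots> = (\<Prod>i = 0..<CARD('n). jmat A $$ (i, ?q i))"
    proof (rule prod.cong[OF refl])
      fix i assume i: "i \<in> ?N"
      have "p (?e i) = ?e (?q i)"
        using map_permutation_apply[OF inj i, of ?q] by (simp add: 1)
      moreover have "?q i \<in> ?N" using q i by (simp add: permutes_in_image del: atLeastLessThan_iff)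
      ultimately show "A $ ?e i $ p (?e i) = jmat A $$ (i, ?q i)" using i by (simp add: jmat_def)
    qed
    finally show "signof ?q * (\<Prod>i = 0..<CARD('n). jmat A $$ (i, ?q i)) = of_int (sign p) * (\<Prod>i\<in>UNIV. A $ i $ p i)"
      by (simp add: s)
  next
    fix q assume "q \<in> {p. p permutes ?N}"
    then have q: "q permutes ?N" by simp
    show "map_permutation UNIV (inv_into ?N ?e) (map_permutation ?N ?e q) = q"
      by (rule map_permutation_compose_inv[OF b q]) (use inj in auto)
    show "map_permutation ?N ?e q \<in> {p. p permutes UNIV}" using map_permutation_permutes[OF b q] by simp
  qed
  also have "\<dots> = Determinant.det (jmat A)" by (rule det_def'[OF jmat_carrier, symmetric])
  finally show ?thesis ..
qed

lemma jmat_mult: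
  fixes A B :: "'a::comm_ring_1 ^ 'n ^ 'n::finite"
  shows "jmat (A ** B) = jmat A * jmat B"
  by (rule eq_matI) (auto simp: jmat_def matrix_matrix_mult_def scalar_prod_def sum_enum_index)

lemma enum_index_eq_iff: "i < CARD('n) \<Longrightarrow> j < CARD('n) \<Longrightarrow> (enum_index i :: 'n::finite) = enum_index j \<longleftrightarrow> i = j"
  using bij_enum_index[where 'n = 'n] by (auto simp: bij_betw_def inj_on_def)

lemma jmat_1: "jmat (mat 1 :: 'a::comm_ring_1 ^ 'n ^ 'n::finite) = 1\<^sub>m CARD('n)"
  by (rule eq_matI) (auto simp: jmat_def mat_def enum_index_eq_iff)

primrec mpow :: "'a::comm_ring_1 ^ 'n ^ 'n::finite \<Rightarrow> nat \<Rightarrow> 'a ^ 'n ^ 'n" where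
  "mpow A 0 = mat 1"
| "mpow A (Suc k) = A ** mpow A k"

lemma mpow_add: "mpow A (i + j) = mpow A i ** mpow A j"
  by (induction i) (simp_all add: matrix_mul_assoc)

lemma mpow_Suc2: "mpow A (Suc k) = mpow A k ** A"
  using mpow_add[of A k 1] by simp

lemma jmat_mpow: "jmat (mpow A k) = jmat A ^\<^sub>m k"
proof (induction k)
  case 0 then show ?case using jmat_carrier[of A] by (simp add: jmat_1)
next
  case (Suc k)
  then show ?case unfolding mpow_Suc2 jmat_mult by simp
qed

lemma trace_jmat: "trace (A :: 'a::comm_ring_1 ^ 'n ^ 'n::finite) = sum_list (diag_mat (jmat A))"
  by (simp add: trace_def diag_mat_def jmat_def sum_enum_index sum_list_sum_nth atLeast0LessThan)

lemma charpoly_jmat: "charpoly A = char_poly (jmat A)"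
proof -
  have "char_poly_matrix (jmat A) = jmat (\<chi> i j. (if i = j then [:0, 1:] else 0) - [:A $ i $ j:])"
    by (rule eq_matI) (auto simp: char_poly_matrix_def jmat_def enum_index_eq_iff)
  then show ?thesis by (simp add: charpoly_def char_poly_def det_jmat)
qed

lemma sum_list_diag_mult_commute:
  fixes X Y :: "'a::comm_ring_1 Matrix.mat"
  assumes "X \<in> carrier_mat n n" "Y \<in> carrier_mat n n"
  shows "sum_list (diag_mat (X * Y)) = sum_list (diag_mat (Y * X))"
proof -
  have *: "sum_list (diag_mat (X * Y)) = (\<Sum>i<n. \<Sum>j<n. X $$ (i, j) * Y $$ (j, i))"
    if "X \<in> carrier_mat n n" "Y \<in> carrier_mat n n" for X Y :: "'a Matrix.mat"
    using that by (auto simp: diag_mat_def sum_list_sum_nth scalar_prod_def atLeast0LessThan intro!: sum.cong)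
  show ?thesis unfolding *[OF assms] *[OF assms(2,1)] by (subst sum.swap) (simp add: mult.commute)
qed

lemma upper_triangular_pow:
  fixes B :: "'a::comm_ring_1 Matrix.mat"
  assumes B: "B \<in> carrier_mat n n" "upper_triangular B"
  shows "upper_triangular (B ^\<^sub>m k) \<and> (\<forall>i<n. (B ^\<^sub>m k) $$ (i, i) = B $$ (i, i) ^ k)"
proof (induction k)
  case 0 then show ?case using B by auto
next
  case (Suc k)
  note Bk = pow_carrier_mat[OF B(1), of k]
  have z: "(B ^\<^sub>m k) $$ (i, j) = 0" if "j < i" "i < n" for i j using Suc Bk that by auto
  have z': "B $$ (i, j) = 0" if "j < i" "i < n" for i j using B that by auto
  have e: "(B ^\<^sub>m Suc k) $$ (i, j) = (\<Sum>l<n. (B ^\<^sub>m k) $$ (i, l) * B $$ (l, j))" if "i < n" "j < n" for i j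
    using that Bk B by (auto simp: scalar_prod_def atLeast0LessThan intro!: sum.cong)
  show ?case
  proof
    show "upper_triangular (B ^\<^sub>m Suc k)"
    proof
      fix i j assume ij: "j < i" "i < dim_row (B ^\<^sub>m Suc k)"
      then have "i < n" using pow_carrier_mat[OF B(1), of "Suc k"] by auto
      with ij have "(B ^\<^sub>m Suc k) $$ (i, j) = (\<Sum>l<n. (B ^\<^sub>m k) $$ (i, l) * B $$ (l, j))" by (intro e) auto
      also have "\<dots> = 0"
      proof (rule sum.neutral, rule ballI)
        fix l assume "l \<in> {..<n}"
        then show "(B ^\<^sub>m k) $$ (i, l) * B $$ (l, j) = 0"
          using z[of l i] z'[of j l] ij \<open>i < n\<close> by (cases "l < i") auto
      qed
      finally show "(B ^\<^sub>m Suc k) $$ (i, j) = 0" .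
    qed
    show "\<forall>i<n. (B ^\<^sub>m Suc k) $$ (i, i) = B $$ (i, i) ^ Suc k"
    proof (intro allI impI)
      fix i assume i: "i < n"
      have "(B ^\<^sub>m Suc k) $$ (i, i) = (\<Sum>l<n. (B ^\<^sub>m k) $$ (i, l) * B $$ (l, i))" by (rule e[OF i i])
      also have "\<dots> = (\<Sum>l\<in>{i}. (B ^\<^sub>m k) $$ (i, l) * B $$ (l, i))"
      proof (rule sum.mono_neutral_right)
        show "\<forall>l\<in>{..<n} - {i}. (B ^\<^sub>m k) $$ (i, l) * B $$ (l, i) = 0"
        proof
          fix l assume "l \<in> {..<n} - {i}"
          then show "(B ^\<^sub>m k) $$ (i, l) * B $$ (l, i) = 0"
            using z[of l i] z'[of i l] i by (cases "l < i") auto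
        qed
      qed (use i in auto)
      finally show "(B ^\<^sub>m Suc k) $$ (i, i) = B $$ (i, i) ^ Suc k" using Suc i by simp
    qed
  qed
qed

lemma proots_linear_factors: "proots (\<Prod>a\<leftarrow>as. [:- a, 1:]) = mset (as :: complex list)"
proof (induction as)
  case (Cons a as)
  have "(\<Prod>a\<leftarrow>as. [:- a, 1:]) \<noteq> 0" by (auto simp: prod_list_zero_iff)
  with Cons show ?case by (simp add: proots_mult del: mult_pCons_left)
qed simp

lemma eigenvalues_factorization:
  fixes A :: "complex ^ 'n ^ 'n::finite"
  obtains as where "char_poly (jmat A) = (\<Prod>a\<leftarrow>as. [:- a, 1:])" "eigenvalues A = mset as" "length as = CARD('n)"
  using char_poly_factorized[OF jmat_carrier[of A]] that
  by (auto simp: eigenvalues_def charpoly_jmat proots_linear_factors)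

text \<open>
  Powers of a triangular matrix have the powers of the eigenvalues on the diagonal, and the trace is
  invariant under similarity.
\<close>

lemma trace_mpow: "trace (mpow A k) = power_sum k A" for A :: "complex ^ 'n ^ 'n::finite"
proof -
  let ?n = "CARD('n)"
  note A = jmat_carrier[of A]
  obtain as where as: "char_poly (jmat A) = (\<Prod>a\<leftarrow>as. [:- a, 1:])" "eigenvalues A = mset as"
    by (rule eigenvalues_factorization)
  obtain B where B: "B \<in> carrier_mat ?n ?n" "upper_triangular B" "similar_mat (jmat A) B"
    using schur_decomposition_exists[OF A as(1)] by auto
  have "char_poly (jmat A) = (\<Prod>a\<leftarrow>diag_mat B. [:- a, 1:])"
    using char_poly_similar[OF B(3)] char_poly_upper_triangular[OF B(1,2)] by simp
  then have ev: "eigenvalues A = mset (diag_mat B)"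
    by (simp add: eigenvalues_def charpoly_jmat proots_linear_factors)
  obtain P Q where wit: "similar_mat_wit (jmat A) B P Q" using B(3) by (auto simp: similar_mat_def)
  note PQ = similar_mat_witD2[OF A wit]
  note Bk = pow_carrier_mat[OF B(1), of k]
  have "trace (mpow A k) = sum_list (diag_mat (P * (B ^\<^sub>m k) * Q))"
    by (simp add: trace_jmat jmat_mpow similar_mat_wit_pow_id[OF wit])
  also have "\<dots> = sum_list (diag_mat (Q * (P * (B ^\<^sub>m k))))"
    by (rule sum_list_diag_mult_commute[of _ ?n]) (use PQ Bk in auto)
  also have "Q * (P * (B ^\<^sub>m k)) = (Q * P) * (B ^\<^sub>m k)"
    by (rule assoc_mult_mat[symmetric, of _ ?n ?n _ ?n _ ?n]) (use PQ Bk in auto)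
  also have "\<dots> = B ^\<^sub>m k" using PQ Bk by simp
  also have "sum_list (diag_mat (B ^\<^sub>m k)) = (\<Sum>i<?n. B $$ (i, i) ^ k)"
    using Bk upper_triangular_pow[OF B(1,2), of k]
    by (auto simp: diag_mat_def sum_list_sum_nth atLeast0LessThan intro!: sum.cong)
  also have "\<dots> = power_sum k A"
  proof -
    have "power_sum k A = (\<Sum>z\<in>#mset (diag_mat B). z ^ k)" unfolding power_sum_def ev ..
    also have "\<dots> = sum_list (map (\<lambda>z. z ^ k) (diag_mat B))"
      by (metis mset_map sum_mset_sum_list)
    also have "\<dots> = (\<Sum>i<?n. B $$ (i, i) ^ k)"
      using B(1) by (simp add: diag_mat_def sum_list_sum_nth atLeast0LessThan)
    finally show ?thesis by simp
  qed
  finally show ?thesis .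
qed

section \<open>The compact symplectic group\<close>

lemma symp_form_nth [simp]:
  "symp_form $ Inl a $ Inl b = 0" "symp_form $ Inr a $ Inr b = 0"
  "symp_form $ Inl a $ Inr b = (if a = b then 1 else 0)"
  "symp_form $ Inr a $ Inl b = (if a = b then -1 else 0)"
  by (simp_all add: symp_form_def)

lemma UNIV_sum_split: "(\<Sum>i\<in>(UNIV::('a::finite + 'b::finite) set). f i) = (\<Sum>a\<in>UNIV. f (Inl a)) + (\<Sum>b\<in>UNIV. f (Inr b))"
  by (simp add: UNIV_Plus_UNIV[symmetric] sum.Plus del: UNIV_Plus_UNIV)

lemma UNIV_prod_split:
  fixes f :: "'a::finite + 'b::finite \<Rightarrow> 'c::comm_monoid_mult"
  shows "(\<Prod>i\<in>UNIV. f i) = (\<Prod>a\<in>UNIV. f (Inl a)) * (\<Prod>b\<in>UNIV. f (Inr b))"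
  by (simp add: UNIV_Plus_UNIV[symmetric] prod.Plus del: UNIV_Plus_UNIV)

lemma matrix_neg_mult_left: "(- A) ** B = - (A ** B)" for A :: "'a::comm_ring_1 ^ 'n::finite ^ 'm"
  by (simp add: matrix_matrix_mult_def vec_eq_iff sum_negf)

lemma matrix_neg_mult_right: "A ** (- B) = - (A ** B)" for A :: "'a::comm_ring_1 ^ 'n::finite ^ 'm"
  by (simp add: matrix_matrix_mult_def vec_eq_iff sum_negf)

lemma symp_form_transpose: "transpose symp_form = - symp_form"
  by (auto simp: vec_eq_iff transpose_def symp_form_def split: sum.splits)

lemma symp_form_square: "symp_form ** symp_form = (- mat 1 :: complex ^ ('g::finite + 'g) ^ ('g + 'g))"
proof -
  have "(symp_form ** symp_form) $ i $ j = (- mat 1 :: complex ^ ('g + 'g) ^ ('g + 'g)) $ i $ j" for i j :: "'g + 'g"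
    by (cases i; cases j)
       (auto simp: matrix_matrix_mult_def UNIV_sum_split mat_def if_distrib[of "\<lambda>x. _ * x"] cong: if_cong)
  then show ?thesis by (simp add: vec_eq_iff)
qed

lemma USp_left_inverse: "A \<in> USp \<Longrightarrow> conj_transpose A ** A = mat 1"
  by (simp add: USp_def)

lemma USp_right_inverse: "A \<in> USp \<Longrightarrow> A ** conj_transpose A = mat 1"
  using matrix_left_right_inverse[of "conj_transpose A" A] by (simp add: USp_def)

lemma USp_symp: "A \<in> USp \<Longrightarrow> transpose A ** symp_form ** A = symp_form"
  by (simp add: USp_def)

lemma conj_transpose_mult: "conj_transpose (A ** B) = conj_transpose B ** conj_transpose A"
  by (simp add: conj_transpose_def matrix_matrix_mult_def vec_eq_iff mult.commute)

lemma conj_transpose_conj_transpose [simp]: "conj_transpose (conj_transpose A) = A"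
  by (simp add: conj_transpose_def vec_eq_iff)

lemma conj_transpose_1 [simp]: "conj_transpose (mat 1) = mat 1"
  by (simp add: conj_transpose_def mat_def vec_eq_iff)

lemma USp_mult: "A \<in> USp \<Longrightarrow> B \<in> USp \<Longrightarrow> A ** B \<in> USp"
proof -
  assume A: "A \<in> USp" and B: "B \<in> USp"
  have "conj_transpose (A ** B) ** (A ** B) = conj_transpose B ** (conj_transpose A ** A) ** B"
    by (simp add: conj_transpose_mult matrix_mul_assoc)
  moreover have "transpose (A ** B) ** symp_form ** (A ** B) = transpose B ** (transpose A ** symp_form ** A) ** B"
    by (simp add: matrix_transpose_mul matrix_mul_assoc)
  ultimately show ?thesis using A B by (simp add: USp_def)
qed

lemma USp_conj_transpose: "A \<in> USp \<Longrightarrow> conj_transpose A \<in> USp"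
proof -
  assume A: "A \<in> USp"
  let ?A = "conj_transpose A"
  have t: "transpose ?A ** transpose A = mat 1"
    using USp_right_inverse[OF A] by (metis matrix_transpose_mul transpose_mat)
  have "transpose ?A ** symp_form ** ?A = transpose ?A ** (transpose A ** symp_form ** A) ** ?A"
    by (simp add: USp_symp[OF A])
  also have "\<dots> = (transpose ?A ** transpose A) ** symp_form ** (A ** ?A)"
    by (simp add: matrix_mul_assoc)
  also have "\<dots> = symp_form" by (simp add: t USp_right_inverse[OF A])
  finally show ?thesis using USp_right_inverse[OF A] by (simp add: USp_def)
qed

text \<open>
  For an element of the group the conjugate transpose is the inverse, which the symplectic relation
  expresses through the transpose.
\<close>

lemma symp_conj:
  assumes "A \<in> USp"
  shows "conj_transpose A = - (symp_form ** transpose A ** symp_form)"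
proof -
  have "symp_form ** transpose A ** symp_form ** A = symp_form ** symp_form"
    using USp_symp[OF assms] by (metis matrix_mul_assoc)
  then have "(- (symp_form ** transpose A ** symp_form)) ** A = mat 1"
    by (simp add: symp_form_square matrix_neg_mult_left)
  then have "- (symp_form ** transpose A ** symp_form) ** (A ** conj_transpose A) = conj_transpose A"
    by (metis matrix_mul_assoc matrix_mul_lid)
  then show ?thesis by (simp add: USp_right_inverse[OF assms])
qed

section \<open>Symplectic matrices have determinant one\<close>

text \<open>
  On skew-symmetric matrices this is a nonzero multiple of the Pfaffian.  The sum ranges over all
  permutations instead of perfect matchings, which spares the choice of representatives.
\<close>

definition pfaff :: "complex ^ ('g + 'g) ^ ('g::finite + 'g) \<Rightarrow> complex" where
  "pfaff B = (\<Sum>\<sigma> | \<sigma> permutes UNIV. of_int (sign \<sigma>) * (\<Prod>a\<in>UNIV. B $ \<sigma> (Inl a) $ \<sigma> (Inr a)))"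

lemma det_select_rows:
  fixes A :: "complex ^ 'n ^ 'n::finite"
  shows "det (\<chi> i. A $ f i) = (if f permutes UNIV then of_int (sign f) * det A else 0)"
proof (cases "inj f")
  case True
  then have "bij f" using finite_UNIV_inj_surj[of f] by (simp add: bij_def)
  then have "f permutes UNIV" by (rule bij_imp_permutes) simp
  then show ?thesis by (simp add: det_permute_rows)
next
  case False
  then obtain i j where "i \<noteq> j" "f i = f j" by (auto simp: inj_def)
  then have "det (\<chi> i. A $ f i) = 0" by (intro det_identical_rows[of i j]) (simp_all add: row_def)
  moreover have "\<not> f permutes UNIV" using False permutes_inj by blast
  ultimately show ?thesis by simp
qed

text \<open>
  Expand the entries of \<open>transpose A ** B ** A\<close> by choosing for every row index \<open>i\<close> a summation index
  \<open>f i\<close>.  The sum over \<open>\<sigma>\<close> then is the determinant of the matrix with rows \<open>A $ f i\<close>, which is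
  zero unless \<open>f\<close> is a permutation.
\<close>

lemma pfaff_congruence: "pfaff (transpose A ** B ** A) = det A * pfaff B"
  for A B :: "complex ^ ('g + 'g) ^ ('g::finite + 'g)"
proof -
  have e: "(transpose A ** B ** A) $ p $ q = (\<Sum>w\<in>UNIV. A $ fst w $ p * B $ fst w $ snd w * A $ snd w $ q)" for p q
  proof -
    have "(transpose A ** B ** A) $ p $ q = (\<Sum>v\<in>UNIV. \<Sum>u\<in>UNIV. A $ u $ p * B $ u $ v * A $ v $ q)"
      by (simp add: matrix_matrix_mult_def transpose_def sum_distrib_right)
    also have "\<dots> = (\<Sum>u\<in>UNIV. \<Sum>v\<in>UNIV. A $ u $ p * B $ u $ v * A $ v $ q)" by (rule sum.swap)
    finally show ?thesis by (simp add: sum.cartesian_product case_prod_unfold UNIV_Times_UNIV[symmetric] del: UNIV_Times_UNIV)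
  qed
  have p: "(\<Prod>a\<in>UNIV. (transpose A ** B ** A) $ \<sigma> (Inl a) $ \<sigma> (Inr a)) =
      (\<Sum>f\<in>UNIV. (\<Prod>a\<in>UNIV. B $ f (Inl a) $ f (Inr a)) * (\<Prod>i\<in>UNIV. A $ f i $ \<sigma> i))" for \<sigma> :: "'g + 'g \<Rightarrow> 'g + 'g"
  proof -
    have "(\<Prod>a\<in>UNIV. (transpose A ** B ** A) $ \<sigma> (Inl a) $ \<sigma> (Inr a)) =
      (\<Sum>h\<in>UNIV \<rightarrow>\<^sub>E UNIV. \<Prod>a\<in>UNIV. A $ fst (h a) $ \<sigma> (Inl a) * B $ fst (h a) $ snd (h a) * A $ snd (h a) $ \<sigma> (Inr a))"
      unfolding e by (rule prod_sum_PiE) auto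
    also have "\<dots> = (\<Sum>f\<in>UNIV. (\<Prod>a\<in>UNIV. B $ f (Inl a) $ f (Inr a)) * (\<Prod>i\<in>UNIV. A $ f i $ \<sigma> i))"
      by (rule sum.reindex_bij_witness[where i = "\<lambda>f a. (f (Inl a), f (Inr a))" and
            j = "\<lambda>h. case_sum (\<lambda>a. fst (h a)) (\<lambda>a. snd (h a))"])
         (auto simp: fun_eq_iff UNIV_prod_split prod.distrib mult_ac split: sum.splits)
    finally show ?thesis .
  qed
  have "pfaff (transpose A ** B ** A) =
     (\<Sum>\<sigma> | \<sigma> permutes UNIV. \<Sum>f\<in>UNIV. (\<Prod>a\<in>UNIV. B $ f (Inl a) $ f (Inr a)) * (of_int (sign \<sigma>) * (\<Prod>i\<in>UNIV. A $ f i $ \<sigma> i)))"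
    unfolding pfaff_def p by (simp add: sum_distrib_left mult_ac)
  also have "\<dots> = (\<Sum>f\<in>UNIV. (\<Prod>a\<in>UNIV. B $ f (Inl a) $ f (Inr a)) * (\<Sum>\<sigma> | \<sigma> permutes UNIV. of_int (sign \<sigma>) * (\<Prod>i\<in>UNIV. A $ f i $ \<sigma> i)))"
    by (subst sum.swap) (simp add: sum_distrib_left)
  also have "\<dots> = (\<Sum>f\<in>UNIV. (\<Prod>a\<in>UNIV. B $ f (Inl a) $ f (Inr a)) * det (\<chi> i. A $ f i))"
    by (simp add: Determinants.det_def)
  also have "\<dots> = (\<Sum>f | f permutes UNIV. (\<Prod>a\<in>UNIV. B $ f (Inl a) $ f (Inr a)) * (of_int (sign f) * det A))"
    unfolding det_select_rows by (intro sum.mono_neutral_cong_right) auto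
  also have "\<dots> = det A * pfaff B" by (simp add: pfaff_def sum_distrib_left mult_ac)
  finally show ?thesis .
qed

text \<open>
  The permutation acts by \<open>\<pi>\<close> on each of two copies of the same set, so its sign is a square.
\<close>

lemma sign_map_sum:
  fixes \<pi> :: "'g::finite \<Rightarrow> 'g"
  assumes "\<pi> permutes UNIV"
  shows "sign (map_sum \<pi> \<pi>) = 1" "map_sum \<pi> \<pi> permutes UNIV"
proof -
  have L: "map_sum \<pi> id = map_permutation UNIV Inl \<pi>"
    by (auto simp: fun_eq_iff map_permutation_def restrict_id_def inv_into_f_f split: sum.splits)
       (metis map_sum.simps sum.exhaust id_apply rangeI)+
  have R: "map_sum id \<pi> = map_permutation UNIV Inr \<pi>"
    by (auto simp: fun_eq_iff map_permutation_def restrict_id_def inv_into_f_f split: sum.splits)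
       (metis map_sum.simps sum.exhaust id_apply rangeI)+
  have bij: "bij \<pi>" using assms by (rule permutes_bij)
  have inv: "inv_into UNIV \<pi> \<circ> \<pi> = id" "\<pi> \<circ> inv_into UNIV \<pi> = id"
    using bij by (simp_all add: bij_is_inj bij_is_surj surj_iff[symmetric])
  have "bij (map_sum \<pi> (id :: 'g \<Rightarrow> 'g))"
    by (rule o_bij[of "map_sum (inv_into UNIV \<pi>) id"]) (simp_all add: map_sum.comp inv map_sum.id)
  moreover have "bij (map_sum (id :: 'g \<Rightarrow> 'g) \<pi>)"
    by (rule o_bij[of "map_sum id (inv_into UNIV \<pi>)"]) (simp_all add: map_sum.comp inv map_sum.id)
  ultimately have pl: "map_sum \<pi> (id :: 'g \<Rightarrow> 'g) permutes UNIV" "map_sum (id :: 'g \<Rightarrow> 'g) \<pi> permutes UNIV"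
    by (auto intro!: bij_imp_permutes)
  have "map_sum \<pi> \<pi> = map_sum \<pi> id \<circ> map_sum id \<pi>" by (auto simp: fun_eq_iff map_sum_def split: sum.splits)
  moreover have "permutation (map_sum \<pi> (id :: 'g \<Rightarrow> 'g))" "permutation (map_sum (id :: 'g \<Rightarrow> 'g) \<pi>)"
    using pl by (auto simp: permutation_permutes)
  ultimately have "sign (map_sum \<pi> \<pi>) = sign (map_sum \<pi> (id::'g\<Rightarrow>'g)) * sign (map_sum (id::'g\<Rightarrow>'g) \<pi>)"
    by (simp add: sign_compose)
  also have "\<dots> = sign \<pi> * sign \<pi>" unfolding L R using assms by (simp add: sign_map_permutation)
  finally show "sign (map_sum \<pi> \<pi>) = 1" by (simp add: sign_idempotent)
  show "map_sum \<pi> \<pi> permutes UNIV" using pl \<open>map_sum \<pi> \<pi> = _\<close> by (simp add: permutes_compose)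
qed

text \<open>
  All nonzero terms of the sum for the symplectic form are equal to one.  If \<open>\<sigma>\<close> maps some \<open>Inl a\<close>
  to the right summand, composing it with the transposition of \<open>Inl a\<close> and \<open>Inr a\<close> changes both the
  sign of \<open>\<sigma>\<close> and one factor of the product; after finitely many such steps \<open>\<sigma>\<close> has the form
  \<open>map_sum \<pi> \<pi>\<close>.
\<close>

lemma pfaff_term:
  fixes \<sigma> :: "'g::finite + 'g \<Rightarrow> 'g + 'g"
  assumes "\<sigma> permutes UNIV" "\<forall>a. symp_form $ \<sigma> (Inl a) $ \<sigma> (Inr a) \<noteq> 0"
  shows "of_int (sign \<sigma>) * (\<Prod>a\<in>UNIV. symp_form $ \<sigma> (Inl a) $ \<sigma> (Inr a)) = (1::complex)"
  using assms
proof (induction "card {a. \<exists>b. \<sigma> (Inl a) = Inr b}" arbitrary: \<sigma>)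
  case 0
  then have "\<forall>a. \<exists>b. \<sigma> (Inl a) = Inl b" by simp (metis sum.exhaust)
  then obtain \<pi> where pi: "\<And>a. \<sigma> (Inl a) = Inl (\<pi> a)" by metis
  have pi': "\<sigma> (Inr a) = Inr (\<pi> a)" for a
    using 0(3)[rule_format, of a] unfolding pi by (cases "\<sigma> (Inr a)") (auto split: if_splits)
  have eq: "\<sigma> = map_sum \<pi> \<pi>"
    by (rule ext) (metis map_sum.simps pi pi' sum.exhaust)
  have "inj \<pi>" using permutes_inj[OF 0(2)] pi by (metis injD injI sum.inject(1))
  then have "\<pi> permutes UNIV" by (intro bij_imp_permutes) (auto simp: bij_def finite_UNIV_inj_surj)
  then show ?case using sign_map_sum(1)[of \<pi>] by (simp add: eq)
next
  case (Suc n)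
  then have "{a. \<exists>b. \<sigma> (Inl a) = Inr b} \<noteq> {}" by (metis card.empty nat.distinct(1))
  then obtain a b where ab: "\<sigma> (Inl a) = Inr b" by auto
  define t where "t = Transposition.transpose (Inl a) (Inr a :: 'g + 'g)"
  define \<tau> where "\<tau> = \<sigma> \<circ> t"
  have tp: "t permutes UNIV" unfolding t_def by (intro permutes_swap_id) auto
  have b': "\<sigma> (Inr a) = Inl b" using Suc(4)[rule_format, of a] unfolding ab
    by (cases "\<sigma> (Inr a)") (auto split: if_splits)
  have t1: "\<tau> (Inl a) = Inl b" "\<tau> (Inr a) = Inr b" by (simp_all add: \<tau>_def t_def ab b')
  have t2: "\<tau> (Inl c) = \<sigma> (Inl c)" "\<tau> (Inr c) = \<sigma> (Inr c)" if "c \<noteq> a" for c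
    using that by (simp_all add: \<tau>_def t_def transpose_apply_other)
  have S: "{c. \<exists>b. \<tau> (Inl c) = Inr b} = {c. \<exists>b. \<sigma> (Inl c) = Inr b} - {a}"
    using t1 t2 by auto (metis Inl_Inr_False)+
  have "n = card {c. \<exists>b. \<tau> (Inl c) = Inr b}"
    unfolding S using Suc(2) ab by (subst card_Diff_singleton) auto
  moreover have "\<tau> permutes UNIV" unfolding \<tau>_def by (rule permutes_compose[OF tp Suc(3)])
  moreover have "\<forall>c. symp_form $ \<tau> (Inl c) $ \<tau> (Inr c) \<noteq> 0"
  proof
    fix c show "symp_form $ \<tau> (Inl c) $ \<tau> (Inr c) \<noteq> 0"
      using Suc(4)[rule_format, of c] t1 t2[of c] by (cases "c = a") auto
  qed
  ultimately have IH: "of_int (sign \<tau>) * (\<Prod>a\<in>UNIV. symp_form $ \<tau> (Inl a) $ \<tau> (Inr a)) = (1::complex)"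
    by (rule Suc(1))
  have "sign \<tau> = sign \<sigma> * sign t" unfolding \<tau>_def
    using tp Suc(3) by (intro sign_compose) (auto simp: permutation_permutes)
  then have sg: "sign \<tau> = - sign \<sigma>" by (simp add: t_def sign_swap_id)
  have "(\<Prod>a\<in>UNIV. symp_form $ \<tau> (Inl a) $ \<tau> (Inr a)) =
     symp_form $ \<tau> (Inl a) $ \<tau> (Inr a) * (\<Prod>c\<in>UNIV - {a}. symp_form $ \<tau> (Inl c) $ \<tau> (Inr c))"
    by (rule prod.remove) auto
  also have "(\<Prod>c\<in>UNIV - {a}. symp_form $ \<tau> (Inl c) $ \<tau> (Inr c)) = (\<Prod>c\<in>UNIV - {a}. symp_form $ \<sigma> (Inl c) $ \<sigma> (Inr c))"
    by (intro prod.cong) (auto simp: t2)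
  also have "symp_form $ \<tau> (Inl a) $ \<tau> (Inr a) = - (symp_form $ \<sigma> (Inl a) $ \<sigma> (Inr a))" by (simp add: t1 ab b')
  also have "- (symp_form $ \<sigma> (Inl a) $ \<sigma> (Inr a)) * (\<Prod>c\<in>UNIV - {a}. symp_form $ \<sigma> (Inl c) $ \<sigma> (Inr c)) =
     - (\<Prod>c\<in>UNIV. symp_form $ \<sigma> (Inl c) $ \<sigma> (Inr c))"
    using prod.remove[of UNIV a "\<lambda>c. symp_form $ \<sigma> (Inl c) $ \<sigma> (Inr c)"] by simp
  finally show ?case using IH sg by simp
qed

lemma pfaff_symp_form_nonzero: "pfaff (symp_form :: complex ^ ('g + 'g) ^ ('g::finite + 'g)) \<noteq> 0"
proof -
  let ?P = "{\<sigma> :: 'g + 'g \<Rightarrow> 'g + 'g. \<sigma> permutes UNIV \<and> (\<forall>a. symp_form $ \<sigma> (Inl a) $ \<sigma> (Inr a) \<noteq> (0::complex))}"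
  have "pfaff (symp_form :: complex ^ ('g + 'g) ^ ('g + 'g)) = (\<Sum>\<sigma>\<in>?P. 1)"
    unfolding pfaff_def
    by (intro sum.mono_neutral_cong_right) (auto simp: pfaff_term finite_permutations)
  also have "\<dots> = of_nat (card ?P)" by simp
  also have "\<dots> \<noteq> 0"
  proof -
    have "id \<in> ?P" by (simp add: permutes_id)
    moreover have "finite ?P" by (rule finite_subset[OF _ finite_permutations[of UNIV]]) auto
    ultimately have "card ?P \<noteq> 0" by (simp only: card_0_eq) blast
    then show ?thesis by (simp only: of_nat_eq_0_iff not_False_eq_True)
  qed
  finally show ?thesis .
qed

text \<open>
  This excludes eigenvalue multisets in which \<open>1\<close> and \<open>-1\<close> both occur an odd number of times.
\<close>

theorem det_USp: "A \<in> USp \<Longrightarrow> det A = 1" for A :: "complex ^ ('g + 'g) ^ ('g::finite + 'g)"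
  using pfaff_congruence[of A symp_form] pfaff_symp_form_nonzero[where 'g = 'g] by (simp add: USp_symp)

section \<open>Eigenangles\<close>

lemma poly_charpoly: "poly (charpoly A) z = det (mat z - A)" for A :: "complex ^ 'n ^ 'n::finite"
proof -
  have "poly (charpoly A) z = (\<Sum>p | p permutes UNIV. of_int (sign p) * (\<Prod>i\<in>UNIV. (if i = p i then z else 0) - A $ i $ p i))"
    unfolding charpoly_def Determinants.det_def poly_sum
    by (intro sum.cong refl) (auto simp: poly_prod intro!: prod.cong)
  also have "\<dots> = det (mat z - A)" unfolding Determinants.det_def by (simp add: mat_def)
  finally show ?thesis .
qed

lemma USp_eigenvalue_norm:
  assumes A: "A \<in> USp" and z: "z \<in># eigenvalues A"
  shows "norm z = 1"
proof -
  obtain as where as: "char_poly (jmat A) = (\<Prod>a\<leftarrow>as. [:- a, 1:])" "eigenvalues A = mset as"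
    by (rule eigenvalues_factorization)
  have "poly (charpoly A) z = 0"
    using z unfolding as charpoly_jmat by (simp add: poly_prod_list prod_list_zero_iff image_iff)
  then have "det (mat z - A) = 0" by (simp add: poly_charpoly)
  then have "\<not> invertible (mat z - A)" by (simp add: invertible_det_nz)
  then have "\<not> (\<exists>B. B ** (mat z - A) = mat 1)"
    using matrix_left_right_inverse by (auto simp: invertible_def)
  then obtain x where x: "(mat z - A) *v x = 0" "x \<noteq> 0" by (auto simp: matrix_left_invertible_ker)
  have Ax: "(A *v x) $ i = z * x $ i" for i
  proof -
    have "0 = ((mat z - A) *v x) $ i" by (simp add: x)
    also have "\<dots> = z * x $ i - (A *v x) $ i"
      by (simp add: matrix_vector_mult_def mat_def left_diff_distrib sum_subtractf if_distrib[of "\<lambda>a. a * _"] cong: if_cong)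
    finally show ?thesis by simp
  qed
  let ?N = "\<Sum>i\<in>UNIV. cnj (x $ i) * x $ i"
  have "(\<Sum>i\<in>UNIV. cnj ((A *v x) $ i) * (A *v x) $ i) =
      (\<Sum>j\<in>UNIV. \<Sum>l\<in>UNIV. cnj (x $ j) * ((conj_transpose A ** A) $ j $ l * x $ l))"
  proof -
    have "(\<Sum>i\<in>UNIV. cnj ((A *v x) $ i) * (A *v x) $ i) =
      (\<Sum>i\<in>UNIV. \<Sum>j\<in>UNIV. \<Sum>l\<in>UNIV. cnj (x $ j) * (cnj (A $ i $ j) * A $ i $ l * x $ l))"
    proof (rule sum.cong[OF refl])
      fix i
      have "cnj ((A *v x) $ i) * (A *v x) $ i = (\<Sum>j\<in>UNIV. cnj (A $ i $ j) * cnj (x $ j)) * (\<Sum>l\<in>UNIV. A $ i $ l * x $ l)"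
        by (simp add: matrix_vector_mult_def)
      also have "\<dots> = (\<Sum>j\<in>UNIV. \<Sum>l\<in>UNIV. cnj (x $ j) * (cnj (A $ i $ j) * A $ i $ l * x $ l))"
        unfolding sum_product by (simp add: mult_ac)
      finally show "cnj ((A *v x) $ i) * (A *v x) $ i = (\<Sum>j\<in>UNIV. \<Sum>l\<in>UNIV. cnj (x $ j) * (cnj (A $ i $ j) * A $ i $ l * x $ l))" .
    qed
    also have "\<dots> = (\<Sum>j\<in>UNIV. \<Sum>i\<in>UNIV. \<Sum>l\<in>UNIV. cnj (x $ j) * (cnj (A $ i $ j) * A $ i $ l * x $ l))"
      by (rule sum.swap)
    also have "\<dots> = (\<Sum>j\<in>UNIV. \<Sum>l\<in>UNIV. \<Sum>i\<in>UNIV. cnj (x $ j) * (cnj (A $ i $ j) * A $ i $ l * x $ l))"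
      by (intro sum.cong refl sum.swap)
    also have "\<dots> = (\<Sum>j\<in>UNIV. \<Sum>l\<in>UNIV. cnj (x $ j) * ((conj_transpose A ** A) $ j $ l * x $ l))"
      by (simp add: conj_transpose_def matrix_matrix_mult_def sum_distrib_left sum_distrib_right)
    finally show ?thesis .
  qed
  also have "\<dots> = ?N"
    unfolding USp_left_inverse[OF A]
    by (simp add: mat_def if_distrib[of "\<lambda>a. a * _"] if_distrib[of "\<lambda>a. _ * a"] cong: if_cong)
  finally have "cnj z * z * ?N = ?N"
    unfolding Ax by (simp add: sum_distrib_left mult_ac)
  moreover have "?N \<noteq> 0"
  proof
    assume "?N = 0"
    then have "complex_of_real (\<Sum>i\<in>UNIV. (norm (x $ i))^2) = 0"
      unfolding of_real_sum complex_norm_square by (simp add: mult.commute)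
    then have "(\<Sum>i\<in>UNIV. (norm (x $ i))^2) = 0" by (simp only: of_real_eq_0_iff)
    then have "x = 0" by (subst (asm) sum_nonneg_eq_0_iff) (auto simp: vec_eq_iff)
    with x show False by simp
  qed
  ultimately have "cnj z * z = 1" by simp
  then have "complex_of_real ((norm z)^2) = 1" unfolding complex_norm_square by (simp add: mult.commute)
  then have "(norm z)^2 = 1" by (simp only: of_real_eq_1_iff)
  then show ?thesis using norm_ge_zero[of z] by (simp add: power2_eq_1_iff)
qed

text \<open>
  The conjugate transpose is similar to the transpose, by \<open>symp_conj\<close>, and therefore has the same
  characteristic polynomial as the matrix itself; but its eigenvalues are the conjugates.
\<close>

lemma USp_eigenvalues_cnj:
  assumes A: "A \<in> (USp :: (complex ^ ('g + 'g) ^ ('g::finite + 'g)) set)"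
  shows "image_mset cnj (eigenvalues A) = eigenvalues A"
proof -
  let ?n = "CARD('g + 'g)"
  obtain as where as: "char_poly (jmat A) = (\<Prod>a\<leftarrow>as. [:- a, 1:])" "eigenvalues A = mset as"
    by (rule eigenvalues_factorization)
  have jt: "jmat (transpose X) = transpose_mat (jmat X)" for X :: "complex ^ ('g + 'g) ^ ('g + 'g)"
    by (rule eq_matI) (auto simp: jmat_def Finite_Cartesian_Product.transpose_def)
  have ja: "jmat (conj_transpose A) = map_mat cnj (transpose_mat (jmat A))"
    by (rule eq_matI) (auto simp: jmat_def conj_transpose_def)
  let ?J = "symp_form :: complex ^ ('g + 'g) ^ ('g + 'g)"
  have m: "(- ?J) ** ?J = mat 1" "?J ** (- ?J) = mat 1"
    by (simp_all add: matrix_neg_mult_left matrix_neg_mult_right symp_form_square)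
  have ct: "conj_transpose A = (- ?J) ** transpose A ** ?J"
    by (simp add: symp_conj[OF A] matrix_neg_mult_left)
  have sim: "similar_mat (jmat (conj_transpose A)) (jmat (transpose A))"
    unfolding similar_mat_def similar_mat_wit_def Let_def
  proof (rule exI[of _ "jmat (- ?J)"], rule exI[of _ "jmat ?J"], intro conjI)
    have d: "dim_row (jmat (conj_transpose A)) = ?n" by (simp add: jmat_def)
    show "{jmat (conj_transpose A), jmat (transpose A), jmat (- ?J), jmat ?J}
        \<subseteq> carrier_mat (dim_row (jmat (conj_transpose A))) (dim_row (jmat (conj_transpose A)))"
      unfolding d using jmat_carrier by blast
    show "jmat (- ?J) * jmat ?J = 1\<^sub>m (dim_row (jmat (conj_transpose A)))"
      "jmat ?J * jmat (- ?J) = 1\<^sub>m (dim_row (jmat (conj_transpose A)))"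
      unfolding d jmat_mult[symmetric] m jmat_1 by rule+
    show "jmat (conj_transpose A) = jmat (- ?J) * jmat (transpose A) * jmat ?J"
      unfolding jmat_mult[symmetric] by (rule arg_cong[of _ _ jmat], rule ct)
  qed
  then have 1: "char_poly (jmat (conj_transpose A)) = char_poly (jmat A)"
    using char_poly_similar[OF sim] char_poly_transpose_mat[OF jmat_carrier[of A]] by (simp add: jt)
  interpret cnj: comm_ring_hom cnj by unfold_locales auto
  interpret pc: map_poly_comm_ring_hom cnj ..
  have "char_poly (jmat (conj_transpose A)) = map_poly cnj (char_poly (transpose_mat (jmat A)))"
    unfolding ja by (rule cnj.char_poly_hom) (use jmat_carrier[of A] in auto)
  also have "\<dots> = map_poly cnj (\<Prod>a\<leftarrow>as. [:- a, 1:])"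
    by (simp add: char_poly_transpose_mat[OF jmat_carrier[of A]] as)
  also have "\<dots> = (\<Prod>a\<leftarrow>map cnj as. [:- a, 1:])"
    by (simp add: pc.hom_prod_list o_def)
  finally have "(\<Prod>a\<leftarrow>map cnj as. [:- a, 1:]) = (\<Prod>a\<leftarrow>as. [:- a, 1:])" using 1 as by simp
  then have "mset (map cnj as) = mset as" using proots_linear_factors by metis
  then show ?thesis by (simp add: as)
qed

lemma USp_uminus: "A \<in> USp \<Longrightarrow> - A \<in> USp"
proof -
  assume "A \<in> USp"
  moreover have "conj_transpose (- A) = - conj_transpose A" "transpose (- A) = - transpose A"
    by (simp_all add: conj_transpose_def Finite_Cartesian_Product.transpose_def vec_eq_iff)
  ultimately show ?thesis by (simp add: USp_def matrix_neg_mult_left matrix_neg_mult_right)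
qed

lemma USp_prod_eigenvalues:
  assumes A: "A \<in> (USp :: (complex ^ ('g + 'g) ^ ('g::finite + 'g)) set)"
  shows "prod_mset (eigenvalues A) = 1" "size (eigenvalues A) = 2 * CARD('g)"
proof -
  obtain as where as: "char_poly (jmat A) = (\<Prod>a\<leftarrow>as. [:- a, 1:])" "eigenvalues A = mset as" "length as = CARD('g + 'g)"
    by (rule eigenvalues_factorization)
  show sz: "size (eigenvalues A) = 2 * CARD('g)" by (simp add: as)
  have "mat 0 - A = - A" by (simp add: mat_def vec_eq_iff)
  then have "det (mat 0 - A) = 1" using det_USp[OF USp_uminus[OF A]] by simp
  then have "poly (charpoly A) 0 = 1" by (simp add: poly_charpoly)
  then have "prod_list (map uminus as) = 1" by (simp add: charpoly_jmat as poly_prod_list o_def)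
  moreover have "prod_list (map uminus as) = (-1) ^ length as * prod_list as" for as :: "complex list"
    by (induction as) auto
  ultimately show "prod_mset (eigenvalues A) = 1" by (simp add: as prod_mset_prod_list)
qed

lemma mset_split_pair:
  assumes "a \<in># R" "b \<in># R - {#a#}"
  shows "\<exists>R'. R = R' + {#a, b#}"
proof -
  obtain S where S: "R = add_mset a S" using assms(1) by (metis multi_member_split)
  then have "b \<in># S" using assms(2) by simp
  then obtain T where "S = add_mset b T" by (metis multi_member_split)
  with S show ?thesis by (intro exI[of _ T]) simp
qed

text \<open>
  Nonreal elements are removed together with their conjugates, and equal real elements in pairs.
  If neither is possible, the multiset consists of \<open>1\<close> and \<open>-1\<close>, whose product is not one.
\<close>

lemma eigenangles_exist:
  fixes R :: "complex multiset"
  assumes "size R = 2 * g" "image_mset cnj R = R" "prod_mset R = 1" "\<And>z. z \<in># R \<Longrightarrow> norm z = 1"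
  shows "\<exists>\<theta>::nat \<Rightarrow> real. \<forall>k. (\<Sum>z\<in>#R. z ^ k) = of_real (\<Sum>j<g. 2 * cos (real k * \<theta> j))"
  using assms
proof (induction g arbitrary: R)
  case 0 then show ?case by auto
next
  case (Suc g)
  have pair: ?case if R: "R = R' + {#z, cnj z#}" for R' z
  proof -
    have nz: "norm z = 1" using Suc.prems(4)[of z] R by simp
    then have zc: "z * cnj z = 1" by (simp add: complex_norm_square[symmetric])
    have "image_mset cnj R' + {#cnj z, z#} = R' + {#z, cnj z#}" using Suc.prems(2) unfolding R by simp
    then have "image_mset cnj R' = R'" by (simp add: add_mset_commute)
    moreover have "size R' = 2 * g" using Suc.prems(1) unfolding R by simp
    moreover have "z * cnj z * prod_mset R' = 1" using Suc.prems(3) unfolding R by (simp add: mult_ac)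
    then have "prod_mset R' = 1" unfolding zc by simp
    moreover have "norm w = 1" if "w \<in># R'" for w using that Suc.prems(4)[of w] by (simp add: R)
    ultimately obtain \<theta> :: "nat \<Rightarrow> real" where
      th: "\<forall>k. (\<Sum>z\<in>#R'. z ^ k) = of_real (\<Sum>j<g. 2 * cos (real k * \<theta> j))" using Suc.IH by blast
    define t where "t = Arg z"
    have zt: "z = cis t" using nz unfolding t_def 
      by (subst cis_Arg) (auto simp: sgn_eq)
    have k: "z ^ k + cnj z ^ k = of_real (2 * cos (real k * t))" for k
    proof -
      have "z ^ k = cis (real k * t)" "cnj z ^ k = cis (real k * - t)"
        unfolding zt cis_cnj by (simp_all only: Complex.DeMoivre)
      then show ?thesis by (simp add: complex_eq_iff)
    qed
    have "(\<Sum>z\<in>#R. z ^ k) = of_real (\<Sum>j<Suc g. 2 * cos (real k * (\<theta>(g := t)) j))" for k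
    proof -
      have "(\<Sum>z\<in>#R. z ^ k) = (\<Sum>z\<in>#R'. z ^ k) + (z ^ k + cnj z ^ k)" by (simp add: R add_ac)
      also have "\<dots> = of_real (\<Sum>j<g. 2 * cos (real k * \<theta> j)) + of_real (2 * cos (real k * t))"
        unfolding k using th by simp
      also have "(\<Sum>j<g. 2 * cos (real k * \<theta> j)) = (\<Sum>j<g. 2 * cos (real k * (\<theta>(g := t)) j))"
        by (intro sum.cong) auto
      finally show ?thesis by simp
    qed
    then show ?thesis by blast
  qed
  show ?case
  proof (cases "\<exists>z\<in>#R. cnj z \<noteq> z")
    case True
    then obtain z where z: "z \<in># R" "cnj z \<noteq> z" by auto
    have "cnj z \<in># image_mset cnj R" using z by auto
    then have c: "cnj z \<in># R - {#z#}" using z(2) Suc.prems(2) by (auto simp: in_diff_count)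
    obtain R' where "R = R' + {#z, cnj z#}" using mset_split_pair[OF z(1) c] by auto
    then show ?thesis by (rule pair)
  next
    case False
    show ?thesis
    proof (cases "\<exists>z. count R z \<ge> 2")
      case True
      then obtain z where z: "count R z \<ge> 2" by auto
      then have zin: "z \<in># R" by (metis count_greater_zero_iff less_le_trans pos2)
      then have "cnj z = z" using False by auto
      moreover have "z \<in># R - {#z#}" using z by (simp add: in_diff_count)
      then obtain R' where "R = R' + {#z, z#}" using mset_split_pair[OF zin] by auto
      ultimately have "R = R' + {#z, cnj z#}" by simp
      then show ?thesis by (rule pair)
    next
      case nd: False
      have "z = 1 \<or> z = -1" if "z \<in># R" for z
      proof -
        have "cnj z = z" "norm z = 1" using that False Suc.prems(4) by auto
        then obtain r where "z = of_real r" "\<bar>r\<bar> = 1" by (metis Reals_cases Reals_cnj_iff norm_of_real)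
        then show ?thesis by (auto simp: abs_if split: if_splits)
      qed
      then have sub: "set_mset R \<subseteq> {1, -1}" by auto
      have c1: "count R z = 1" if "z \<in># R" for z
        using nd that by (metis One_nat_def Suc_1 count_greater_zero_iff le_less_Suc_eq not_less_eq_eq less_eq_Suc_le linorder_not_le)
      have Rs: "R = mset_set (set_mset R)"
        by (rule multiset_eqI) (auto simp: count_mset_set' c1 not_in_iff)
      have "size R = card (set_mset R)" by (subst Rs) simp
      also have "\<dots> \<le> card {1, -1 :: complex}" using sub by (intro card_mono) auto
      finally have "size R \<le> 2" by simp
      then have g0: "g = 0" "size R = 2" using Suc.prems(1) by auto
      have "card (set_mset R) = card {1, -1 :: complex}" using \<open>size R = card (set_mset R)\<close> g0 by simp
      then have "set_mset R = {1, -1}" using sub by (intro card_subset_eq) auto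
      then have "R = {#1, -1#}" using Rs by simp
      then show ?thesis using Suc.prems(3) by simp
    qed
  qed
qed

theorem USp_eigenangles:
  assumes A: "A \<in> (USp :: (complex ^ ('g + 'g) ^ ('g::finite + 'g)) set)"
  shows "\<exists>\<theta>. \<forall>k. trace (mpow A k) = of_real (psum CARD('g) (int k) \<theta>)"
  using eigenangles_exist[OF USp_prod_eigenvalues(2)[OF A] USp_eigenvalues_cnj[OF A] USp_prod_eigenvalues(1)[OF A] USp_eigenvalue_norm[OF A]]
  unfolding trace_mpow power_sum_def psum_def by simp

section \<open>Curves in the group\<close>
text \<open>
  A curve through the identity with velocity \<open>X\<close>; the quadratic error bound replaces
  differentiability.
\<close>

definition curve :: "complex ^ ('g + 'g) ^ ('g::finite + 'g) \<Rightarrow> (real \<Rightarrow> complex ^ ('g + 'g) ^ ('g + 'g)) \<Rightarrow> bool" where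
  "curve X B \<longleftrightarrow> (\<forall>t. B t \<in> USp) \<and>
     (\<exists>L. \<forall>t i j. \<bar>t\<bar> \<le> 1 \<longrightarrow> norm (B t $ i $ j - mat 1 $ i $ j - of_real t * X $ i $ j) \<le> L * t\<^sup>2)"

definition cscale :: "complex \<Rightarrow> complex ^ 'n ^ 'n \<Rightarrow> complex ^ 'n ^ 'n" where
  "cscale c X = (\<chi> i j. c * X $ i $ j)"

text \<open>
  The complex symplectic Lie algebra.
\<close>

definition lie_sp :: "complex ^ ('g + 'g) ^ ('g::finite + 'g) \<Rightarrow> bool" where
  "lie_sp X \<longleftrightarrow> transpose X ** symp_form = - (symp_form ** X)"

lemma USp_entry_bound: "A \<in> USp \<Longrightarrow> norm (A $ i $ j) \<le> 1"
proof -
  assume "A \<in> USp"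
  then have "1 = (conj_transpose A ** A) $ j $ j" by (simp add: USp_left_inverse mat_def)
  also have "\<dots> = of_real (\<Sum>i\<in>UNIV. (norm (A $ i $ j))\<^sup>2)"
    unfolding of_real_sum complex_norm_square
    by (simp add: conj_transpose_def matrix_matrix_mult_def mult.commute)
  finally have "(\<Sum>i\<in>UNIV. (norm (A $ i $ j))\<^sup>2) = 1" by (metis of_real_eq_1_iff)
  moreover have "(norm (A $ i $ j))\<^sup>2 \<le> (\<Sum>i\<in>UNIV. (norm (A $ i $ j))\<^sup>2)"
    by (rule member_le_sum) auto
  ultimately have "(norm (A $ i $ j))\<^sup>2 \<le> 1" by simp
  then show ?thesis by (simp add: power_le_one_iff abs_square_le_1)
qed

lemma conj_transpose_add: "conj_transpose (A + B) = conj_transpose A + conj_transpose B"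
  by (simp add: conj_transpose_def vec_eq_iff)

lemma conj_transpose_minus: "conj_transpose (- A) = - conj_transpose A"
  by (simp add: conj_transpose_def vec_eq_iff)

lemma conj_transpose_diff: "conj_transpose (A - B) = conj_transpose A - conj_transpose B"
  by (simp add: conj_transpose_def vec_eq_iff)

lemma transpose_add': "transpose (A + B) = transpose A + transpose B" for A :: "complex ^ 'n ^ 'm"
  by (simp add: transpose_def vec_eq_iff)

lemma transpose_diff': "transpose (A - B) = transpose A - transpose B" for A :: "complex ^ 'n ^ 'm"
  by (simp add: transpose_def vec_eq_iff)

text \<open>
  If \<open>v = S v\<close> with \<open>S\<close> skew-Hermitian, then \<open>\<bar>v\<bar>\<^sup>2\<close> equals its own negative.
\<close>

lemma skew_invertible:
  fixes S :: "complex ^ 'n ^ 'n::finite"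
  assumes "conj_transpose S = - S"
  shows "\<exists>C. C ** (mat 1 - S) = mat 1"
  unfolding matrix_left_invertible_ker
proof (intro allI impI)
  fix v assume "(mat 1 - S) *v v = 0"
  then have v: "v = S *v v" by (simp add: matrix_vector_mult_diff_rdistrib)
  let ?N = "\<Sum>i\<in>UNIV. cnj (v $ i) * v $ i"
  have "?N = (\<Sum>i\<in>UNIV. \<Sum>j\<in>UNIV. cnj (v $ i) * (S $ i $ j * v $ j))"
    by (subst (2) v) (simp add: matrix_vector_mult_def sum_distrib_left)
  also have "\<dots> = (\<Sum>j\<in>UNIV. \<Sum>i\<in>UNIV. cnj (v $ i) * (S $ i $ j * v $ j))" by (rule sum.swap)
  also have "\<dots> = (\<Sum>j\<in>UNIV. - (cnj (\<Sum>i\<in>UNIV. S $ j $ i * v $ i) * v $ j))"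
  proof (rule sum.cong[OF refl])
    fix j
    have "S $ i $ j = - cnj (S $ j $ i)" for i
    proof -
      have "conj_transpose S $ i $ j = - S $ i $ j" by (simp add: assms)
      then show ?thesis by (simp add: conj_transpose_def)
    qed
    then show "(\<Sum>i\<in>UNIV. cnj (v $ i) * (S $ i $ j * v $ j)) = - (cnj (\<Sum>i\<in>UNIV. S $ j $ i * v $ i) * v $ j)"
      by (simp add: sum_distrib_right sum_distrib_left sum_negf mult_ac)
  qed
  also have "\<dots> = - (\<Sum>j\<in>UNIV. cnj ((S *v v) $ j) * v $ j)" by (simp add: matrix_vector_mult_def sum_negf)
  also have "\<dots> = - ?N" unfolding v[symmetric] ..
  finally have "?N = 0" by (simp add: eq_neg_iff_add_eq_0)
  moreover have "?N = complex_of_real (\<Sum>i\<in>UNIV. (norm (v $ i))\<^sup>2)"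
    unfolding of_real_sum complex_norm_square by (simp add: mult.commute)
  ultimately have "(\<Sum>i\<in>UNIV. (norm (v $ i))\<^sup>2) = 0" by (simp only: of_real_eq_0_iff)
  then show "v = 0" by (subst (asm) sum_nonneg_eq_0_iff) (auto simp: vec_eq_iff)
qed

lemma matrix_sub_distrib_left: "A ** (B - C) = A ** B - A ** C" for A :: "complex ^ 'n::finite ^ 'm"
  by (simp add: matrix_matrix_mult_def vec_eq_iff right_diff_distrib sum_subtractf)

lemma matrix_sub_distrib_right: "(A - B) ** C = A ** C - B ** C" for A :: "complex ^ 'n::finite ^ 'm"
  by (simp add: matrix_matrix_mult_def vec_eq_iff left_diff_distrib sum_subtractf)

lemma matrix_add_distrib_left: "A ** (B + C) = A ** B + A ** C" for A :: "complex ^ 'n::finite ^ 'm"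
  by (simp add: matrix_matrix_mult_def vec_eq_iff distrib_left sum.distrib)

lemma matrix_add_distrib_right: "(A + B) ** C = A ** C + B ** C" for A :: "complex ^ 'n::finite ^ 'm"
  by (simp add: matrix_matrix_mult_def vec_eq_iff distrib_right sum.distrib)

lemmas matrix_distribs = matrix_sub_distrib_left matrix_sub_distrib_right matrix_add_distrib_left
  matrix_add_distrib_right matrix_neg_mult_left matrix_neg_mult_right

text \<open>
  \<open>B\<close> is the Cayley transform \<open>(1 + S) / (1 - S)\<close>, which maps the compact Lie algebra into the group.
  The equation exhibits \<open>1 + 2 S\<close> as its first-order expansion with an explicit remainder.
\<close>

lemma cayley:
  fixes S :: "complex ^ ('g + 'g) ^ ('g::finite + 'g)"
  assumes skew: "conj_transpose S = - S" and sp: "lie_sp S"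
  shows "\<exists>B\<in>USp. B = mat 1 + (S + S) + (B + mat 1) ** S ** S"
proof -
  obtain C where C1: "C ** (mat 1 - S) = mat 1" using skew_invertible[OF skew] by blast
  then have C2: "(mat 1 - S) ** C = mat 1" using matrix_left_right_inverse by blast
  define B where "B = C ** (mat 1 + S)"
  have comm: "(mat 1 - S) ** (mat 1 + S) = (mat 1 + S) ** (mat 1 - S)"
    by (simp add: matrix_distribs)
  have BC: "B ** (mat 1 - S) = mat 1 + S"
    by (simp add: B_def matrix_mul_assoc[symmetric] comm[symmetric]) (simp add: matrix_mul_assoc C1)
  have SB: "(mat 1 - S) ** B = mat 1 + S" by (simp add: B_def matrix_mul_assoc C2)
  have "C - C ** S = mat 1" using C1 by (simp add: matrix_distribs)
  then have CS: "C ** S = C - mat 1" by (simp add: algebra_simps)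
  have B2: "B = C + C - mat 1" by (simp add: B_def matrix_distribs CS)
  have "(B + mat 1) ** S ** S = (C + C) ** S ** S" by (simp add: B2)
  also have "\<dots> = B - mat 1 - (S + S)" by (simp only: matrix_distribs CS B2 matrix_mul_lid) (simp add: algebra_simps)
  finally have eq: "B = mat 1 + (S + S) + (B + mat 1) ** S ** S" by simp
  have "conj_transpose B ** (mat 1 + S) = mat 1 - S"
  proof -
    have "conj_transpose ((mat 1 - S) ** B) = conj_transpose (mat 1 + S)" by (simp only: SB)
    then show ?thesis by (simp add: conj_transpose_mult conj_transpose_diff conj_transpose_add skew)
  qed
  then have "conj_transpose B ** B ** (mat 1 - S) = mat 1 - S"
    by (simp add: matrix_mul_assoc[symmetric] BC)
  then have "conj_transpose B ** B ** ((mat 1 - S) ** C) = (mat 1 - S) ** C"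
    by (simp add: matrix_mul_assoc)
  then have un: "conj_transpose B ** B = mat 1" by (simp add: C2)
  let ?T = "transpose S"
  have TJ: "?T ** symp_form = - (symp_form ** S)" using sp by (simp add: lie_sp_def)
  have "transpose B ** (mat 1 - ?T) = mat 1 + ?T"
  proof -
    have "transpose ((mat 1 - S) ** B) = transpose (mat 1 + S)" by (simp only: SB)
    then show ?thesis by (simp add: matrix_transpose_mul transpose_diff' transpose_add' transpose_mat)
  qed
  then have 1: "transpose B ** (mat 1 - ?T) ** symp_form = symp_form ** (mat 1 - S)"
    by (simp add: matrix_distribs TJ)
  have "(mat 1 - ?T) ** symp_form = symp_form ** (mat 1 + S)" by (simp add: matrix_distribs TJ)
  then have "transpose B ** symp_form ** (mat 1 + S) = symp_form ** (mat 1 - S)"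
    using 1 by (simp add: matrix_mul_assoc[symmetric])
  then have "transpose B ** symp_form ** B ** (mat 1 - S) = symp_form ** (mat 1 - S)"
    by (simp add: matrix_mul_assoc[symmetric] BC)
  then have "transpose B ** symp_form ** B ** ((mat 1 - S) ** C) = symp_form ** ((mat 1 - S) ** C)"
    by (simp add: matrix_mul_assoc)
  then have "transpose B ** symp_form ** B = symp_form" by (simp add: C2)
  with un have "B \<in> USp" by (simp add: USp_def)
  with eq show ?thesis by blast
qed

text \<open>
  Take the Cayley transform of \<open>t X / 2\<close>.  The remainder is bounded uniformly because the entries of
  elements of the group have absolute value at most one.
\<close>

lemma ex_curve:
  fixes X :: "complex ^ ('g + 'g) ^ ('g::finite + 'g)"
  assumes skew: "conj_transpose X = - X" and sp: "lie_sp X"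
  shows "\<exists>B. curve X B"
proof -
  have "\<exists>B\<in>USp. B = mat 1 + cscale (of_real t) X + cscale (of_real (t\<^sup>2 / 4)) ((B + mat 1) ** X ** X)" for t :: real
  proof -
    let ?S = "cscale (of_real (t / 2)) X"
    have "conj_transpose ?S = - ?S"
    proof -
      have "cnj (X $ j $ i) = - X $ i $ j" for i j
        using arg_cong[OF skew, of "\<lambda>Y. Y $ i $ j"] by (simp add: conj_transpose_def)
      then show ?thesis by (simp add: conj_transpose_def cscale_def vec_eq_iff)
    qed
    moreover have "lie_sp ?S"
    proof -
      have "transpose ?S ** symp_form = cscale (of_real (t/2)) (transpose X ** symp_form)"
        by (simp add: transpose_def cscale_def matrix_matrix_mult_def vec_eq_iff sum_distrib_left mult_ac)
      also have "\<dots> = - (symp_form ** ?S)" using sp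
        by (simp add: lie_sp_def cscale_def matrix_matrix_mult_def vec_eq_iff sum_distrib_left mult_ac)
      finally show ?thesis by (simp add: lie_sp_def)
    qed
    ultimately obtain B where B: "B \<in> USp" "B = mat 1 + (?S + ?S) + (B + mat 1) ** ?S ** ?S"
      using cayley[of ?S] by blast
    have 1: "?S + ?S = cscale (of_real t) X"
      by (simp add: cscale_def vec_eq_iff)
    have p1: "Y ** ?S = cscale (of_real (t/2)) (Y ** X)" for Y
      by (simp add: cscale_def matrix_matrix_mult_def vec_eq_iff sum_distrib_left mult_ac)
    have p2: "cscale a Y ** X = cscale a (Y ** X)" for a Y
      by (simp add: cscale_def matrix_matrix_mult_def vec_eq_iff sum_distrib_left mult_ac)
    have p3: "cscale a (cscale b Y) = cscale (a * b) Y" for a b and Y :: "complex ^ ('g + 'g) ^ ('g + 'g)"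
      by (simp add: cscale_def vec_eq_iff)
    have p4: "complex_of_real (t/2) * of_real (t/2) = of_real (t\<^sup>2 / 4)" by (simp add: power2_eq_square)
    have 2: "(B + mat 1) ** ?S ** ?S = cscale (of_real (t\<^sup>2 / 4)) ((B + mat 1) ** X ** X)"
      by (simp only: p1 p2 p3 p4)
    show ?thesis using B unfolding 1 2 by blast
  qed
  then obtain B where B: "\<And>t. B t \<in> USp"
    "\<And>t. B t = mat 1 + cscale (of_real t) X + cscale (of_real (t\<^sup>2 / 4)) ((B t + mat 1) ** X ** X)" by metis
  \<comment> \<open>a common bound for the entries of \<open>X ** X\<close>\<close>
  define N where "N = (\<Sum>i\<in>UNIV. \<Sum>j\<in>UNIV. norm ((X ** X) $ i $ j))"
  have N: "norm ((X ** X) $ i $ j) \<le> N" for i j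
  proof -
    have "norm ((X ** X) $ i $ j) \<le> (\<Sum>j\<in>UNIV. norm ((X ** X) $ i $ j))" by (rule member_le_sum) auto
    also have "\<dots> \<le> N" unfolding N_def by (rule member_le_sum[where f = "\<lambda>i. \<Sum>j\<in>UNIV. norm ((X ** X) $ i $ j)"]) (auto intro: sum_nonneg)
    finally show ?thesis .
  qed
  have "norm (B t $ i $ j - mat 1 $ i $ j - of_real t * X $ i $ j) \<le> (real CARD('g + 'g) * (2 * N)) * t\<^sup>2" for t i j
  proof -
    have "B t $ i $ j = mat 1 $ i $ j + of_real t * X $ i $ j + of_real (t\<^sup>2 / 4) * ((B t + mat 1) ** X ** X) $ i $ j"
      using arg_cong[OF B(2)[of t], of "\<lambda>Y. Y $ i $ j"] by (simp add: cscale_def)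
    then have "norm (B t $ i $ j - mat 1 $ i $ j - of_real t * X $ i $ j) = t\<^sup>2 / 4 * norm (((B t + mat 1) ** (X ** X)) $ i $ j)"
      by (simp add: norm_mult matrix_mul_assoc norm_power)
    also have "norm (((B t + mat 1) ** (X ** X)) $ i $ j) \<le> (\<Sum>l\<in>UNIV. norm ((B t + mat 1) $ i $ l * (X ** X) $ l $ j))"
      unfolding matrix_matrix_mult_def[of "B t + mat 1"] by (simp add: norm_sum)
    also have "\<dots> \<le> (\<Sum>l\<in>(UNIV::('g + 'g) set). 2 * N)"
    proof (rule sum_mono)
      fix l
      have "norm ((B t + mat 1) $ i $ l) \<le> norm (B t $ i $ l) + norm (mat 1 $ i $ l :: complex)"
        by (simp add: norm_triangle_ineq)
      also have "\<dots> \<le> 1 + 1" using USp_entry_bound[OF B(1)] by (intro add_mono) (auto simp: mat_def)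
      finally show "norm ((B t + mat 1) $ i $ l * (X ** X) $ l $ j) \<le> 2 * N"
        unfolding norm_mult using N[of l j] by (intro mult_mono) auto
    qed
    also have "\<dots> = real CARD('g + 'g) * (2 * N)" by simp
    finally have "norm (B t $ i $ j - mat 1 $ i $ j - of_real t * X $ i $ j) \<le> t\<^sup>2 / 4 * (real CARD('g + 'g) * (2 * N))"
      by (simp add: mult_left_mono)
    also have "\<dots> \<le> t\<^sup>2 * (real CARD('g + 'g) * (2 * N))"
      using order_trans[OF norm_ge_zero N] by (intro mult_right_mono) auto
    finally show ?thesis by (simp add: mult_ac)
  qed
  then show ?thesis unfolding curve_def using B(1) by blast
qed

section \<open>First-order expansions along a curve\<close>

text \<open>
  \<open>D\<close> is the derivative of \<open>F\<close> along left translation by the curve \<open>B\<close>, uniformly on the group.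
  Demanding a uniform quadratic error lets the expansion be integrated directly.
\<close>

definition jet where
  "jet B F D \<longleftrightarrow> (\<exists>K. (\<forall>A\<in>USp. norm (F A) \<le> K \<and> norm (D A) \<le> K) \<and>
     (\<forall>t. \<forall>A\<in>USp. \<bar>t\<bar> \<le> 1 \<longrightarrow> norm (F (B t ** A) - F A - of_real t * D A) \<le> K * t\<^sup>2))"
  for F D :: "complex ^ ('g + 'g) ^ ('g::finite + 'g) \<Rightarrow> complex"

lemma jet_const: "jet B (\<lambda>_. c) (\<lambda>_. 0)"
  unfolding jet_def by (intro exI[of _ "norm c"]) auto

lemma jet_add:
  assumes "jet B F D" "jet B F' D'"
  shows "jet B (\<lambda>A. F A + F' A) (\<lambda>A. D A + D' A)"
proof -
  obtain K where K: "\<forall>A\<in>USp. norm (F A) \<le> K \<and> norm (D A) \<le> K"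
     "\<forall>t. \<forall>A\<in>USp. \<bar>t\<bar> \<le> 1 \<longrightarrow> norm (F (B t ** A) - F A - of_real t * D A) \<le> K * t\<^sup>2"
    using assms(1) by (auto simp: jet_def)
  obtain K' where K': "\<forall>A\<in>USp. norm (F' A) \<le> K' \<and> norm (D' A) \<le> K'"
     "\<forall>t. \<forall>A\<in>USp. \<bar>t\<bar> \<le> 1 \<longrightarrow> norm (F' (B t ** A) - F' A - of_real t * D' A) \<le> K' * t\<^sup>2"
    using assms(2) by (auto simp: jet_def)
  have n: "norm (x + y) \<le> K + K'" if "norm x \<le> K" "norm y \<le> K'" for x y :: complex
    using that norm_triangle_ineq[of x y] by linarith
  have "norm (F (B t ** A) + F' (B t ** A) - (F A + F' A) - of_real t * (D A + D' A)) \<le> (K + K') * t\<^sup>2"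
    if "A \<in> USp" "\<bar>t\<bar> \<le> 1" for A t
  proof -
    have "norm (F (B t ** A) + F' (B t ** A) - (F A + F' A) - of_real t * (D A + D' A)) =
      norm ((F (B t ** A) - F A - of_real t * D A) + (F' (B t ** A) - F' A - of_real t * D' A))"
      by (simp add: algebra_simps)
    also have "\<dots> \<le> K * t\<^sup>2 + K' * t\<^sup>2" using K(2) K'(2) that by (intro norm_triangle_le add_mono) auto
    finally show ?thesis by (simp add: algebra_simps)
  qed
  then show ?thesis unfolding jet_def using K(1) K'(1) n by (intro exI[of _ "K + K'"]) auto
qed

lemma jet_mult:
  assumes "jet B F D" "jet B F' D'" and B: "\<And>t. B t \<in> USp"
  shows "jet B (\<lambda>A. F A * F' A) (\<lambda>A. D A * F' A + F A * D' A)"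
proof -
  obtain K where K: "\<And>A. A \<in> USp \<Longrightarrow> norm (F A) \<le> K" "\<And>A. A \<in> USp \<Longrightarrow> norm (D A) \<le> K"
     "\<And>t A. A \<in> USp \<Longrightarrow> \<bar>t\<bar> \<le> 1 \<Longrightarrow> norm (F (B t ** A) - F A - of_real t * D A) \<le> K * t\<^sup>2"
    using assms(1) by (auto simp: jet_def)
  obtain K' where K': "\<And>A. A \<in> USp \<Longrightarrow> norm (F' A) \<le> K'" "\<And>A. A \<in> USp \<Longrightarrow> norm (D' A) \<le> K'"
     "\<And>t A. A \<in> USp \<Longrightarrow> \<bar>t\<bar> \<le> 1 \<Longrightarrow> norm (F' (B t ** A) - F' A - of_real t * D' A) \<le> K' * t\<^sup>2"
    using assms(2) by (auto simp: jet_def)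
  have nn: "K \<ge> 0" "K' \<ge> 0"
    using K(1)[OF B[of 0]] K'(1)[OF B[of 0]] order_trans[OF norm_ge_zero] by blast+
  have p: "norm (x * y) \<le> K * K'" if "norm x \<le> K" "norm y \<le> K'" for x y :: complex
    unfolding norm_mult using that nn by (intro mult_mono) auto
  have 1: "norm (F A * F' A) \<le> 4 * K * K'" "norm (D A * F' A + F A * D' A) \<le> 4 * K * K'" if "A \<in> USp" for A
  proof -
    have "norm (F A * F' A) \<le> K * K'" using K K' that by (intro p)
    moreover have "norm (D A * F' A + F A * D' A) \<le> K * K' + K * K'"
      using K K' that by (intro norm_triangle_le add_mono p)
    moreover have "K * K' \<ge> 0" using nn by simp
    ultimately show "norm (F A * F' A) \<le> 4 * K * K'" "norm (D A * F' A + F A * D' A) \<le> 4 * K * K'" by linarith+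
  qed
  have 2: "norm (F (B t ** A) * F' (B t ** A) - F A * F' A - of_real t * (D A * F' A + F A * D' A)) \<le> 4 * K * K' * t\<^sup>2"
    if A: "A \<in> USp" and t: "\<bar>t\<bar> \<le> 1" for A t
  proof -
    define r r' where "r = F (B t ** A) - F A - of_real t * D A" and "r' = F' (B t ** A) - F' A - of_real t * D' A"
    have r: "norm r \<le> K * t\<^sup>2" "norm r' \<le> K' * t\<^sup>2" unfolding r_def r'_def using K(3) K'(3) A t by auto
    have BA: "B t ** A \<in> USp" by (rule USp_mult[OF B A])
    have a: "norm (of_real t * of_real t * (D A * D' A)) \<le> K * K' * t\<^sup>2"
    proof -
      have "norm (of_real t * of_real t * (D A * D' A)) = t\<^sup>2 * norm (D A * D' A)"
        by (simp add: norm_mult power2_eq_square)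
      also have "\<dots> \<le> t\<^sup>2 * (K * K')" using K K' A by (intro mult_left_mono p) auto
      finally show ?thesis by (simp add: mult_ac)
    qed
    have b: "norm (r * F' (B t ** A)) \<le> K * K' * t\<^sup>2"
    proof -
      have "norm (r * F' (B t ** A)) \<le> (K * t\<^sup>2) * K'"
        unfolding norm_mult using r K'(1)[OF BA] nn by (intro mult_mono) auto
      then show ?thesis by (simp add: mult_ac)
    qed
    have c: "norm (F A * r') \<le> K * K' * t\<^sup>2"
    proof -
      have "norm (F A * r') \<le> K * (K' * t\<^sup>2)"
        unfolding norm_mult using r K(1)[OF A] nn by (intro mult_mono) auto
      then show ?thesis by (simp add: mult_ac)
    qed
    have d: "norm (of_real t * D A * r') \<le> K * K' * t\<^sup>2"
    proof -
      have "norm (of_real t * D A * r') \<le> (1 * K) * (K' * t\<^sup>2)"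
        unfolding norm_mult using r K(2)[OF A] nn t by (intro mult_mono) auto
      then show ?thesis by (simp add: mult_ac)
    qed
    have "F (B t ** A) * F' (B t ** A) - F A * F' A - of_real t * (D A * F' A + F A * D' A) =
      of_real t * of_real t * (D A * D' A) + r * F' (B t ** A) + F A * r' + of_real t * D A * r'"
      unfolding r_def r'_def by (simp add: algebra_simps)
    also have "norm \<dots> \<le> K * K' * t\<^sup>2 + K * K' * t\<^sup>2 + K * K' * t\<^sup>2 + K * K' * t\<^sup>2"
      using a b c d by (intro norm_triangle_le add_mono order_refl)
    finally show ?thesis by (simp add: mult_ac)
  qed
  show ?thesis unfolding jet_def using 1 2 by (intro exI[of _ "4 * K * K'"]) auto
qed

lemma jet_sum:
  "finite I \<Longrightarrow> (\<And>i. i \<in> I \<Longrightarrow> jet B (F i) (D i)) \<Longrightarrow> jet B (\<lambda>A. \<Sum>i\<in>I. F i A) (\<lambda>A. \<Sum>i\<in>I. D i A)"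
  by (induction I rule: finite_induct) (auto intro: jet_const jet_add)

lemma jet_cmult:
  assumes "jet B F D" "\<And>t. B t \<in> USp" shows "jet B (\<lambda>A. c * F A) (\<lambda>A. c * D A)"
  using jet_mult[OF jet_const assms(1), of c] assms(2) by simp

lemma jet_entry:
  fixes X :: "complex ^ ('g + 'g) ^ ('g::finite + 'g)"
  assumes "curve X B"
  shows "jet B (\<lambda>A. A $ i $ j) (\<lambda>A. (X ** A) $ i $ j)"
proof -
  obtain L where L': "\<forall>t i j. \<bar>t\<bar> \<le> 1 \<longrightarrow> norm (B t $ i $ j - mat 1 $ i $ j - of_real t * X $ i $ j) \<le> L * t\<^sup>2"
    using assms unfolding curve_def by blast
  note L = L'[rule_format]
  define K where "K = Max {1, real CARD('g + 'g) * L, \<Sum>l\<in>UNIV. norm (X $ i $ l)}"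
  have K: "1 \<le> K" "real CARD('g + 'g) * L \<le> K" "(\<Sum>l\<in>UNIV. norm (X $ i $ l)) \<le> K"
    by (auto simp: K_def)
  have 1: "norm (A $ i $ j) \<le> K" "norm ((X ** A) $ i $ j) \<le> K" if "A \<in> USp" for A
  proof -
    show "norm (A $ i $ j) \<le> K" using USp_entry_bound[OF that, of i j] K by linarith
    have "norm ((X ** A) $ i $ j) \<le> (\<Sum>l\<in>UNIV. norm (X $ i $ l * A $ l $ j))"
      by (simp add: matrix_matrix_mult_def norm_sum)
    also have "\<dots> \<le> (\<Sum>l\<in>UNIV. norm (X $ i $ l))"
      using USp_entry_bound[OF that] by (intro sum_mono) (simp add: norm_mult mult_left_le)
    finally show "norm ((X ** A) $ i $ j) \<le> K" using K by linarith
  qed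
  have 2: "norm ((B t ** A) $ i $ j - A $ i $ j - of_real t * (X ** A) $ i $ j) \<le> K * t\<^sup>2"
    if A: "A \<in> USp" and t: "\<bar>t\<bar> \<le> 1" for A t
  proof -
    have "(B t ** A) $ i $ j - A $ i $ j - of_real t * (X ** A) $ i $ j =
      (B t ** A) $ i $ j - (mat 1 ** A) $ i $ j - of_real t * (X ** A) $ i $ j" by simp
    also have "\<dots> = (\<Sum>l\<in>UNIV. (B t $ i $ l - mat 1 $ i $ l - of_real t * X $ i $ l) * A $ l $ j)"
      unfolding matrix_matrix_mult_def by (simp add: sum_subtractf[symmetric] sum_distrib_left algebra_simps)
    finally have "norm ((B t ** A) $ i $ j - A $ i $ j - of_real t * (X ** A) $ i $ j) \<le>
       (\<Sum>l\<in>UNIV. norm ((B t $ i $ l - mat 1 $ i $ l - of_real t * X $ i $ l) * A $ l $ j))"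
      by (simp add: norm_sum)
    also have "\<dots> \<le> (\<Sum>l\<in>(UNIV::('g + 'g) set). L * t\<^sup>2)"
    proof (rule sum_mono)
      fix l
      have "norm ((B t $ i $ l - mat 1 $ i $ l - of_real t * X $ i $ l) * A $ l $ j) \<le> (L * t\<^sup>2) * 1"
        unfolding norm_mult using L[OF t, of i l] USp_entry_bound[OF A, of l j]
        by (intro mult_mono) (auto intro: order_trans[OF norm_ge_zero])
      then show "norm ((B t $ i $ l - mat 1 $ i $ l - of_real t * X $ i $ l) * A $ l $ j) \<le> L * t\<^sup>2" by simp
    qed
    also have "\<dots> = (real CARD('g + 'g) * L) * t\<^sup>2" by simp
    also have "\<dots> \<le> K * t\<^sup>2" using K by (intro mult_right_mono) auto
    finally show ?thesis .
  qed
  show ?thesis unfolding jet_def using 1 2 by (intro exI[of _ K]) auto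
qed

text \<open>
  The derivative of the \<open>k\<close>-th power of \<open>A\<close> in the direction \<open>X ** A\<close>.
\<close>

primrec dpow :: "'a::comm_ring_1 ^ 'n ^ 'n::finite \<Rightarrow> 'a ^ 'n ^ 'n \<Rightarrow> nat \<Rightarrow> 'a ^ 'n ^ 'n" where
  "dpow X A 0 = 0"
| "dpow X A (Suc k) = X ** A ** mpow A k + A ** dpow X A k"

lemma jet_mpow:
  fixes X :: "complex ^ ('g + 'g) ^ ('g::finite + 'g)"
  assumes "curve X B"
  shows "jet B (\<lambda>A. mpow A k $ i $ j) (\<lambda>A. dpow X A k $ i $ j)"
proof (induction k arbitrary: i j)
  case 0 then show ?case by (simp add: jet_const)
next
  case (Suc k)
  have B: "\<And>t. B t \<in> USp" using assms by (simp add: curve_def)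
  have "jet B (\<lambda>A. \<Sum>l\<in>UNIV. A $ i $ l * mpow A k $ l $ j)
     (\<lambda>A. \<Sum>l\<in>UNIV. (X ** A) $ i $ l * mpow A k $ l $ j + A $ i $ l * dpow X A k $ l $ j)"
    by (rule jet_sum, simp, rule jet_mult, rule jet_entry[OF assms], rule Suc, rule B)
  then show ?case by (simp add: matrix_matrix_mult_def[of _ "mpow _ _"] matrix_matrix_mult_def[of _ "dpow _ _ _"] sum.distrib)
qed

lemma jet_trace_mpow:
  fixes X :: "complex ^ ('g + 'g) ^ ('g::finite + 'g)"
  assumes "curve X B"
  shows "jet B (\<lambda>A. trace (Y ** mpow A k)) (\<lambda>A. trace (Y ** dpow X A k))"
proof -
  have B: "\<And>t. B t \<in> USp" using assms by (simp add: curve_def)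
  have "jet B (\<lambda>A. \<Sum>i\<in>UNIV. \<Sum>l\<in>UNIV. Y $ i $ l * mpow A k $ l $ i)
     (\<lambda>A. \<Sum>i\<in>UNIV. \<Sum>l\<in>UNIV. Y $ i $ l * dpow X A k $ l $ i)"
    by (rule jet_sum, simp, rule jet_sum, simp, rule jet_cmult, rule jet_mpow[OF assms], rule B)
  moreover have "trace (Y ** Z) = (\<Sum>i\<in>UNIV. \<Sum>l\<in>UNIV. Y $ i $ l * Z $ l $ i)" for Z
    by (simp add: trace_def matrix_matrix_mult_def)
  ultimately show ?thesis by (simp only:)
qed

section \<open>Traces in terms of eigenangles\<close>
lemma trace_uminus: "trace (- A) = - trace A" for A :: "complex ^ 'n::finite ^ 'n"
  by (simp add: trace_def sum_negf)

lemma trace_sum: "trace (\<Sum>i\<in>I. A i) = (\<Sum>i\<in>I. trace (A i))" for A :: "'i \<Rightarrow> complex ^ 'n::finite ^ 'n"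
  by (induction I rule: infinite_finite_induct) (simp_all add: trace_add trace_def)

lemma matrix_sum_mult_left: "A ** (\<Sum>i\<in>I. B i) = (\<Sum>i\<in>I. A ** B i)" for A :: "complex ^ 'n::finite ^ 'm"
  by (induction I rule: infinite_finite_induct) (simp_all add: matrix_add_distrib_left)

lemma mpow_conj_transpose: "mpow (conj_transpose A) k = conj_transpose (mpow A k)"
proof (induction k)
  case (Suc k)
  then show ?case unfolding mpow_Suc2[of A] conj_transpose_mult by simp
qed simp

lemma trace_conj_transpose: "trace (conj_transpose A) = cnj (trace A)" for A :: "complex ^ 'n::finite ^ 'n"
  by (simp add: trace_def conj_transpose_def)

lemma symp_conj_mpow:
  assumes A: "A \<in> USp"
  shows "symp_form ** transpose (mpow A k) ** symp_form = - mpow (conj_transpose A) k"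
proof (induction k)
  case 0 then show ?case by (simp add: transpose_mat symp_form_square)
next
  case (Suc k)
  let ?J = symp_form
  have "mpow (conj_transpose A) (Suc k) = (?J ** transpose A ** ?J) ** (?J ** transpose (mpow A k) ** ?J)"
    by (simp add: Suc symp_conj[OF A] matrix_neg_mult_left matrix_neg_mult_right)
  also have "\<dots> = ?J ** transpose A ** (?J ** ?J) ** transpose (mpow A k) ** ?J"
    by (simp add: matrix_mul_assoc)
  also have "\<dots> = - (?J ** (transpose A ** transpose (mpow A k)) ** ?J)"
    unfolding symp_form_square by (simp add: matrix_neg_mult_left matrix_neg_mult_right matrix_mul_assoc)
  also have "transpose A ** transpose (mpow A k) = transpose (mpow A (Suc k))"
    unfolding mpow_Suc2 matrix_transpose_mul ..
  finally show ?case by simp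
qed

text \<open>
  Some eigenangles of \<open>A\<close>; symmetric functions do not depend on the choice.
\<close>

definition theta :: "complex ^ ('g + 'g) ^ ('g::finite + 'g) \<Rightarrow> nat \<Rightarrow> real" where
  "theta A = (SOME \<theta>. \<forall>k. trace (mpow A k) = of_real (psum CARD('g) (int k) \<theta>))"

lemma trace_mpow_theta:
  fixes A :: "complex ^ ('g + 'g) ^ ('g::finite + 'g)"
  shows "A \<in> USp \<Longrightarrow> trace (mpow A k) = of_real (psum CARD('g) (int k) (theta A))"
  unfolding theta_def using someI_ex[OF USp_eigenangles[of A]] by blast

lemma mpow_cancel:
  assumes "A \<in> USp"
  shows "mpow (conj_transpose A) j ** mpow A j = mat 1"
proof (induction j)
  case (Suc j)
  have "mpow (conj_transpose A) (Suc j) ** mpow A (Suc j) =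
     mpow (conj_transpose A) j ** (conj_transpose A ** A) ** mpow A j"
    unfolding mpow_Suc2[of "conj_transpose A"] by (simp add: matrix_mul_assoc)
  then show ?case using Suc by (simp add: USp_left_inverse[OF assms])
qed simp

text \<open>
  The two powers cancel up to the power \<open>m - j\<close>, where negative powers have the same trace because
  the traces are real.
\<close>

lemma trace_mixed:
  fixes A :: "complex ^ ('g + 'g) ^ ('g::finite + 'g)"
  assumes A: "A \<in> USp"
  shows "trace (mpow (conj_transpose A) j ** mpow A m) = of_real (psum CARD('g) (int m - int j) (theta A))"
proof (cases "j \<le> m")
  case True
  then have "mpow A m = mpow A j ** mpow A (m - j)" by (simp flip: mpow_add)
  then have "mpow (conj_transpose A) j ** mpow A m = mpow A (m - j)"
    by (simp add: matrix_mul_assoc mpow_cancel[OF A])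
  then show ?thesis using True by (simp add: trace_mpow_theta[OF A] of_nat_diff)
next
  case False
  then have "mpow (conj_transpose A) j = mpow (conj_transpose A) (j - m) ** mpow (conj_transpose A) m"
    by (simp flip: mpow_add)
  then have "mpow (conj_transpose A) j ** mpow A m = mpow (conj_transpose A) (j - m)"
    by (simp add: matrix_mul_assoc[symmetric] mpow_cancel[OF A])
  then have "trace (mpow (conj_transpose A) j ** mpow A m) = of_real (psum CARD('g) (int (j - m)) (theta A))"
    by (simp add: mpow_conj_transpose trace_conj_transpose trace_mpow_theta[OF A])
  also have "int (j - m) = - (int m - int j)" using False by simp
  finally show ?thesis by (simp only: psum_minus)
qed

section \<open>Contraction with the Casimir tensor\<close>

text \<open>
  Twice the orthogonal projection of an elementary matrix to the symmetric matrices.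
\<close>

definition sym_unit :: "'n \<Rightarrow> 'n \<Rightarrow> complex ^ 'n ^ 'n::finite" where
  "sym_unit a b = (\<chi> i j. of_bool (i = a) * of_bool (j = b) + of_bool (i = b) * of_bool (j = a))"

lemma sum_of_bool_mult: "(\<Sum>m\<in>UNIV. of_bool (m = b) * f m) = f b" for f :: "'n::finite \<Rightarrow> complex"
proof -
  have "(\<Sum>m\<in>UNIV. of_bool (m = b) * f m) = (\<Sum>m\<in>UNIV. if m = b then f m else 0)"
    by (intro sum.cong refl) simp
  then show ?thesis by simp
qed

lemma sym_unit_mult: "(sym_unit a b ** V) $ l $ j = of_bool (l = a) * V $ b $ j + of_bool (l = b) * V $ a $ j"
proof -
  have "(sym_unit a b ** V) $ l $ j =
      (\<Sum>m\<in>UNIV. (of_bool (l = a) * of_bool (m = b) + of_bool (l = b) * of_bool (m = a)) * V $ m $ j)"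
    by (simp only: matrix_matrix_mult_def sym_unit_def vec_lambda_beta)
  also have "\<dots> = of_bool (l = a) * (\<Sum>m\<in>UNIV. of_bool (m = b) * V $ m $ j)
      + of_bool (l = b) * (\<Sum>m\<in>UNIV. of_bool (m = a) * V $ m $ j)"
    by (simp only: distrib_right sum.distrib sum_distrib_left mult.assoc)
  finally show ?thesis by (simp only: sum_of_bool_mult)
qed

lemma trace_sym_unit: "trace (sym_unit a b ** P) = P $ b $ a + P $ a $ b"
  by (simp only: trace_def sym_unit_mult sum.distrib sum_of_bool_mult)

lemma sym_unit_sandwich: "(U ** sym_unit a b ** V) $ i $ j = U $ i $ a * V $ b $ j + U $ i $ b * V $ a $ j"
proof -
  have "(U ** (sym_unit a b ** V)) $ i $ j =
      (\<Sum>l\<in>UNIV. U $ i $ l * (of_bool (l = a) * V $ b $ j + of_bool (l = b) * V $ a $ j))"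
    by (simp only: matrix_matrix_mult_def[of U] vec_lambda_beta sym_unit_mult)
  also have "\<dots> = (\<Sum>l\<in>UNIV. of_bool (l = a) * (U $ i $ l * V $ b $ j)) + (\<Sum>l\<in>UNIV. of_bool (l = b) * (U $ i $ l * V $ a $ j))"
    by (simp only: distrib_left sum.distrib mult.left_commute)
  also have "\<dots> = U $ i $ a * V $ b $ j + U $ i $ b * V $ a $ j" by (simp only: sum_of_bool_mult)
  finally show ?thesis by (simp only: matrix_mul_assoc)
qed

lemma contraction_sandwich:
  "(\<Sum>a\<in>UNIV. \<Sum>b\<in>UNIV. trace (sym_unit a b ** (U ** sym_unit a b ** V))) =
     2 * trace (transpose U ** V) + 2 * (trace U * trace V)"
proof -
  have "(\<Sum>a\<in>UNIV. \<Sum>b\<in>UNIV. trace (sym_unit a b ** (U ** sym_unit a b ** V))) =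
    (\<Sum>a\<in>UNIV. \<Sum>b\<in>UNIV. U $ b $ a * V $ b $ a) + (\<Sum>a\<in>UNIV. \<Sum>b\<in>UNIV. U $ b $ b * V $ a $ a)
    + (\<Sum>a\<in>UNIV. \<Sum>b\<in>UNIV. U $ a $ a * V $ b $ b) + (\<Sum>a\<in>UNIV. \<Sum>b\<in>UNIV. U $ a $ b * V $ a $ b)"
    unfolding trace_sym_unit sym_unit_sandwich sum.distrib by (simp add: add_ac)
  also have "(\<Sum>a\<in>UNIV. \<Sum>b\<in>UNIV. U $ b $ a * V $ b $ a) = trace (transpose U ** V)"
    by (simp add: trace_def matrix_matrix_mult_def Finite_Cartesian_Product.transpose_def)
  also have "(\<Sum>a\<in>UNIV. \<Sum>b\<in>UNIV. U $ a $ b * V $ a $ b) = (\<Sum>b\<in>UNIV. \<Sum>a\<in>UNIV. U $ a $ b * V $ a $ b)"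
    by (rule sum.swap)
  also have "\<dots> = trace (transpose U ** V)"
    by (simp add: trace_def matrix_matrix_mult_def Finite_Cartesian_Product.transpose_def)
  also have "(\<Sum>a\<in>UNIV. \<Sum>b\<in>UNIV. U $ b $ b * V $ a $ a) = trace U * trace V"
    by (simp add: trace_def sum_product) (rule sum.swap)
  also have "(\<Sum>a\<in>UNIV. \<Sum>b\<in>UNIV. U $ a $ a * V $ b $ b) = trace U * trace V"
    by (simp add: trace_def sum_product)
  finally show ?thesis by simp
qed

lemma contraction_product:
  "(\<Sum>a\<in>UNIV. \<Sum>b\<in>UNIV. trace (sym_unit a b ** P) * trace (sym_unit a b ** Q)) =
     2 * trace (P ** Q) + 2 * trace (P ** transpose Q)"
proof -
  have t1: "(\<Sum>a\<in>UNIV. \<Sum>b\<in>UNIV. P $ a $ b * Q $ a $ b) = trace (P ** transpose Q)"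
    by (simp add: trace_def matrix_matrix_mult_def Finite_Cartesian_Product.transpose_def)
  have t2: "(\<Sum>a\<in>UNIV. \<Sum>b\<in>UNIV. P $ a $ b * Q $ b $ a) = trace (P ** Q)"
    by (simp add: trace_def matrix_matrix_mult_def)
  have t3: "(\<Sum>a\<in>UNIV. \<Sum>b\<in>UNIV. P $ b $ a * Q $ b $ a) = trace (P ** transpose Q)"
    by (subst sum.swap) (rule t1)
  have t4: "(\<Sum>a\<in>UNIV. \<Sum>b\<in>UNIV. P $ b $ a * Q $ a $ b) = trace (P ** Q)"
    by (subst sum.swap) (rule t2)
  have "(\<Sum>a\<in>UNIV. \<Sum>b\<in>UNIV. trace (sym_unit a b ** P) * trace (sym_unit a b ** Q)) =
    (\<Sum>a\<in>UNIV. \<Sum>b\<in>UNIV. P $ b $ a * Q $ b $ a) + (\<Sum>a\<in>UNIV. \<Sum>b\<in>UNIV. P $ b $ a * Q $ a $ b)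
    + ((\<Sum>a\<in>UNIV. \<Sum>b\<in>UNIV. P $ a $ b * Q $ b $ a) + (\<Sum>a\<in>UNIV. \<Sum>b\<in>UNIV. P $ a $ b * Q $ a $ b))"
    by (simp only: trace_sym_unit sum.distrib distrib_left distrib_right add_ac)
  then show ?thesis by (simp only: t1 t2 t3 t4) simp
qed

text \<open>
  The matrices \<open>lieX a b\<close> and \<open>lieY a b\<close> belong to \<open>lie_sp\<close>, and up to a factor the sum of
  \<open>lieX a b \<otimes> lieY a b\<close> over all \<open>a\<close> and \<open>b\<close> is the Casimir tensor.
\<close>

definition lieX :: "'g + 'g \<Rightarrow> 'g + 'g \<Rightarrow> complex ^ ('g + 'g) ^ ('g::finite + 'g)" where
  "lieX a b = sym_unit a b ** symp_form"

definition lieY :: "'g + 'g \<Rightarrow> 'g + 'g \<Rightarrow> complex ^ ('g + 'g) ^ ('g::finite + 'g)" where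
  "lieY a b = - (symp_form ** sym_unit a b)"

lemma dpow_sum: "dpow X A k = (\<Sum>j<k. mpow A j ** X ** mpow A (k - j))" for X :: "complex ^ 'n ^ 'n::finite"
proof (induction k)
  case (Suc k)
  have "dpow X A (Suc k) = X ** mpow A (Suc k) + (\<Sum>j<k. mpow A (Suc j) ** X ** mpow A (k - j))"
    by (simp add: Suc matrix_sum_mult_left matrix_mul_assoc)
  then show ?case by (simp add: sum.lessThan_Suc_shift del: sum.lessThan_Suc mpow.simps(2))
qed simp

lemma trace_dpow: "trace (dpow X A k) = of_nat k * trace (X ** mpow A k)" for X :: "complex ^ 'n ^ 'n::finite"
proof -
  have "trace (mpow A j ** X ** mpow A (k - j)) = trace (X ** mpow A k)" if "j < k" for j
  proof -
    have "trace (mpow A j ** (X ** mpow A (k - j))) = trace ((X ** mpow A (k - j)) ** mpow A j)"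
      by (rule trace_mul_sym)
    also have "\<dots> = trace (X ** (mpow A (k - j) ** mpow A j))" by (simp add: matrix_mul_assoc)
    also have "mpow A (k - j) ** mpow A j = mpow A k" using that by (simp flip: mpow_add)
    finally show ?thesis by (simp add: matrix_mul_assoc)
  qed
  then show ?thesis by (simp add: dpow_sum trace_sum)
qed

lemma trace_lieY: "trace (lieY a b ** M) = - trace (sym_unit a b ** (M ** symp_form))"
proof -
  have "trace (lieY a b ** M) = - trace (symp_form ** (sym_unit a b ** M))"
    by (simp add: lieY_def matrix_neg_mult_left trace_uminus matrix_mul_assoc)
  also have "trace (symp_form ** (sym_unit a b ** M)) = trace ((sym_unit a b ** M) ** symp_form)"
    by (rule trace_mul_sym)
  finally show ?thesis by (simp add: matrix_mul_assoc)
qed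

lemma trace_lieX: "trace (lieX a b ** N) = trace (sym_unit a b ** (symp_form ** N))"
  by (simp add: lieX_def matrix_mul_assoc)

text \<open>
  The contraction turns \<open>A ^ j\<close> and \<open>A ^ (k - j)\<close> between the two Lie algebra elements into a
  product of two traces plus a trace of \<open>A ^ (k - 2 j)\<close>.
\<close>

lemma casimir_second_order:
  fixes A :: "complex ^ ('g + 'g) ^ ('g::finite + 'g)"
  assumes A: "A \<in> USp"
  shows "(\<Sum>a\<in>UNIV. \<Sum>b\<in>UNIV. trace (lieY a b ** dpow (lieX a b) A k)) = 2 * of_real (loop CARD('g) k (theta A))"
proof -
  let ?J = "symp_form :: complex ^ ('g + 'g) ^ ('g + 'g)"
  have sandwich: "(\<Sum>a\<in>UNIV. \<Sum>b\<in>UNIV. trace (lieY a b ** (M ** lieX a b ** N))) =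
     2 * trace (- (?J ** transpose M ** ?J) ** N) + 2 * (trace M * trace N)" for M N :: "complex ^ ('g + 'g) ^ ('g + 'g)"
  proof -
    have "trace (lieY a b ** (M ** lieX a b ** N)) = - trace (sym_unit a b ** (M ** sym_unit a b ** (?J ** N ** ?J)))" for a b
      unfolding trace_lieY by (simp add: lieX_def matrix_mul_assoc)
    then have "(\<Sum>a\<in>UNIV. \<Sum>b\<in>UNIV. trace (lieY a b ** (M ** lieX a b ** N))) =
      - (2 * trace (transpose M ** (?J ** N ** ?J)) + 2 * (trace M * trace (?J ** N ** ?J)))"
      by (simp only: sum_negf contraction_sandwich)
    also have "trace (?J ** N ** ?J) = trace (?J ** (?J ** N))" by (rule trace_mul_sym)
    also have "\<dots> = - trace N" by (simp add: matrix_mul_assoc symp_form_square matrix_neg_mult_left trace_uminus)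
    also have "trace (transpose M ** (?J ** N ** ?J)) = trace ((transpose M ** ?J ** N) ** ?J)"
      by (simp add: matrix_mul_assoc)
    also have "\<dots> = trace (?J ** (transpose M ** ?J ** N))" by (rule trace_mul_sym)
    also have "\<dots> = - trace (- (?J ** transpose M ** ?J) ** N)"
      by (simp add: matrix_neg_mult_left trace_uminus matrix_mul_assoc)
    finally show ?thesis by simp
  qed
  have "(\<Sum>a\<in>UNIV. \<Sum>b\<in>UNIV. trace (lieY a b ** dpow (lieX a b) A k)) =
    (\<Sum>a\<in>UNIV. \<Sum>b\<in>UNIV. \<Sum>j<k. trace (lieY a b ** (mpow A j ** lieX a b ** mpow A (k - j))))"
    by (simp add: dpow_sum matrix_sum_mult_left trace_sum)
  also have "\<dots> = (\<Sum>a\<in>UNIV. \<Sum>j<k. \<Sum>b\<in>UNIV. trace (lieY a b ** (mpow A j ** lieX a b ** mpow A (k - j))))"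
    by (intro sum.cong refl sum.swap)
  also have "\<dots> = (\<Sum>j<k. \<Sum>a\<in>UNIV. \<Sum>b\<in>UNIV. trace (lieY a b ** (mpow A j ** lieX a b ** mpow A (k - j))))"
    by (rule sum.swap)
  also have "\<dots> = (\<Sum>j<k. 2 * of_real (psum CARD('g) (2 * int j - int k) (theta A) +
      psum CARD('g) (int j) (theta A) * psum CARD('g) (int k - int j) (theta A)))"
  proof (rule sum.cong[OF refl])
    fix j assume "j \<in> {..<k}"
    then have j: "int (k - j) = int k - int j" by auto
    have "psum CARD('g) (int k - int j - int j) = psum CARD('g) (2 * int j - int k)"
      using psum_minus[of "CARD('g)" "2 * int j - int k"] by (simp add: algebra_simps)
    then show "(\<Sum>a\<in>UNIV. \<Sum>b\<in>UNIV. trace (lieY a b ** (mpow A j ** lieX a b ** mpow A (k - j)))) =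
      2 * of_real (psum CARD('g) (2 * int j - int k) (theta A) +
      psum CARD('g) (int j) (theta A) * psum CARD('g) (int k - int j) (theta A))"
      unfolding sandwich symp_conj_mpow[OF A] minus_minus trace_mixed[OF A] trace_mpow_theta[OF A] j by simp
  qed
  finally show ?thesis by (simp add: loop_def sum_distrib_left)
qed

text \<open>
  Both sides equal \<open>2 l (psum (k + l) - psum (k - l))\<close>.
\<close>

lemma casimir_first_order:
  fixes A :: "complex ^ ('g + 'g) ^ ('g::finite + 'g)"
  assumes A: "A \<in> USp"
  shows "(\<Sum>a\<in>UNIV. \<Sum>b\<in>UNIV. trace (lieY a b ** mpow A k) * trace (dpow (lieX a b) A l)) =
    2 * of_real (\<Sum>j<CARD('g). vf k j (theta A) * pd j (psum CARD('g) (int l)) (theta A))"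
proof -
  let ?J = "symp_form :: complex ^ ('g + 'g) ^ ('g + 'g)"
  let ?p = "\<lambda>m. psum CARD('g) m (theta A)"
  have "trace (lieY a b ** mpow A k) * trace (dpow (lieX a b) A l) =
     - of_nat l * (trace (sym_unit a b ** (mpow A k ** ?J)) * trace (sym_unit a b ** (?J ** mpow A l)))" for a b
    by (simp add: trace_dpow trace_lieY trace_lieX)
  then have "(\<Sum>a\<in>UNIV. \<Sum>b\<in>UNIV. trace (lieY a b ** mpow A k) * trace (dpow (lieX a b) A l)) =
    - of_nat l * (2 * trace (mpow A k ** ?J ** (?J ** mpow A l)) + 2 * trace (mpow A k ** ?J ** transpose (?J ** mpow A l)))"
    by (simp only: sum_distrib_left[symmetric] contraction_product)
  also have "mpow A k ** ?J ** (?J ** mpow A l) = mpow A k ** (?J ** ?J) ** mpow A l"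
    by (simp add: matrix_mul_assoc)
  also have "\<dots> = - mpow A (k + l)"
    by (simp add: symp_form_square matrix_neg_mult_left matrix_neg_mult_right mpow_add)
  also have "mpow A k ** ?J ** transpose (?J ** mpow A l) = - (mpow A k ** (?J ** transpose (mpow A l) ** ?J))"
    by (simp add: matrix_transpose_mul symp_form_transpose matrix_neg_mult_right matrix_mul_assoc)
  also have "\<dots> = mpow A k ** mpow (conj_transpose A) l"
    by (simp add: symp_conj_mpow[OF A] matrix_neg_mult_right)
  also have "trace (mpow A k ** mpow (conj_transpose A) l) = trace (mpow (conj_transpose A) l ** mpow A k)"
    by (rule trace_mul_sym)
  also have "\<dots> = of_real (?p (int k - int l))" by (rule trace_mixed[OF A])
  also have "trace (- mpow A (k + l)) = - of_real (?p (int k + int l))"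
    by (simp add: trace_uminus trace_mpow_theta[OF A])
  finally have 1: "(\<Sum>a\<in>UNIV. \<Sum>b\<in>UNIV. trace (lieY a b ** mpow A k) * trace (dpow (lieX a b) A l)) =
    2 * of_real (real l * (?p (int k + int l) - ?p (int k - int l)))" by (simp add: algebra_simps)
  have "(\<Sum>j<CARD('g). vf k j (theta A) * pd j (psum CARD('g) (int l)) (theta A)) =
     - real l * (\<Sum>j<CARD('g). vf k j (theta A) * vf l j (theta A))"
    by (simp add: pd_psum sum_distrib_left mult_ac)
  also have "(\<Sum>j<CARD('g). vf k j (theta A) * vf l j (theta A)) = ?p (int k - int l) - ?p (int k + int l)"
    unfolding vf_def sin_sin_2 psum_def sum_subtractf[symmetric] by (simp add: algebra_simps)
  finally have 2: "(\<Sum>j<CARD('g). vf k j (theta A) * pd j (psum CARD('g) (int l)) (theta A)) =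
      - real l * (?p (int k - int l) - ?p (int k + int l))" .
  show ?thesis unfolding 1 2 by (simp add: algebra_simps)
qed

section \<open>Symmetric functions as matrix polynomials\<close>

text \<open>
  \<open>F\<close> represents the symmetric function \<open>f\<close> of the eigenangles as a function of the matrix, and
  \<open>D X\<close> is its derivative along curves with velocity \<open>X\<close>.  The derivative is extended to all complex
  \<open>X\<close>, linearly, because the matrices \<open>lieX a b\<close> do not lie in the compact Lie algebra.  The last
  clause says that the Casimir tensor pairs the differential of a power sum with that of \<open>f\<close> just as the
  vector field \<open>vf k\<close> does on the torus.
\<close>

definition realizes :: "((nat \<Rightarrow> real) \<Rightarrow> real) \<Rightarrow> (complex ^ ('g + 'g) ^ ('g::finite + 'g) \<Rightarrow> complex) \<Rightarrow>
    (complex ^ ('g + 'g) ^ ('g + 'g) \<Rightarrow> complex ^ ('g + 'g) ^ ('g + 'g) \<Rightarrow> complex) \<Rightarrow> bool" where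
  "realizes f F D \<longleftrightarrow>
     continuous_on UNIV F \<and> (\<forall>X. continuous_on UNIV (D X)) \<and>
     (\<forall>A\<in>USp. F A = of_real (f (theta A))) \<and>
     (\<forall>X B. curve X B \<longrightarrow> jet B F (D X)) \<and>
     (\<forall>X X' A. D (X + X') A = D X A + D X' A) \<and>
     (\<forall>c X A. D (cscale c X) A = c * D X A) \<and>
     (\<forall>k. \<forall>A\<in>USp. (\<Sum>a\<in>UNIV. \<Sum>b\<in>UNIV. trace (lieY a b ** mpow A k) * D (lieX a b) A) =
        2 * of_real (\<Sum>j<CARD('g). vf k j (theta A) * pd j f (theta A)))"

lemma continuous_entry: "continuous_on UNIV (\<lambda>A :: complex ^ 'n ^ 'n::finite. A $ i $ j)"
  by (intro continuous_intros)

lemma continuous_mpow: "continuous_on UNIV (\<lambda>A :: complex ^ 'n ^ 'n::finite. mpow A k $ i $ j)"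
proof (induction k arbitrary: i j)
  case (Suc k)
  have "continuous_on UNIV (\<lambda>A :: complex ^ 'n ^ 'n. \<Sum>l\<in>UNIV. A $ i $ l * mpow A k $ l $ j)"
    by (intro continuous_on_sum continuous_on_mult continuous_entry Suc)
  then show ?case by (simp add: matrix_matrix_mult_def)
qed simp

lemma continuous_dpow: "continuous_on UNIV (\<lambda>A :: complex ^ 'n ^ 'n::finite. dpow X A k $ i $ j)"
proof (induction k arbitrary: i j)
  case (Suc k)
  have "continuous_on UNIV (\<lambda>A :: complex ^ 'n ^ 'n. (\<Sum>l\<in>UNIV. X $ i $ l * mpow A (Suc k) $ l $ j) +
      (\<Sum>l\<in>UNIV. A $ i $ l * dpow X A k $ l $ j))"
    by (intro continuous_on_add continuous_on_sum continuous_on_mult continuous_on_const continuous_entry continuous_mpow Suc)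
  moreover have "dpow X A (Suc k) = X ** mpow A (Suc k) + A ** dpow X A k" for A
    by (simp add: matrix_mul_assoc)
  then have "dpow X A (Suc k) $ i $ j = (\<Sum>l\<in>UNIV. X $ i $ l * mpow A (Suc k) $ l $ j) +
      (\<Sum>l\<in>UNIV. A $ i $ l * dpow X A k $ l $ j)" for A
    by (simp add: matrix_matrix_mult_def[of X] matrix_matrix_mult_def[of _ "dpow _ _ _"] del: mpow.simps dpow.simps)
  ultimately show ?case by (simp only:)
qed simp

lemma continuous_trace_mult:
  "continuous_on UNIV (\<lambda>A :: complex ^ 'n ^ 'n::finite. trace (Y ** mpow A k))"
  "continuous_on UNIV (\<lambda>A :: complex ^ 'n ^ 'n::finite. trace (Y ** dpow X A k))"
  unfolding trace_def matrix_matrix_mult_def[of Y] vec_lambda_beta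
  by (intro continuous_on_sum continuous_on_mult continuous_on_const continuous_mpow continuous_dpow)+

lemma dpow_add: "dpow (X + X') A k = dpow X A k + dpow X' A k" for X :: "complex ^ 'n ^ 'n::finite"
  by (induction k) (simp_all add: matrix_distribs)

lemma cscale_mult_left: "cscale c X ** Y = cscale c (X ** Y)"
  by (simp add: cscale_def matrix_matrix_mult_def vec_eq_iff sum_distrib_left mult_ac)

lemma cscale_mult_right: "X ** cscale c Y = cscale c (X ** Y)"
  by (simp add: cscale_def matrix_matrix_mult_def vec_eq_iff sum_distrib_left mult_ac)

lemma trace_cscale: "trace (cscale c X) = c * trace X"
  by (simp add: trace_def cscale_def sum_distrib_left)

lemma dpow_cscale: "dpow (cscale c X) A k = cscale c (dpow X A k)" for X :: "complex ^ 'n ^ 'n::finite"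
proof (induction k)
  case 0 then show ?case by (simp add: cscale_def vec_eq_iff)
next
  case (Suc k)
  have "cscale c Y + cscale c Z = cscale c (Y + Z)" for Y Z :: "complex ^ 'n ^ 'n"
    by (simp add: cscale_def vec_eq_iff distrib_left)
  with Suc show ?case by (simp add: cscale_mult_left cscale_mult_right)
qed

lemma realizes_const: "realizes (\<lambda>_. c) (\<lambda>_. of_real c) (\<lambda>_ _. 0)"
  by (simp add: realizes_def jet_const)

lemma realizes_psum:
  "realizes (psum CARD('g) (int l)) (\<lambda>A :: complex ^ ('g + 'g) ^ ('g::finite + 'g). trace (mpow A l)) (\<lambda>X A. trace (dpow X A l))"
  unfolding realizes_def
proof (intro conjI allI ballI impI)
  show "continuous_on UNIV (\<lambda>A :: complex ^ ('g + 'g) ^ ('g::finite + 'g). trace (mpow A l))"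
    unfolding trace_def by (intro continuous_on_sum continuous_mpow)
  show "continuous_on UNIV (\<lambda>A :: complex ^ ('g + 'g) ^ ('g::finite + 'g). trace (dpow X A l))" for X
    unfolding trace_def by (intro continuous_on_sum continuous_dpow)
  show "curve X B \<Longrightarrow> jet B (\<lambda>A. trace (mpow A l)) (\<lambda>A. trace (dpow X A l))"
    for X :: "complex ^ ('g + 'g) ^ ('g::finite + 'g)" and B
    using jet_trace_mpow[of X B "mat 1" l] by simp
qed (simp_all add: trace_mpow_theta dpow_add trace_add dpow_cscale trace_cscale casimir_first_order)

lemma realizes_add:
  fixes F :: "complex ^ ('g + 'g) ^ ('g::finite + 'g) \<Rightarrow> complex"
  assumes "realizes f F D" "realizes f' F' D'" "f \<in> trig CARD('g)" "f' \<in> trig CARD('g)"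
  shows "realizes (\<lambda>\<theta>. f \<theta> + f' \<theta>) (\<lambda>A. F A + F' A) (\<lambda>X A. D X A + D' X A)"
  using assms(1,2) unfolding realizes_def
  by (auto intro!: continuous_on_add jet_add simp: distrib_left sum.distrib pd_add[OF assms(3,4)])

lemma realizes_mult:
  fixes F :: "complex ^ ('g + 'g) ^ ('g::finite + 'g) \<Rightarrow> complex"
  assumes r: "realizes f F D" "realizes f' F' D'" and t: "f \<in> trig CARD('g)" "f' \<in> trig CARD('g)"
  shows "realizes (\<lambda>\<theta>. f \<theta> * f' \<theta>) (\<lambda>A. F A * F' A) (\<lambda>X A. D X A * F' A + F A * D' X A)"
  unfolding realizes_def
proof (intro conjI allI ballI impI)
  show "continuous_on UNIV (\<lambda>A. F A * F' A)" "continuous_on UNIV (\<lambda>A. D X A * F' A + F A * D' X A)" for X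
    using r by (auto simp: realizes_def intro!: continuous_intros)
  show "A \<in> USp \<Longrightarrow> F A * F' A = of_real (f (theta A) * f' (theta A))" for A
    using r by (auto simp: realizes_def)
  show "jet B (\<lambda>A. F A * F' A) (\<lambda>A. D X A * F' A + F A * D' X A)" if "curve X B" for X B
    using r that by (intro jet_mult) (auto simp: realizes_def curve_def)
  show "D (X + X') A * F' A + F A * D' (X + X') A = (D X A * F' A + F A * D' X A) + (D X' A * F' A + F A * D' X' A)" for X X' A
    using r by (auto simp: realizes_def algebra_simps)
  show "D (cscale c X) A * F' A + F A * D' (cscale c X) A = c * (D X A * F' A + F A * D' X A)" for c X A
    using r by (auto simp: realizes_def algebra_simps)
  fix k and A :: "complex ^ ('g + 'g) ^ ('g + 'g)" assume A: "A \<in> USp"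
  have "(\<Sum>a\<in>UNIV. \<Sum>b\<in>UNIV. trace (lieY a b ** mpow A k) * (D (lieX a b) A * F' A + F A * D' (lieX a b) A)) =
    (\<Sum>a\<in>UNIV. \<Sum>b\<in>UNIV. trace (lieY a b ** mpow A k) * D (lieX a b) A) * F' A +
    F A * (\<Sum>a\<in>UNIV. \<Sum>b\<in>UNIV. trace (lieY a b ** mpow A k) * D' (lieX a b) A)"
    by (simp add: sum_distrib_left sum_distrib_right sum.distrib distrib_left mult_ac)
  also have "\<dots> = 2 * of_real ((\<Sum>j<CARD('g). vf k j (theta A) * pd j f (theta A)) * f' (theta A) +
      f (theta A) * (\<Sum>j<CARD('g). vf k j (theta A) * pd j f' (theta A)))"
    using r A by (simp add: realizes_def algebra_simps)
  also have "(\<Sum>j<CARD('g). vf k j (theta A) * pd j f (theta A)) * f' (theta A) +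
      f (theta A) * (\<Sum>j<CARD('g). vf k j (theta A) * pd j f' (theta A)) =
      (\<Sum>j<CARD('g). vf k j (theta A) * pd j (\<lambda>\<theta>. f \<theta> * f' \<theta>) (theta A))"
    by (simp add: pd_mult[OF t] sum_distrib_left sum_distrib_right sum.distrib distrib_left mult_ac)
  finally show "(\<Sum>a\<in>UNIV. \<Sum>b\<in>UNIV. trace (lieY a b ** mpow A k) * (D (lieX a b) A * F' A + F A * D' (lieX a b) A)) =
    2 * of_real (\<Sum>j<CARD('g). vf k j (theta A) * pd j (\<lambda>\<theta>. f \<theta> * f' \<theta>) (theta A))" .
qed

lemma symf_realized:
  "symf CARD('g) n f \<Longrightarrow> \<exists>F D. realizes f (F :: complex ^ ('g + 'g) ^ ('g::finite + 'g) \<Rightarrow> complex) D"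
proof (induction rule: symf.induct)
  case (symf_const n c) show ?case by (rule exI, rule exI, rule realizes_const)
next
  case (symf_psum l n) show ?case by (rule exI, rule exI, rule realizes_psum)
next
  case (symf_add n f h)
  from symf_add.IH obtain F D F' D' where FD: "realizes f (F :: complex ^ ('g + 'g) ^ ('g + 'g) \<Rightarrow> complex) D"
    "realizes h (F' :: complex ^ ('g + 'g) ^ ('g + 'g) \<Rightarrow> complex) D'" by (elim exE) (rule that)
  show ?case
    by (rule exI, rule exI, rule realizes_add[OF FD symf_trig[OF symf_add.hyps(1)] symf_trig[OF symf_add.hyps(2)]])
next
  case (symf_mult n f m h)
  from symf_mult.IH obtain F D F' D' where FD: "realizes f (F :: complex ^ ('g + 'g) ^ ('g + 'g) \<Rightarrow> complex) D"
    "realizes h (F' :: complex ^ ('g + 'g) ^ ('g + 'g) \<Rightarrow> complex) D'" by (elim exE) (rule that)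
  show ?case
    by (rule exI, rule exI, rule realizes_mult[OF FD symf_trig[OF symf_mult.hyps(1)] symf_trig[OF symf_mult.hyps(2)]])
qed

section \<open>Loop equations for Haar measure\<close>

locale haar =
  fixes M :: "(complex ^ ('g + 'g) ^ ('g::finite + 'g)) measure"
  assumes haar: "is_haar_USp M"
begin

sublocale prob_space M using haar by (simp add: is_haar_USp_def)

lemma sets_haar: "sets M = sets (restrict_space borel USp)"
  using haar by (simp add: is_haar_USp_def)

lemma space_haar: "space M = USp"
  using sets_eq_imp_space_eq[OF sets_haar] by (simp add: space_restrict_space)

lemma measurable_haar: "F \<in> borel_measurable borel \<Longrightarrow> F \<in> borel_measurable M"
  using measurable_restrict_space1[of F borel borel USp] measurable_cong_sets[OF sets_haar refl] by blast

lemma continuous_left_mult: "continuous_on UNIV (\<lambda>A. (B :: complex ^ ('g + 'g) ^ ('g + 'g)) ** (A :: complex ^ ('g + 'g) ^ ('g + 'g)))"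
  unfolding matrix_matrix_mult_def by (intro continuous_intros)

lemma measurable_left_mult: "B \<in> USp \<Longrightarrow> (\<lambda>A. B ** A) \<in> M \<rightarrow>\<^sub>M M"
proof -
  assume B: "B \<in> USp"
  have "(\<lambda>A :: complex ^ ('g + 'g) ^ ('g + 'g). B ** A) \<in> borel_measurable borel" using continuous_left_mult[of B] by (rule borel_measurable_continuous_onI)
  then have "(\<lambda>A. B ** A) \<in> restrict_space borel USp \<rightarrow>\<^sub>M restrict_space borel USp"
    by (rule measurable_restrict_space3) (auto intro: USp_mult[OF B])
  then show ?thesis by (simp cong: measurable_cong_sets add: measurable_cong_sets[OF sets_haar sets_haar])
qed

lemma distr_left_mult: assumes B: "B \<in> USp" shows "distr M M (\<lambda>A. B ** A) = M"
proof (rule measure_eqI)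
  fix S assume "S \<in> sets (distr M M (\<lambda>A. B ** A))"
  then have S: "S \<in> sets M" by simp
  have SU: "S \<subseteq> USp" using sets.sets_into_space[OF S] by (simp add: space_haar)
  let ?C = "conj_transpose B"
  have "(\<lambda>A. B ** A) -` S \<inter> space M = (\<lambda>A. ?C ** A) ` S"
  proof (intro equalityI subsetI)
    fix A assume "A \<in> (\<lambda>A. B ** A) -` S \<inter> space M"
    moreover have "A = ?C ** (B ** A)" by (simp add: matrix_mul_assoc USp_left_inverse[OF B])
    ultimately show "A \<in> (\<lambda>A. ?C ** A) ` S" by blast
  next
    fix A assume "A \<in> (\<lambda>A. ?C ** A) ` S"
    then obtain A' where A': "A' \<in> S" "A = ?C ** A'" by blast
    have "B ** A = A'" by (simp add: A' matrix_mul_assoc USp_right_inverse[OF B])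
    then show "A \<in> (\<lambda>A. B ** A) -` S \<inter> space M"
      using A' SU USp_mult[OF USp_conj_transpose[OF B]] by (auto simp: space_haar)
  qed
  then have "emeasure (distr M M (\<lambda>A. B ** A)) S = emeasure M ((\<lambda>A. ?C ** A) ` S)"
    by (simp add: emeasure_distr[OF measurable_left_mult[OF B] S])
  also have "\<dots> = emeasure M S" using haar S USp_conj_transpose[OF B] by (simp add: is_haar_USp_def)
  finally show "emeasure (distr M M (\<lambda>A. B ** A)) S = emeasure M S" .
qed simp

lemma integral_left_mult:
  fixes F :: "complex ^ ('g + 'g) ^ ('g + 'g) \<Rightarrow> complex"
  assumes "B \<in> USp" "continuous_on UNIV F"
  shows "(LINT A|M. F (B ** A)) = (LINT A|M. F A)"
proof -
  have F: "F \<in> borel_measurable M" by (rule measurable_haar[OF borel_measurable_continuous_onI[OF assms(2)]])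
  have "(LINT A|M. F A) = (LINT A|distr M M (\<lambda>A. B ** A). F A)" by (simp add: distr_left_mult[OF assms(1)])
  also have "\<dots> = (LINT A|M. F (B ** A))" by (rule integral_distr[OF measurable_left_mult[OF assms(1)] F])
  finally show ?thesis ..
qed

lemma integrable_continuous:
  fixes F :: "complex ^ ('g + 'g) ^ ('g + 'g) \<Rightarrow> complex"
  assumes "continuous_on UNIV F"
  shows "integrable M F"
proof -
  define R where "R = real CARD('g + 'g) * real CARD('g + 'g)"
  have sub: "USp \<subseteq> cball (0 :: complex ^ ('g + 'g) ^ ('g + 'g)) R"
  proof
    fix A :: "complex ^ ('g + 'g) ^ ('g + 'g)" assume A: "A \<in> USp"
    have "norm A \<le> (\<Sum>i\<in>UNIV. norm (A $ i))" unfolding norm_vec_def by (rule L2_set_le_sum) simp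
    also have "\<dots> \<le> (\<Sum>i\<in>UNIV. \<Sum>j\<in>UNIV. norm (A $ i $ j))"
      unfolding norm_vec_def[of "_ $ _"] by (intro sum_mono L2_set_le_sum) simp
    also have "\<dots> \<le> (\<Sum>i\<in>(UNIV::('g + 'g) set). \<Sum>j\<in>(UNIV::('g + 'g) set). 1)"
      by (intro sum_mono USp_entry_bound[OF A])
    finally show "A \<in> cball 0 R" by (simp add: R_def)
  qed
  have "bounded (F ` cball 0 R)"
    by (intro compact_imp_bounded compact_continuous_image continuous_on_subset[OF assms]) auto
  then obtain K where K: "\<forall>x\<in>F ` cball 0 R. norm x \<le> K" unfolding bounded_iff by blast
  have "AE A in M. norm (F A) \<le> K" using sub K by (intro AE_I2) (auto simp: space_haar)
  then show ?thesis
    by (rule integrable_const_bound) (rule measurable_haar[OF borel_measurable_continuous_onI[OF assms]])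
qed

text \<open>
  By invariance, integrating the expansion along the curve leaves \<open>t\<close> times the integral of \<open>D\<close>
  against an error of order \<open>t\<^sup>2\<close>.
\<close>

lemma integral_jet_zero:
  assumes B: "\<And>t. B t \<in> USp" and F: "continuous_on UNIV F" and D: "continuous_on UNIV D" and j: "jet B F D"
  shows "(LINT A|M. D A) = 0"
proof -
  obtain K where K: "\<And>t A. A \<in> USp \<Longrightarrow> \<bar>t\<bar> \<le> 1 \<Longrightarrow> norm (F (B t ** A) - F A - of_real t * D A) \<le> K * t\<^sup>2"
    using j by (auto simp: jet_def)
  have FB: "continuous_on UNIV (\<lambda>A. F (B t ** A))" for t
    by (rule continuous_on_compose2[OF F continuous_left_mult]) simp
  have bd: "norm (LINT A|M. D A) \<le> K * t" if t: "0 < t" "t \<le> 1" for t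
  proof -
    let ?r = "\<lambda>A. F (B t ** A) - F A - of_real t * D A"
    have "(LINT A|M. ?r A) = (LINT A|M. F (B t ** A)) - (LINT A|M. F A) - of_real t * (LINT A|M. D A)"
      using integrable_continuous[OF FB] integrable_continuous[OF F] integrable_continuous[OF D] by simp
    then have "of_real t * (LINT A|M. D A) = - (LINT A|M. ?r A)" by (simp add: integral_left_mult[OF B F])
    then have "norm (of_real t * (LINT A|M. D A)) = norm (LINT A|M. ?r A)" by (simp only: norm_minus_cancel)
    then have "t * norm (LINT A|M. D A) = norm (LINT A|M. ?r A)" using t by (simp add: norm_mult)
    also have "\<dots> \<le> (LINT A|M. norm (?r A))" by (rule integral_norm_bound)
    also have "\<dots> \<le> (LINT A|M. K * t\<^sup>2)"
    proof (rule integral_mono)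
      show "integrable M (\<lambda>A. norm (?r A))"
        by (intro integrable_norm integrable_continuous continuous_intros FB F D)
      show "norm (?r A) \<le> K * t\<^sup>2" if "A \<in> space M" for A using that K t by (auto simp: space_haar)
    qed simp
    also have "\<dots> = K * t\<^sup>2" by (simp add: prob_space)
    finally have "t * norm (LINT A|M. D A) \<le> t * (K * t)" by (simp add: power2_eq_square mult_ac)
    then show ?thesis using t by simp
  qed
  have "norm (LINT A|M. D A) \<le> 0"
  proof (rule field_le_epsilon)
    fix e :: real assume e: "e > 0"
    \<comment> \<open>the expansion is available for \<open>t \<le> 1\<close> only\<close>
    define t where "t = min 1 (e / (\<bar>K\<bar> + 1))"
    have t: "0 < t" "t \<le> 1" using e by (auto simp: t_def)
    have "K * t \<le> (\<bar>K\<bar> + 1) * t" using t by (intro mult_right_mono) auto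
    also have "\<dots> \<le> (\<bar>K\<bar> + 1) * (e / (\<bar>K\<bar> + 1))" by (intro mult_left_mono) (auto simp: t_def)
    also have "\<dots> = e" by (simp add: add_nonneg_eq_0_iff)
    finally show "norm (LINT A|M. D A) \<le> 0 + e" using bd[OF t] by simp
  qed
  then show ?thesis by simp
qed

text \<open>
  For skew-Hermitian \<open>X\<close> this is \<open>integral_jet_zero\<close>.  Both sides are linear in \<open>X\<close>, and every element
  of the complex Lie algebra is a complex combination of the skew-Hermitian elements
  \<open>X - X*\<close> and \<open>\<i> (X + X*)\<close>.
\<close>

lemma haar_integration_by_parts:
  fixes F :: "complex ^ ('g + 'g) ^ ('g + 'g) \<Rightarrow> complex"
  assumes r: "realizes f F D" and X: "lie_sp X"
  shows "(LINT A|M. trace (Y ** dpow X A k) * F A + trace (Y ** mpow A k) * D X A) = 0"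
proof -
  let ?D = "\<lambda>X A. trace (Y ** dpow X A k) * F A + trace (Y ** mpow A k) * D X A"
  have cont: "continuous_on UNIV F" "\<And>X. continuous_on UNIV (D X)" using r by (auto simp: realizes_def)
  note cm = continuous_trace_mult
  have contD: "continuous_on UNIV (?D X)" for X by (intro continuous_on_add continuous_on_mult cont cm)
  have skew: "(LINT A|M. ?D X A) = 0" if X: "conj_transpose X = - X" "lie_sp X" for X
  proof -
    obtain B where B: "curve X B" using ex_curve[OF X] by blast
    show ?thesis
    proof (rule integral_jet_zero)
      show "B t \<in> USp" for t using B by (simp add: curve_def)
      show "continuous_on UNIV (\<lambda>A. trace (Y ** mpow A k) * F A)" by (intro continuous_on_add continuous_on_mult cont cm)
      show "continuous_on UNIV (?D X)" by (rule contD)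
      show "jet B (\<lambda>A. trace (Y ** mpow A k) * F A) (?D X)"
        using B r by (intro jet_mult jet_trace_mpow[OF B]) (auto simp: realizes_def curve_def)
    qed
  qed
  have add: "?D (X + X') A = ?D X A + ?D X' A" for X X' A
    using r by (simp add: realizes_def dpow_add matrix_add_distrib_left trace_add algebra_simps)
  have scale: "?D (cscale c X) A = c * ?D X A" for c X A
    using r by (simp add: realizes_def dpow_cscale cscale_mult_right trace_cscale algebra_simps)
  let ?P = "X - conj_transpose X" and ?Q = "cscale \<i> (X + conj_transpose X)"
  have sp': "lie_sp (conj_transpose X)"
  proof -
    let ?J = "symp_form :: complex ^ ('g + 'g) ^ ('g + 'g)"
    have "?J ** (transpose X ** ?J) ** ?J = - (?J ** (?J ** X) ** ?J)"
      using X by (simp add: lie_sp_def matrix_distribs)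
    moreover have "?J ** (transpose X ** ?J) ** ?J = ?J ** transpose X ** (?J ** ?J)"
      by (simp add: matrix_mul_assoc)
    moreover have "?J ** (?J ** X) ** ?J = (?J ** ?J) ** X ** ?J" by (simp add: matrix_mul_assoc)
    ultimately have "- (?J ** transpose X) = X ** ?J"
      unfolding symp_form_square by (simp add: matrix_distribs)
    then have "?J ** transpose X = - (X ** ?J)" by (metis minus_minus)
    then have "conj_transpose (?J ** transpose X) = conj_transpose (- (X ** ?J))" by simp
    moreover have "conj_transpose ?J = - ?J"
      by (auto simp: vec_eq_iff conj_transpose_def symp_form_def split: sum.splits)
    moreover have "conj_transpose (transpose X) = transpose (conj_transpose X)"
      by (simp add: vec_eq_iff conj_transpose_def Finite_Cartesian_Product.transpose_def)
    ultimately have "- (transpose (conj_transpose X) ** ?J) = ?J ** conj_transpose X"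
      by (simp add: conj_transpose_mult conj_transpose_minus matrix_distribs)
    then show ?thesis unfolding lie_sp_def by (metis minus_minus)
  qed
  have P: "(LINT A|M. ?D ?P A) = 0"
  proof (rule skew)
    show "conj_transpose ?P = - ?P" by (simp add: conj_transpose_diff)
    show "lie_sp ?P" using X sp' by (simp add: lie_sp_def transpose_diff' matrix_distribs)
  qed
  have Q: "(LINT A|M. ?D ?Q A) = 0"
  proof (rule skew)
    show "conj_transpose ?Q = - ?Q"
      by (simp add: vec_eq_iff conj_transpose_def cscale_def algebra_simps)
    have t: "transpose (cscale c Z) = cscale c (transpose Z)" for c and Z :: "complex ^ ('g + 'g) ^ ('g + 'g)"
      by (simp add: vec_eq_iff cscale_def Finite_Cartesian_Product.transpose_def)
    have n: "cscale c (- Z) = - cscale c Z" for c and Z :: "complex ^ ('g + 'g) ^ ('g + 'g)"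
      by (simp add: vec_eq_iff cscale_def)
    have "lie_sp (X + conj_transpose X)"
      using X sp' by (simp add: lie_sp_def transpose_add' matrix_distribs)
    then show "lie_sp ?Q"
      unfolding lie_sp_def by (simp only: t cscale_mult_left cscale_mult_right n)
  qed
  have "X = cscale (1/2) ?P + cscale (- \<i> / 2) ?Q"
    by (simp add: vec_eq_iff cscale_def conj_transpose_def field_simps)
  then have "?D X A = 1/2 * ?D ?P A + (- \<i> / 2) * ?D ?Q A" for A
    using add[of "cscale (1/2) ?P" "cscale (- \<i> / 2) ?Q" A] scale by simp
  then have "(LINT A|M. ?D X A) = (LINT A|M. 1/2 * ?D ?P A + (- \<i> / 2) * ?D ?Q A)" by simp
  also have "\<dots> = 1/2 * (LINT A|M. ?D ?P A) + (- \<i> / 2) * (LINT A|M. ?D ?Q A)"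
    using integrable_continuous[OF contD[of ?P]] integrable_continuous[OF contD[of ?Q]]
    by (subst Bochner_Integration.integral_add) (auto intro: integrable_mult_right)
  finally show ?thesis using P Q by simp
qed

lemma lie_sp_lieX: "lie_sp (lieX a b)"
proof -
  have "transpose (sym_unit a b) = sym_unit a b"
    by (simp add: vec_eq_iff Finite_Cartesian_Product.transpose_def sym_unit_def mult.commute add.commute)
  then show ?thesis
    by (simp add: lie_sp_def lieX_def matrix_transpose_mul symp_form_transpose matrix_distribs matrix_mul_assoc)
qed

text \<open>
  Integration by parts for the function \<open>trace (Y ** mpow A k) * F A\<close> in the direction \<open>X\<close>, summed over
  the Casimir tensor.
\<close>

lemma haar_loop:
  assumes f: "symf CARD('g) n f"
  shows "(LINT A|M. loop CARD('g) k (theta A) * f (theta A) + (\<Sum>j<CARD('g). vf k j (theta A) * pd j f (theta A))) = 0"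
proof -
  from symf_realized[OF f] obtain F D where r: "realizes f (F :: complex ^ ('g + 'g) ^ ('g + 'g) \<Rightarrow> complex) D"
    by (elim exE) (rule that)
  let ?h = "\<lambda>A. loop CARD('g) k (theta A) * f (theta A) + (\<Sum>j<CARD('g). vf k j (theta A) * pd j f (theta A))"
  let ?D = "\<lambda>a b A. trace (lieY a b ** dpow (lieX a b) A k) * F A + trace (lieY a b ** mpow A k) * D (lieX a b) A"
  have eq: "(\<Sum>a\<in>UNIV. \<Sum>b\<in>UNIV. ?D a b A) = 2 * of_real (?h A)" if A: "A \<in> USp" for A
  proof -
    have "(\<Sum>a\<in>UNIV. \<Sum>b\<in>UNIV. ?D a b A) = (\<Sum>a\<in>UNIV. \<Sum>b\<in>UNIV. trace (lieY a b ** dpow (lieX a b) A k)) * F A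
       + (\<Sum>a\<in>UNIV. \<Sum>b\<in>UNIV. trace (lieY a b ** mpow A k) * D (lieX a b) A)"
      by (simp add: sum.distrib sum_distrib_right)
    then show ?thesis using r A by (simp add: casimir_second_order[OF A] realizes_def algebra_simps)
  qed
  have cont: "continuous_on UNIV F" "\<And>X. continuous_on UNIV (D X)" using r by (auto simp: realizes_def)
  note cm = continuous_trace_mult
  have int: "integrable M (?D a b)" for a b by (intro integrable_continuous continuous_on_add continuous_on_mult cont cm)
  have "(LINT A|M. 2 * complex_of_real (?h A)) = (LINT A|M. (\<Sum>a\<in>UNIV. \<Sum>b\<in>UNIV. ?D a b A))"
    by (intro Bochner_Integration.integral_cong refl) (simp only: eq space_haar)
  also have "\<dots> = (\<Sum>a\<in>UNIV. \<Sum>b\<in>UNIV. LINT A|M. ?D a b A)"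
    by (rule trans[OF Bochner_Integration.integral_sum sum.cong[OF refl Bochner_Integration.integral_sum]])
       (intro Bochner_Integration.integrable_sum int, rule int)
  also have "\<dots> = 0" by (intro sum.neutral ballI haar_integration_by_parts[OF r lie_sp_lieX])
  finally have 0: "(LINT A|M. 2 * complex_of_real (?h A)) = 0" .
  have "(LINT A|M. 2 * complex_of_real (?h A)) = 2 * complex_of_real (LINT A|M. ?h A)"
    by (simp only: integral_mult_right_zero integral_complex_of_real)
  with 0 have "2 * complex_of_real (LINT A|M. ?h A) = 0" by (simp only:)
  then show ?thesis by (simp only: mult_eq_0_iff of_real_eq_0_iff) simp
qed

lemma integrable_symf:
  assumes "symf CARD('g) n f" shows "integrable M (\<lambda>A. f (theta A))"
proof -
  from symf_realized[OF assms] obtain F D where r: "realizes f (F :: complex ^ ('g + 'g) ^ ('g + 'g) \<Rightarrow> complex) D"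
    by (elim exE) (rule that)
  have "integrable M (\<lambda>A. Re (F A))" using r by (intro integrable_Re integrable_continuous) (simp add: realizes_def)
  moreover have "integrable M (\<lambda>A. Re (F A)) \<longleftrightarrow> integrable M (\<lambda>A. f (theta A))"
    using r by (intro Bochner_Integration.integrable_cong refl) (simp add: realizes_def space_haar)
  ultimately show ?thesis by simp
qed

sublocale loop_functional "CARD('g)" "\<lambda>f. LINT A|M. f (theta A)"
proof
  show "(LINT A|M. f (theta A) + h (theta A)) = (LINT A|M. f (theta A)) + (LINT A|M. h (theta A))"
    if "symf CARD('g) n f" "symf CARD('g) n h" for n f h
    using integrable_symf[OF that(1)] integrable_symf[OF that(2)] by simp
  show "(LINT A|M. c * f (theta A)) = c * (LINT A|M. f (theta A))" for f :: "(nat \<Rightarrow> real) \<Rightarrow> real" and c by simp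
  show "(LINT A|M. 1) = (1 :: real)" by (simp add: prob_space)
  show "(LINT A|M. loop CARD('g) k (theta A) * f (theta A) + (\<Sum>j<CARD('g). vf k j (theta A) * pd j f (theta A))) = 0"
    if "symf CARD('g) n f" for k n f by (rule haar_loop[OF that])
qed

text \<open>
  Weyl's integration formula for the moments of a power sum.
\<close>

theorem weyl_integration_power_sum:
  "(LINT A|M. power_sum k A ^ n) = of_real (wint CARD('g) (\<lambda>\<theta>. psum CARD('g) (int k) \<theta> ^ n) / wint CARD('g) (\<lambda>_. 1))"
proof -
  have "(LINT A|M. power_sum k A ^ n) = (LINT A|M. complex_of_real (psum CARD('g) (int k) (theta A) ^ n))"
    by (intro Bochner_Integration.integral_cong refl) (simp add: trace_mpow[symmetric] trace_mpow_theta space_haar)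
  also have "\<dots> = of_real (LINT A|M. psum CARD('g) (int k) (theta A) ^ n)" by (rule integral_complex_of_real)
  also have "(LINT A|M. psum CARD('g) (int k) (theta A) ^ n) =
     wint CARD('g) (\<lambda>\<theta>. psum CARD('g) (int k) \<theta> ^ n) / wint CARD('g) (\<lambda>_. 1)"
    using E_eq_wint[OF symf_power[OF symf_psum[OF order_refl]], of k n] wint_1_pos[of "CARD('g)"]
    by (simp add: field_simps)
  finally show ?thesis .
qed

end

section \<open>Vandermonde determinants\<close>

text \<open>
  The matrix of values is the Vandermonde matrix times the unitriangular matrix of coefficients.
\<close>

lemma det_monic_polys:
  fixes x :: "nat \<Rightarrow> 'a::comm_ring_1"
  assumes "\<And>j. j < n \<Longrightarrow> degree (q j) = j" "\<And>j. j < n \<Longrightarrow> coeff (q j) j = 1"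
  shows "Determinant.det (Matrix.mat n n (\<lambda>(i, j). poly (q j) (x i))) = Determinant.det (Matrix.mat n n (\<lambda>(i, j). x i ^ j))"
proof -
  let ?V = "Matrix.mat n n (\<lambda>(i, j). x i ^ j)" and ?U = "Matrix.mat n n (\<lambda>(l, j). coeff (q j) l)"
  have "Matrix.mat n n (\<lambda>(i, j). poly (q j) (x i)) = ?V * ?U"
  proof (rule eq_matI)
    fix i j assume "i < dim_row (?V * ?U)" "j < dim_col (?V * ?U)"
    then have ij: "i < n" "j < n" by auto
    have "poly (q j) (x i) = (\<Sum>l\<le>j. coeff (q j) l * x i ^ l)"
      using assms(1)[OF ij(2)] by (simp add: poly_altdef)
    also have "\<dots> = (\<Sum>l<n. coeff (q j) l * x i ^ l)"
      using ij assms(1)[OF ij(2)] by (intro sum.mono_neutral_left) (auto simp: coeff_eq_0)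
    finally show "Matrix.mat n n (\<lambda>(i, j). poly (q j) (x i)) $$ (i, j) = (?V * ?U) $$ (i, j)"
      using ij by (simp add: scalar_prod_def atLeast0LessThan mult.commute)
  qed auto
  then have "Determinant.det (Matrix.mat n n (\<lambda>(i, j). poly (q j) (x i))) = Determinant.det ?V * Determinant.det ?U"
    by (simp add: Determinant.det_mult[of _ n])
  also have "Determinant.det ?U = prod_list (diag_mat ?U)"
    by (rule det_upper_triangular[of _ n]) (auto simp: assms coeff_eq_0)
  also have "\<dots> = 1"
    unfolding prod_list_diag_prod by (intro prod.neutral) (auto simp: assms)
  finally show ?thesis by simp
qed

text \<open>
  With the Newton polynomials for the nodes \<open>x\<close> the matrix of values becomes triangular.
\<close>

lemma vandermonde_det:
  fixes x :: "nat \<Rightarrow> 'a::idom"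
  shows "Determinant.det (Matrix.mat n n (\<lambda>(i, j). x i ^ j)) = (\<Prod>a<n. \<Prod>b<a. x a - x b)"
proof -
  define q where "q j = (\<Prod>l<j. [:- x l, 1:])" for j
  have deg: "degree (q j) = j" for j unfolding q_def by (subst degree_prod_sum_eq) auto
  have lc: "coeff (q j) j = 1" for j
  proof -
    have "lead_coeff (q j) = 1" unfolding q_def lead_coeff_prod by simp
    then show ?thesis by (simp add: deg)
  qed
  have pq: "poly (q j) t = (\<Prod>l<j. t - x l)" for j t by (simp add: q_def poly_prod)
  let ?N = "Matrix.mat n n (\<lambda>(i, j). poly (q j) (x i))"
  have "Determinant.det (Matrix.mat n n (\<lambda>(i, j). x i ^ j)) = Determinant.det ?N"
    by (rule det_monic_polys[symmetric]) (simp_all add: deg lc)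
  also have "\<dots> = prod_list (diag_mat ?N)"
    by (rule det_lower_triangular[of n]) (auto simp: pq intro!: prod_zero)
  also have "\<dots> = (\<Prod>a<n. \<Prod>b<a. x a - x b)"
    unfolding prod_list_diag_prod by (simp add: pq atLeast0LessThan)
  finally show ?thesis .
qed

text \<open>
  Chebyshev polynomials of the second kind, rescaled to be monic in \<open>2 cos t\<close>.
\<close>

fun cheb :: "nat \<Rightarrow> real poly" where
  "cheb 0 = 1"
| "cheb (Suc 0) = [:0, 1:]"
| "cheb (Suc (Suc n)) = [:0, 1:] * cheb (Suc n) - cheb n"

lemma cheb_monic: "degree (cheb n) = n \<and> coeff (cheb n) n = 1"
proof (induction n rule: cheb.induct)
  case (3 n)
  have c: "coeff (cheb (Suc (Suc n))) (Suc (Suc n)) = 1"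
    using 3 by (simp add: coeff_eq_0)
  have "degree (cheb (Suc (Suc n))) \<le> Suc (Suc n)"
  proof (rule degree_le, intro allI impI)
    fix i assume i: "Suc (Suc n) < i"
    then obtain l where "i = Suc l" by (cases i) auto
    with i 3 show "coeff (cheb (Suc (Suc n))) i = 0" by (simp add: coeff_eq_0)
  qed
  with c show ?case by (metis le_antisym le_degree zero_neq_one)
qed (auto simp: degree_pCons_eq_if)

lemma sin_cheb: "2 * sin (real (Suc n) * t) = 2 * sin t * poly (cheb n) (2 * cos t)"
proof (induction n rule: cheb.induct)
  case 2 then show ?case using sin_double[of t] by simp
next
  case (3 n)
  have "sin (real (Suc (Suc (Suc n))) * t) = sin (real (Suc (Suc n)) * t + t)" by (simp add: algebra_simps)
  moreover have "sin (real (Suc n) * t) = sin (real (Suc (Suc n)) * t - t)" by (simp add: algebra_simps)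
  ultimately have "2 * sin (real (Suc (Suc (Suc n))) * t) =
      2 * cos t * (2 * sin (real (Suc (Suc n)) * t)) - 2 * sin (real (Suc n) * t)"
    by (simp add: sin_add sin_diff)
  then show ?case unfolding 3 by (simp add: algebra_simps)
qed auto

text \<open>
  The Weyl denominator has two expansions into products of functions of single angles.  \<open>vdet\<close>
  leads to the entries of the determinant in the theorem, while \<open>sdet\<close> consists of orthogonal functions
  and therefore yields the normalizing constant.
\<close>

definition vdet :: "nat \<Rightarrow> (nat \<Rightarrow> real) \<Rightarrow> real" where
  "vdet g \<theta> = (\<Sum>\<sigma> | \<sigma> permutes {0..<g}. signof \<sigma> * (\<Prod>j<g. (2 * cos (\<theta> j)) ^ \<sigma> j))"

lemma weyl_vdet: "weyl g \<theta> = (\<Prod>j<g. (2 * sin (\<theta> j))\<^sup>2) * (vdet g \<theta>)\<^sup>2"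
proof -
  have "vdet g \<theta> = Determinant.det (Matrix.mat g g (\<lambda>(i, j). (2 * cos (\<theta> i)) ^ j))"
    unfolding vdet_def
    by (subst det_def'[of _ g]) (auto simp: atLeast0LessThan permutes_in_image intro!: sum.cong prod.cong)
  then have "vdet g \<theta> = (\<Prod>a<g. \<Prod>b<a. 2 * cos (\<theta> a) - 2 * cos (\<theta> b))" by (simp only: vandermonde_det)
  then show ?thesis by (simp add: weyl_def prod_power_distrib)
qed

definition sdet :: "nat \<Rightarrow> (nat \<Rightarrow> real) \<Rightarrow> real" where
  "sdet g \<theta> = (\<Sum>\<sigma> | \<sigma> permutes {0..<g}. signof \<sigma> * (\<Prod>j<g. 2 * sin (real (Suc (\<sigma> j)) * \<theta> j)))"

lemma weyl_sdet: "weyl g \<theta> = (sdet g \<theta>)\<^sup>2"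
proof -
  have "sdet g \<theta> = (\<Prod>j<g. 2 * sin (\<theta> j)) * (\<Sum>\<sigma> | \<sigma> permutes {0..<g}. signof \<sigma> * (\<Prod>j<g. poly (cheb (\<sigma> j)) (2 * cos (\<theta> j))))"
    unfolding sdet_def sin_cheb prod.distrib by (simp add: sum_distrib_left mult_ac prod.distrib)
  also have "(\<Sum>\<sigma> | \<sigma> permutes {0..<g}. signof \<sigma> * (\<Prod>j<g. poly (cheb (\<sigma> j)) (2 * cos (\<theta> j)))) =
     Determinant.det (Matrix.mat g g (\<lambda>(i, j). poly (cheb j) (2 * cos (\<theta> i))))"
    by (subst det_def'[of _ g]) (auto simp: atLeast0LessThan permutes_in_image intro!: sum.cong prod.cong)
  also have "\<dots> = Determinant.det (Matrix.mat g g (\<lambda>(i, j). (2 * cos (\<theta> i)) ^ j))"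
    by (rule det_monic_polys) (simp_all add: cheb_monic)
  also have "\<dots> = vdet g \<theta>"
    unfolding vdet_def
    by (subst det_def'[of _ g]) (auto simp: atLeast0LessThan permutes_in_image intro!: sum.cong prod.cong)
  finally have eq: "sdet g \<theta> = (\<Prod>j<g. 2 * sin (\<theta> j)) * vdet g \<theta>" .
  show ?thesis unfolding weyl_vdet eq power_mult_distrib prod_power_distrib ..
qed

section \<open>Andreief's identity\<close>

text \<open>
  Coefficientwise integration, so that exponential generating functions can be integrated as formal
  power series.
\<close>

definition circle_fps :: "(real \<Rightarrow> complex fps) \<Rightarrow> complex fps" where
  "circle_fps F = Abs_fps (\<lambda>n. LINT t|circle. fps_nth (F t) n)"

text \<open>
  Substituting \<open>\<rho> = \<tau> \<circ> \<sigma>\<close> makes the inner sum independent of \<open>\<sigma>\<close>.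
\<close>

lemma double_det_sum:
  fixes c :: "nat \<Rightarrow> nat \<Rightarrow> 'a::comm_ring_1"
  shows "(\<Sum>\<sigma> | \<sigma> permutes {0..<g}. \<Sum>\<rho> | \<rho> permutes {0..<g}. signof \<sigma> * signof \<rho> * (\<Prod>j<g. c (\<sigma> j) (\<rho> j))) =
     of_nat (fact g) * Determinant.det (Matrix.mat g g (\<lambda>(a, b). c a b))"
proof -
  let ?P = "{\<sigma>. \<sigma> permutes {0..<g}}"
  have fixed: "(\<Sum>\<rho>\<in>?P. signof \<sigma> * signof \<rho> * (\<Prod>j<g. c (\<sigma> j) (\<rho> j))) =
     Determinant.det (Matrix.mat g g (\<lambda>(a, b). c a b))" if s: "\<sigma> \<in> ?P" for \<sigma>
  proof -
    have sp: "\<sigma> permutes {0..<g}" using s by simp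
    have "(\<Sum>\<rho>\<in>?P. signof \<sigma> * signof \<rho> * (\<Prod>j<g. c (\<sigma> j) (\<rho> j))) =
      (\<Sum>\<tau>\<in>?P. signof \<sigma> * signof (\<tau> \<circ> \<sigma>) * (\<Prod>j<g. c (\<sigma> j) ((\<tau> \<circ> \<sigma>) j)))"
      using sum_permutations_compose_right[OF sp, of "\<lambda>\<rho>. signof \<sigma> * signof \<rho> * (\<Prod>j<g. c (\<sigma> j) (\<rho> j))"] .
    also have "\<dots> = (\<Sum>\<tau>\<in>?P. signof \<tau> * (\<Prod>i = 0..<g. c i (\<tau> i)))"
    proof (rule sum.cong[OF refl])
      fix \<tau> assume t: "\<tau> \<in> ?P"
      have "sign (\<tau> \<circ> \<sigma>) = sign \<tau> * sign \<sigma>"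
        using t sp by (intro sign_compose) (auto simp: permutation_permutes)
      then have "(signof \<sigma> * signof (\<tau> \<circ> \<sigma>) :: 'a) = signof \<tau>"
        by (simp add: sign_def)
      moreover have "(\<Prod>j<g. c (\<sigma> j) ((\<tau> \<circ> \<sigma>) j)) = (\<Prod>i = 0..<g. c i (\<tau> i))"
        using prod.permute[OF sp, of "\<lambda>i. c i (\<tau> i)"] by (simp add: atLeast0LessThan o_def)
      ultimately show "signof \<sigma> * signof (\<tau> \<circ> \<sigma>) * (\<Prod>j<g. c (\<sigma> j) ((\<tau> \<circ> \<sigma>) j)) = signof \<tau> * (\<Prod>i = 0..<g. c i (\<tau> i))"
        by simp
    qed
    also have "\<dots> = Determinant.det (Matrix.mat g g (\<lambda>(a, b). c a b))"
      by (subst det_def'[of _ g]) (auto simp: permutes_in_image intro!: sum.cong prod.cong)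
    finally show ?thesis .
  qed
  have "(\<Sum>\<sigma>\<in>?P. \<Sum>\<rho>\<in>?P. signof \<sigma> * signof \<rho> * (\<Prod>j<g. c (\<sigma> j) (\<rho> j))) =
     (\<Sum>\<sigma>\<in>?P. Determinant.det (Matrix.mat g g (\<lambda>(a, b). c a b)))" by (rule sum.cong[OF refl fixed])
  also have "card ?P = fact g" by (rule card_permutations) auto
  then have "(\<Sum>\<sigma>\<in>?P. Determinant.det (Matrix.mat g g (\<lambda>(a, b). c a b))) = of_nat (fact g) * Determinant.det (Matrix.mat g g (\<lambda>(a, b). c a b))"
    by simp
  finally show ?thesis .
qed

text \<open>
  Each coefficient of the product is a finite sum of products of functions of single angles.
\<close>

lemma integral_torus_prod_fps:
  assumes int: "\<And>j n. j < g \<Longrightarrow> integrable circle (\<lambda>t. fps_nth (F j t) n)"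
  shows "integrable (torus g) (\<lambda>\<theta>. fps_nth (\<Prod>j<g. F j (\<theta> j)) n)"
    and "(LINT \<theta>|torus g. fps_nth (\<Prod>j<g. F j (\<theta> j)) n) = fps_nth (\<Prod>j<g. circle_fps (F j)) n"
proof -
  let ?X = "multisets_of_size {..<g} n"
  have e: "fps_nth (\<Prod>j<g. F j (\<theta> j)) n = (\<Sum>X\<in>?X. \<Prod>j<g. fps_nth (F j (\<theta> j)) (count X j))" for \<theta>
    by (rule fps_prod_nth') simp
  have i: "integrable (torus g) (\<lambda>\<theta>. \<Prod>j<g. fps_nth (F j (\<theta> j)) (count X j))" for X
    unfolding torus_def by (rule tor.product_integrable_prod) (auto intro: int)
  show "integrable (torus g) (\<lambda>\<theta>. fps_nth (\<Prod>j<g. F j (\<theta> j)) n)"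
    unfolding e by (rule Bochner_Integration.integrable_sum) (rule i)
  have "(LINT \<theta>|torus g. fps_nth (\<Prod>j<g. F j (\<theta> j)) n) = (\<Sum>X\<in>?X. (LINT \<theta>|torus g. (\<Prod>j<g. fps_nth (F j (\<theta> j)) (count X j))))"
    unfolding e by (rule Bochner_Integration.integral_sum) (rule i)
  also have "\<dots> = (\<Sum>X\<in>?X. \<Prod>j<g. (LINT t|circle. fps_nth (F j t) (count X j)))"
    unfolding torus_def by (intro sum.cong refl tor.product_integral_prod) (auto intro: int)
  also have "\<dots> = fps_nth (\<Prod>j<g. circle_fps (F j)) n"
    by (subst fps_prod_nth') (auto simp: circle_fps_def)
  finally show "(LINT \<theta>|torus g. fps_nth (\<Prod>j<g. F j (\<theta> j)) n) = fps_nth (\<Prod>j<g. circle_fps (F j)) n" .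
qed

text \<open>
  After expanding both determinants, only the permutation relating them matters, so every term
  occurs \<open>fact g\<close> times (\<open>double_det_sum\<close>); each occurrence factors over the angles.
\<close>

lemma andreief:
  assumes int: "\<And>a b n. integrable circle (\<lambda>t. fps_nth (G a b t) n)"
  shows "(LINT \<theta>|torus g. fps_nth (\<Sum>\<sigma> | \<sigma> permutes {0..<g}. \<Sum>\<rho> | \<rho> permutes {0..<g}.
            signof \<sigma> * signof \<rho> * (\<Prod>j<g. G (\<sigma> j) (\<rho> j) (\<theta> j))) n) =
     fact g * fps_nth (Determinant.det (Matrix.mat g g (\<lambda>(a, b). circle_fps (G a b)))) n"
proof -
  let ?P = "{\<sigma>. \<sigma> permutes {0..<g}}"
  have s: "fps_nth (signof \<sigma> * signof \<rho> * H) n = signof \<sigma> * signof \<rho> * fps_nth H n" for \<sigma> \<rho> and H :: "complex fps"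
    by (simp add: sign_def)
  have ip: "integrable (torus g) (\<lambda>\<theta>. fps_nth (\<Prod>j<g. G (\<sigma> j) (\<rho> j) (\<theta> j)) n)"
    "(LINT \<theta>|torus g. fps_nth (\<Prod>j<g. G (\<sigma> j) (\<rho> j) (\<theta> j)) n) = fps_nth (\<Prod>j<g. circle_fps (G (\<sigma> j) (\<rho> j))) n" for \<sigma> \<rho>
    by (rule integral_torus_prod_fps[where F = "\<lambda>j. G (\<sigma> j) (\<rho> j)"], rule int)+
  have "(LINT \<theta>|torus g. fps_nth (\<Sum>\<sigma>\<in>?P. \<Sum>\<rho>\<in>?P. signof \<sigma> * signof \<rho> * (\<Prod>j<g. G (\<sigma> j) (\<rho> j) (\<theta> j))) n) =
    (LINT \<theta>|torus g. (\<Sum>\<sigma>\<in>?P. \<Sum>\<rho>\<in>?P. signof \<sigma> * signof \<rho> * fps_nth (\<Prod>j<g. G (\<sigma> j) (\<rho> j) (\<theta> j)) n))"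
    by (simp only: fps_sum_nth s)
  also have "\<dots> = (\<Sum>\<sigma>\<in>?P. (LINT \<theta>|torus g. (\<Sum>\<rho>\<in>?P. signof \<sigma> * signof \<rho> * fps_nth (\<Prod>j<g. G (\<sigma> j) (\<rho> j) (\<theta> j)) n)))"
    by (rule Bochner_Integration.integral_sum) (intro Bochner_Integration.integrable_sum integrable_mult_right ip(1))
  also have "\<dots> = (\<Sum>\<sigma>\<in>?P. \<Sum>\<rho>\<in>?P. (LINT \<theta>|torus g. signof \<sigma> * signof \<rho> * fps_nth (\<Prod>j<g. G (\<sigma> j) (\<rho> j) (\<theta> j)) n))"
    by (intro sum.cong refl Bochner_Integration.integral_sum integrable_mult_right ip(1))
  also have "\<dots> = (\<Sum>\<sigma>\<in>?P. \<Sum>\<rho>\<in>?P. signof \<sigma> * signof \<rho> * fps_nth (\<Prod>j<g. circle_fps (G (\<sigma> j) (\<rho> j))) n)"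
    by (simp only: integral_mult_right_zero ip(2))
  also have "\<dots> = fps_nth (\<Sum>\<sigma>\<in>?P. \<Sum>\<rho>\<in>?P. signof \<sigma> * signof \<rho> * (\<Prod>j<g. circle_fps (G (\<sigma> j) (\<rho> j)))) n"
    by (simp only: fps_sum_nth s)
  also have "\<dots> = fps_nth (of_nat (fact g) * Determinant.det (Matrix.mat g g (\<lambda>(a, b). circle_fps (G a b)))) n"
    by (subst double_det_sum[where c = "\<lambda>a b. circle_fps (G a b)"]) rule
  finally show ?thesis by (simp only: fps_of_nat[symmetric] fps_mult_left_const_nth of_nat_fact)
qed

lemma fps_exp_sum: "finite I \<Longrightarrow> fps_exp (\<Sum>j\<in>I. c j) = (\<Prod>j\<in>I. fps_exp (c j :: complex))"
  by (induction I rule: finite_induct) (simp_all add: fps_exp_add_mult)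

lemma fps_const_prod: "(\<Prod>i\<in>I. fps_const (c i)) = fps_const (\<Prod>i\<in>I. c i :: complex)"
  by (induction I rule: infinite_finite_induct) simp_all

lemma fps_const_sum: "(\<Sum>i\<in>I. fps_const (c i)) = fps_const (\<Sum>i\<in>I. c i :: complex)"
  by (induction I rule: infinite_finite_induct) simp_all

text \<open>
  The factor \<open>exp (2 z cos (k t))\<close> of the generating function is attached to the single angle \<open>t\<close>,
  because the exponential of a power sum is a product over the angles.
\<close>

definition Gser :: "nat \<Rightarrow> nat \<Rightarrow> nat \<Rightarrow> real \<Rightarrow> complex fps" where
  "Gser k a b t = fps_const (of_real ((2 * sin t)\<^sup>2 * (2 * cos t) ^ a * (2 * cos t) ^ b)) * fps_exp (of_real (2 * cos (real k * t)))"

lemma integrable_circle_bounded: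
  fixes f :: "real \<Rightarrow> real"
  assumes "continuous_on UNIV f" "\<And>t. \<bar>f t\<bar> \<le> K"
  shows "integrable circle f"
proof (rule circle.integrable_const_bound)
  show "AE t in circle. norm (f t) \<le> K" using assms(2) by simp
  show "f \<in> borel_measurable circle"
    using borel_measurable_continuous_onI[OF assms(1)] by (simp add: measurable_cong_sets[OF sets_circle refl])
qed

lemma integrable_Gser_coeff:
  "integrable circle (\<lambda>t. (2 * sin t)\<^sup>2 * (2 * cos t) ^ m * (2 * cos (real k * t)) ^ n :: real)"
proof (rule integrable_circle_bounded)
  show "continuous_on UNIV (\<lambda>t. (2 * sin t)\<^sup>2 * (2 * cos t) ^ m * (2 * cos (real k * t)) ^ n :: real)"
    by (intro continuous_intros)
  have b: "(\<bar>2\<bar> * \<bar>x\<bar>) ^ l \<le> 2 ^ l" if "\<bar>x\<bar> \<le> 1" for x :: real and l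
    using that by (intro power_mono) auto
  show "\<bar>(2 * sin t)\<^sup>2 * (2 * cos t) ^ m * (2 * cos (real k * t)) ^ n\<bar> \<le> 2^2 * 2^m * 2^n" for t :: real
    unfolding abs_mult power_abs
    by (intro mult_mono b abs_sin_le_one abs_cos_le_one mult_nonneg_nonneg zero_le_power abs_ge_zero zero_le_numeral)
qed

lemma fps_nth_Gser: "fps_nth (Gser k a b t) n =
   of_real ((2 * sin t)\<^sup>2 * (2 * cos t) ^ (a + b) * (2 * cos (real k * t)) ^ n / fact n)"
  by (simp add: Gser_def power_add)

lemma wint_psum_power:
  "complex_of_real (wint g (\<lambda>\<theta>. psum g (int k) \<theta> ^ n)) / fact n =
     fact g * fps_nth (Determinant.det (Matrix.mat g g (\<lambda>(a, b). circle_fps (Gser k a b)))) n"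
proof -
  let ?P = "{\<sigma>. \<sigma> permutes {0..<g}}"
  have e: "(\<Sum>\<sigma>\<in>?P. \<Sum>\<rho>\<in>?P. signof \<sigma> * signof \<rho> * (\<Prod>j<g. Gser k (\<sigma> j) (\<rho> j) (\<theta> j))) =
     fps_const (of_real (weyl g \<theta>)) * fps_exp (of_real (psum g (int k) \<theta>))" for \<theta>
  proof -
    have p: "(\<Prod>j<g. Gser k (\<sigma> j) (\<rho> j) (\<theta> j)) = fps_const (of_real ((\<Prod>j<g. (2 * sin (\<theta> j))\<^sup>2) *
       (\<Prod>j<g. (2 * cos (\<theta> j)) ^ \<sigma> j) * (\<Prod>j<g. (2 * cos (\<theta> j)) ^ \<rho> j))) * fps_exp (of_real (psum g (int k) \<theta>))" for \<sigma> \<rho>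
      unfolding Gser_def prod.distrib psum_def of_real_sum
      by (subst fps_exp_sum) (simp_all add: fps_const_prod prod.distrib of_real_prod)
    have sg: "(signof \<sigma> :: complex fps) = fps_const (of_real (signof \<sigma>))" for \<sigma> :: "nat \<Rightarrow> nat"
      by (simp add: sign_def)
    have q: "fps_const (of_real s) * fps_const (of_real r) * (fps_const (of_real (P * V * W)) * X) =
        fps_const (of_real (P * ((s * V) * (r * W)))) * X" for s r P V W :: real and X :: "complex fps"
    proof -
      have "fps_const (complex_of_real s) * fps_const (of_real r) * (fps_const (of_real (P * V * W)) * X) =
          fps_const (of_real (s * r * (P * V * W))) * X"
        by (simp only: of_real_mult fps_const_mult mult.assoc[symmetric])
      also have "s * r * (P * V * W) = P * ((s * V) * (r * W))" by (simp add: mult_ac)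
      finally show ?thesis .
    qed
    have "(\<Sum>\<sigma>\<in>?P. \<Sum>\<rho>\<in>?P. signof \<sigma> * signof \<rho> * (\<Prod>j<g. Gser k (\<sigma> j) (\<rho> j) (\<theta> j))) =
      (\<Sum>\<sigma>\<in>?P. \<Sum>\<rho>\<in>?P. fps_const (of_real ((\<Prod>j<g. (2 * sin (\<theta> j))\<^sup>2) *
         ((signof \<sigma> * (\<Prod>j<g. (2 * cos (\<theta> j)) ^ \<sigma> j)) * (signof \<rho> * (\<Prod>j<g. (2 * cos (\<theta> j)) ^ \<rho> j))))) * fps_exp (of_real (psum g (int k) \<theta>)))"
      unfolding p sg q ..
    also have "\<dots> = fps_const (of_real ((\<Prod>j<g. (2 * sin (\<theta> j))\<^sup>2) * (\<Sum>\<sigma>\<in>?P. \<Sum>\<rho>\<in>?P.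
         ((signof \<sigma> * (\<Prod>j<g. (2 * cos (\<theta> j)) ^ \<sigma> j)) * (signof \<rho> * (\<Prod>j<g. (2 * cos (\<theta> j)) ^ \<rho> j)))))) * fps_exp (of_real (psum g (int k) \<theta>))"
      by (simp only: sum_distrib_left sum_distrib_right of_real_sum fps_const_sum[symmetric])
    also have "(\<Sum>\<sigma>\<in>?P. \<Sum>\<rho>\<in>?P.
         ((signof \<sigma> * (\<Prod>j<g. (2 * cos (\<theta> j)) ^ \<sigma> j)) * (signof \<rho> * (\<Prod>j<g. (2 * cos (\<theta> j)) ^ \<rho> j)))) = (vdet g \<theta>)\<^sup>2"
      unfolding vdet_def power2_eq_square sum_product ..
    finally show ?thesis unfolding weyl_vdet .
  qed
  have "fact g * fps_nth (Determinant.det (Matrix.mat g g (\<lambda>(a, b). circle_fps (Gser k a b)))) n =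
    (LINT \<theta>|torus g. fps_nth (fps_const (of_real (weyl g \<theta>)) * fps_exp (of_real (psum g (int k) \<theta>))) n)"
  proof (subst andreief[symmetric])
    show "integrable circle (\<lambda>t. fps_nth (Gser k a b t) n)" for a b n
      unfolding fps_nth_Gser by (intro integrable_of_real integrable_divide integrable_Gser_coeff)
  qed (simp only: e)
  also have "\<dots> = (LINT \<theta>|torus g. complex_of_real (weyl g \<theta> * psum g (int k) \<theta> ^ n / fact n))"
    by simp
  also have "\<dots> = of_real (wint g (\<lambda>\<theta>. psum g (int k) \<theta> ^ n) / fact n)"
    unfolding integral_complex_of_real wint_def by simp
  finally show ?thesis by simp
qed

lemma integral_circle_cos: "(LINT t|circle. cos (of_int a * t)) = (if a = 0 then 1 else 0)"
proof (cases "a = 0")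
  case True then show ?thesis using circle.prob_space by simp
next
  case False
  have "(LINT t|circle. cos (of_int a * t)) = 0"
  proof (rule integral_circle_deriv[where F = "\<lambda>t. sin (of_int a * t) / of_int a"])
    show "((\<lambda>t. sin (of_int a * t) / of_int a) has_real_derivative cos (of_int a * t)) (at t)" for t
      using False by (auto intro!: derivative_eq_intros)
    show "sin (of_int a * (2 * pi)) / of_int a = sin (of_int a * 0) / (of_int a :: real)"
      using sin_int_2pin[of a] by (simp add: mult.commute mult.left_commute)
  qed (intro continuous_intros)
  with False show ?thesis by simp
qed

lemma integrable_circle_cos: "integrable circle (\<lambda>t. cos (of_int a * t))"
  by (rule integrable_circle_bounded[of _ 1]) (auto intro!: continuous_intros)

text \<open>
  The functions \<open>2 sin ((a + 1) t)\<close> are orthogonal, so the determinant of their scalar products is a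
  power of two.
\<close>

lemma wint_1: "wint g (\<lambda>_. 1) = fact g * 2 ^ g"
proof -
  let ?P = "{\<sigma>. \<sigma> permutes {0..<g}}"
  define G where "G a b t = fps_const (complex_of_real (2 * sin (real (Suc a) * t) * (2 * sin (real (Suc b) * t))))" for a b t
  have G_eq: "2 * sin (real (Suc a) * t) * (2 * sin (real (Suc b) * t)) =
      2 * cos (of_int (int a - int b) * t) - 2 * cos (of_int (int a + int b + 2) * t)" for a b t
    unfolding sin_sin_2 by (simp add: algebra_simps)
  have sg: "(signof \<sigma> :: complex fps) = fps_const (of_real (signof \<sigma>))" for \<sigma> :: "nat \<Rightarrow> nat"
    by (simp add: sign_def)
  have e: "(\<Sum>\<sigma>\<in>?P. \<Sum>\<rho>\<in>?P. signof \<sigma> * signof \<rho> * (\<Prod>j<g. G (\<sigma> j) (\<rho> j) (\<theta> j))) = fps_const (of_real (weyl g \<theta>))" for \<theta>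
  proof -
    have "(\<Sum>\<sigma>\<in>?P. \<Sum>\<rho>\<in>?P. signof \<sigma> * signof \<rho> * (\<Prod>j<g. G (\<sigma> j) (\<rho> j) (\<theta> j))) =
      (\<Sum>\<sigma>\<in>?P. \<Sum>\<rho>\<in>?P. fps_const (of_real ((signof \<sigma> * (\<Prod>j<g. 2 * sin (real (Suc (\<sigma> j)) * \<theta> j))) *
          (signof \<rho> * (\<Prod>j<g. 2 * sin (real (Suc (\<rho> j)) * \<theta> j))))))"
      unfolding sg G_def fps_const_prod fps_const_mult of_real_prod[symmetric] of_real_mult[symmetric]
      by (intro sum.cong refl) (simp only: prod.distrib mult_ac)
    also have "\<dots> = fps_const (of_real ((sdet g \<theta>)\<^sup>2))"
      unfolding sdet_def power2_eq_square sum_product of_real_sum fps_const_sum[symmetric] ..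
    finally show ?thesis unfolding weyl_sdet .
  qed
  have int: "integrable circle (\<lambda>t. fps_nth (G a b t) n)" for a b n
    unfolding G_def fps_nth_fps_const G_eq
    by (cases "n = 0") (simp_all del: of_int_add of_int_diff add: integrable_circle_cos)
  have cG: "circle_fps (G a b) = fps_const (if a = b then 2 else 0)" for a b
  proof (rule fps_ext)
    fix n
    have "fps_nth (circle_fps (G a b)) n = (LINT t|circle. complex_of_real (if n = 0 then 2 * cos (of_int (int a - int b) * t) - 2 * cos (of_int (int a + int b + 2) * t) else 0))"
      unfolding circle_fps_def fps_nth_Abs_fps G_def G_eq fps_nth_fps_const by (intro Bochner_Integration.integral_cong refl) auto
    also have "\<dots> = of_real (LINT t|circle. (if n = 0 then 2 * cos (of_int (int a - int b) * t) - 2 * cos (of_int (int a + int b + 2) * t) else 0))"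
      by (rule integral_complex_of_real)
    also have "(LINT t|circle. (if n = 0 then 2 * cos (of_int (int a - int b) * t) - 2 * cos (of_int (int a + int b + 2) * t) else 0)) =
       (if n = 0 then 2 * (if a = b then 1 else 0) else 0)"
      using integral_circle_cos[of "int a - int b"] integral_circle_cos[of "int a + int b + 2"]
        integrable_circle_cos[of "int a - int b"] integrable_circle_cos[of "int a + int b + 2"]
      by (auto simp del: of_int_add of_int_diff)
    finally show "fps_nth (circle_fps (G a b)) n = fps_nth (fps_const (if a = b then 2 else 0)) n" by simp
  qed
  have "Matrix.mat g g (\<lambda>(a, b). circle_fps (G a b)) = fps_const 2 \<cdot>\<^sub>m 1\<^sub>m g"
    by (rule eq_matI) (auto simp: cG)
  then have "Determinant.det (Matrix.mat g g (\<lambda>(a, b). circle_fps (G a b))) = fps_const (2 ^ g)"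
    by (simp add: fps_const_power)
  moreover have "(LINT \<theta>|torus g. fps_nth (fps_const (complex_of_real (weyl g \<theta>))) 0) =
     fact g * fps_nth (Determinant.det (Matrix.mat g g (\<lambda>(a, b). circle_fps (G a b)))) 0"
    using andreief[where G = G and g = g and n = 0, OF int] by (simp only: e)
  ultimately have "(LINT \<theta>|torus g. complex_of_real (weyl g \<theta>)) = fact g * 2 ^ g" by simp
  then have "complex_of_real (wint g (\<lambda>_. 1)) = complex_of_real (fact g * 2 ^ g)"
    unfolding integral_complex_of_real wint_def by simp
  then show ?thesis by (simp only: of_real_eq_iff)
qed

section \<open>Moments on the circle\<close>

text \<open>
  At most one summand is nonzero.  Its index \<open>i\<close> corresponds to the lower index \<open>n - i\<close> of the
  binomial coefficient in the definition of \<open>Bcoeff\<close>.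
\<close>

lemma Bcoeff_sum:
  assumes k: "k \<ge> 1"
  shows "(\<Sum>i\<le>n. real (n choose i) * (if c + int k * (2 * int i - int n) = 0 then 1 else 0)) = real (Bcoeff (of_int c / of_nat k) n)"
proof (cases "\<exists>i\<le>n. c + int k * (2 * int i - int n) = 0")
  case True
  then obtain i where i: "i \<le> n" "c + int k * (2 * int i - int n) = 0" by blast
  have uniq: "c + int k * (2 * int i' - int n) = 0 \<longleftrightarrow> i' = i" for i'
  proof
    assume "c + int k * (2 * int i' - int n) = 0"
    with i(2) have "int k * (2 * int i' - int n) = int k * (2 * int i - int n)" by linarith
    then show "i' = i" using k by simp
  qed (use i in simp)
  have "(\<Sum>i'\<le>n. real (n choose i') * (if c + int k * (2 * int i' - int n) = 0 then 1 else 0)) = real (n choose i)"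
    unfolding uniq using i(1) by (simp add: if_distrib[of "\<lambda>x. _ * x"] cong: if_cong)
  moreover have "c = int k * (int n - 2 * int i)" using i(2) by (simp add: algebra_simps)
  then have "(of_int c / of_nat k :: rat) = of_int (int n - 2 * int i)" using k by simp
  then have "(of_nat n + of_int c / of_nat k) / 2 = (of_nat (n - i) :: rat)"
    using i(1) by (simp add: of_nat_diff)
  then have "Bcoeff (of_int c / of_nat k) n = n choose (n - i)"
    unfolding Bcoeff_def Let_def by simp
  ultimately show ?thesis using i(1) binomial_symmetric[of i n] by simp
next
  case False
  have "Bcoeff (of_int c / of_nat k) n = 0"
  proof (rule ccontr)
    assume "Bcoeff (of_int c / of_nat k) n \<noteq> 0"
    then have q: "(of_nat n + of_int c / of_nat k) / 2 \<in> (\<int> :: rat set)"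
      "0 \<le> (of_nat n + of_int c / of_nat k :: rat) / 2" "(of_nat n + of_int c / of_nat k :: rat) / 2 \<le> of_nat n"
      by (auto simp: Bcoeff_def Let_def split: if_splits)
    from q(1) obtain m where m: "(of_nat n + of_int c / of_nat k :: rat) / 2 = of_int m" by (auto elim: Ints_cases)
    have "0 \<le> m" "m \<le> int n" using q(2,3) unfolding m by simp_all
    moreover have "(of_int c :: rat) = of_int (int k * (2 * m - int n))" using m k by (simp add: field_simps)
    then have "c = int k * (2 * m - int n)" by (simp only: of_int_eq_iff)
    ultimately have "nat (int n - m) \<le> n" "c + int k * (2 * int (nat (int n - m)) - int n) = 0"
      by (simp_all add: algebra_simps)
    with False show False by blast
  qed
  with False show ?thesis by auto
qed

text \<open>
  Real and imaginary part of the product of two binomial expansions in exponentials; the imaginary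
  part vanishes because the left-hand side is real.
\<close>

lemma cos_power_expansion:
  fixes t :: real and k m n :: nat
  assumes A_def: "A = (\<lambda>j i. 2 * int j - int m + int k * (2 * int i - int n))"
  shows "(2 * cos t) ^ m * (2 * cos (real k * t)) ^ n = (\<Sum>j\<le>m. \<Sum>i\<le>n. real (m choose j) * real (n choose i) * cos (of_int (A j i) * t))"
    and "(\<Sum>j\<le>m. \<Sum>i\<le>n. real (m choose j) * real (n choose i) * sin (of_int (A j i) * t)) = 0"
proof -
  have c: "complex_of_real (2 * cos s) = cis s + cis (- s)" for s by (simp add: complex_eq_iff)
  have b: "complex_of_real (2 * cos s) ^ l = (\<Sum>j\<le>l. of_nat (l choose j) * cis (of_int (2 * int j - int l) * s))" for s l
  proof -
    have "complex_of_real (2 * cos s) ^ l = (\<Sum>j\<le>l. of_nat (l choose j) * cis s ^ j * cis (- s) ^ (l - j))"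
      unfolding c by (rule binomial_ring)
    also have "\<dots> = (\<Sum>j\<le>l. of_nat (l choose j) * cis (of_int (2 * int j - int l) * s))"
    proof (rule sum.cong[OF refl])
      fix j assume "j \<in> {..l}"
      then have "real j * s + real (l - j) * - s = of_int (2 * int j - int l) * s" by (simp add: of_nat_diff algebra_simps)
      then show "of_nat (l choose j) * cis s ^ j * cis (- s) ^ (l - j) = of_nat (l choose j) * cis (of_int (2 * int j - int l) * s)"
        by (simp only: Complex.DeMoivre mult.assoc cis_mult)
    qed
    finally show ?thesis .
  qed
  have "complex_of_real ((2 * cos t) ^ m * (2 * cos (real k * t)) ^ n) =
     (\<Sum>j\<le>m. of_nat (m choose j) * cis (of_int (2 * int j - int m) * t)) * (\<Sum>i\<le>n. of_nat (n choose i) * cis (of_int (2 * int i - int n) * (real k * t)))"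
    unfolding b[symmetric] by simp
  also have "\<dots> = (\<Sum>j\<le>m. \<Sum>i\<le>n. of_real (real (m choose j) * real (n choose i)) * cis (of_int (A j i) * t))"
    unfolding sum_product
  proof (intro sum.cong refl)
    fix j i
    have "of_int (A j i) * t = of_int (2 * int j - int m) * t + of_int (2 * int i - int n) * (real k * t)"
      by (simp add: A_def algebra_simps)
    then show "of_nat (m choose j) * cis (of_int (2 * int j - int m) * t) * (of_nat (n choose i) * cis (of_int (2 * int i - int n) * (real k * t)))
       = of_real (real (m choose j) * real (n choose i)) * cis (of_int (A j i) * t)"
      by (simp only: cis_mult[symmetric] of_real_mult of_real_of_nat_eq mult_ac)
  qed
  finally have e: "complex_of_real ((2 * cos t) ^ m * (2 * cos (real k * t)) ^ n) =
    (\<Sum>j\<le>m. \<Sum>i\<le>n. of_real (real (m choose j) * real (n choose i)) * cis (of_int (A j i) * t))" .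
  have re: "Re (complex_of_real x * z) = x * Re z" and im: "Im (complex_of_real x * z) = x * Im z" for x z by simp_all
  from arg_cong[OF e, of Re] show "(2 * cos t) ^ m * (2 * cos (real k * t)) ^ n = (\<Sum>j\<le>m. \<Sum>i\<le>n. real (m choose j) * real (n choose i) * cos (of_int (A j i) * t))"
    by (simp only: Re_complex_of_real Re_sum re cis.sel)
  from arg_cong[OF e, of Im] show "(\<Sum>j\<le>m. \<Sum>i\<le>n. real (m choose j) * real (n choose i) * sin (of_int (A j i) * t)) = 0"
    by (simp only: Im_complex_of_real Im_sum im cis.sel)
qed

text \<open>
  The weight \<open>(2 sin t)\<^sup>2\<close> is \<open>2 (1 - cos (2 t))\<close>.  The vanishing sine sum allows the product with
  \<open>cos (2 t)\<close> to be replaced by a shift of all frequencies by two, which gives the second binomial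
  coefficient.
\<close>

lemma circle_moment:
  assumes k: "k \<ge> 1"
  shows "(LINT t|circle. (2 * sin t)\<^sup>2 * (2 * cos t) ^ m * (2 * cos (real k * t)) ^ n) =
    2 * (\<Sum>j\<le>m. real (m choose j) * (real (Bcoeff ((2 * of_nat j - of_nat m) / of_nat k) n) - real (Bcoeff ((2 * of_nat j - of_nat m + 2) / of_nat k) n)))"
proof -
  define A where "A = (\<lambda>j i. 2 * int j - int m + int k * (2 * int i - int n))"
  note ex = cos_power_expansion[OF A_def]
  let ?b = "\<lambda>j i. real (m choose j) * real (n choose i)"
  have e: "(2 * sin t)\<^sup>2 * (2 * cos t) ^ m * (2 * cos (real k * t)) ^ n =
     (\<Sum>j\<le>m. \<Sum>i\<le>n. 2 * ?b j i * (cos (of_int (A j i) * t) - cos (of_int (A j i + 2) * t)))" for t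
  proof -
    have s: "(2 * sin t)\<^sup>2 = 2 * (1 - cos (2 * t))"
      by (simp add: cos_double_sin power2_eq_square)
    have "(2 * sin t)\<^sup>2 * (2 * cos t) ^ m * (2 * cos (real k * t)) ^ n =
       2 * (1 - cos (2 * t)) * ((2 * cos t) ^ m * (2 * cos (real k * t)) ^ n) + 2 * sin (2 * t) * 0"
      unfolding s by simp
    also have "\<dots> = 2 * (1 - cos (2 * t)) * (\<Sum>j\<le>m. \<Sum>i\<le>n. ?b j i * cos (of_int (A j i) * t))
       + 2 * sin (2 * t) * (\<Sum>j\<le>m. \<Sum>i\<le>n. ?b j i * sin (of_int (A j i) * t))"
      by (simp only: ex)
    also have "\<dots> = (\<Sum>j\<le>m. \<Sum>i\<le>n. 2 * (1 - cos (2 * t)) * (?b j i * cos (of_int (A j i) * t)) + 2 * sin (2 * t) * (?b j i * sin (of_int (A j i) * t)))"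
      by (simp only: sum_distrib_left sum.distrib)
    also have "\<dots> = (\<Sum>j\<le>m. \<Sum>i\<le>n. 2 * ?b j i * (cos (of_int (A j i) * t) - cos (of_int (A j i + 2) * t)))"
    proof (intro sum.cong refl)
      fix j i
      have "cos (of_int (A j i + 2) * t) = cos (of_int (A j i) * t + 2 * t)" by (simp add: algebra_simps)
      then show "2 * (1 - cos (2 * t)) * (?b j i * cos (of_int (A j i) * t)) + 2 * sin (2 * t) * (?b j i * sin (of_int (A j i) * t)) =
         2 * ?b j i * (cos (of_int (A j i) * t) - cos (of_int (A j i + 2) * t))"
        by (simp only: cos_add) (simp add: algebra_simps)
    qed
    finally show ?thesis .
  qed
  have int: "integrable circle (\<lambda>t. 2 * ?b j i * (cos (of_int (A j i) * t) - cos (of_int (A j i + 2) * t)))" for j i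
    by (intro integrable_mult_right Bochner_Integration.integrable_diff integrable_circle_cos)
  have val: "(LINT t|circle. 2 * ?b j i * (cos (of_int (A j i) * t) - cos (of_int (A j i + 2) * t))) =
     2 * ?b j i * ((if A j i = 0 then 1 else 0) - (if A j i + 2 = 0 then 1 else 0))" for j i
    by (simp only: integral_mult_right_zero Bochner_Integration.integral_diff[OF integrable_circle_cos integrable_circle_cos] integral_circle_cos)
  have "(LINT t|circle. (2 * sin t)\<^sup>2 * (2 * cos t) ^ m * (2 * cos (real k * t)) ^ n) =
     (\<Sum>j\<le>m. \<Sum>i\<le>n. 2 * ?b j i * ((if A j i = 0 then 1 else 0) - (if A j i + 2 = 0 then 1 else 0)))"
    unfolding e
    by (subst Bochner_Integration.integral_sum, intro Bochner_Integration.integrable_sum int, intro sum.cong refl,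
        subst Bochner_Integration.integral_sum, rule int, intro sum.cong refl val)
  also have "\<dots> = (\<Sum>j\<le>m. 2 * real (m choose j) * ((\<Sum>i\<le>n. real (n choose i) * (if A j i = 0 then 1 else 0)) - (\<Sum>i\<le>n. real (n choose i) * (if A j i + 2 = 0 then 1 else 0))))"
    by (simp only: sum_distrib_left right_diff_distrib sum_subtractf mult.assoc)
  also have "\<dots> = (\<Sum>j\<le>m. 2 * real (m choose j) * (real (Bcoeff ((2 * of_nat j - of_nat m) / of_nat k) n) - real (Bcoeff ((2 * of_nat j - of_nat m + 2) / of_nat k) n)))"
  proof (intro sum.cong refl arg_cong2[of _ _ _ _ "(*)"] arg_cong2[of _ _ _ _ "(-)"])
    fix j
    show "(\<Sum>i\<le>n. real (n choose i) * (if A j i = 0 then 1 else 0)) = real (Bcoeff ((2 * of_nat j - of_nat m) / of_nat k) n)"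
      using Bcoeff_sum[OF k, of n "2 * int j - int m"] by (simp add: A_def)
    have AA: "A j i + 2 = (2 * int j - int m + 2) + int k * (2 * int i - int n)" for i by (simp add: A_def)
    show "(\<Sum>i\<le>n. real (n choose i) * (if A j i + 2 = 0 then 1 else 0)) = real (Bcoeff ((2 * of_nat j - of_nat m + 2) / of_nat k) n)"
      unfolding AA using Bcoeff_sum[OF k, of n "2 * int j - int m + 2"] by simp
  qed
  finally show ?thesis by (simp add: sum_distrib_left mult_ac)
qed

lemma circle_fps_Gser:
  assumes k: "k \<ge> 1"
  shows "circle_fps (Gser k a b) = fps_const 2 * Cseries k (a + b)"
proof (rule fps_ext)
  fix n
  let ?B = "\<lambda>s j. Bcoeff ((2 * of_nat j - of_nat (a + b) + s) / of_nat k) n"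
  have "fps_nth (circle_fps (Gser k a b)) n =
     of_real ((LINT t|circle. (2 * sin t)\<^sup>2 * (2 * cos t) ^ (a + b) * (2 * cos (real k * t)) ^ n) / fact n)"
    unfolding circle_fps_def fps_nth_Abs_fps fps_nth_Gser integral_complex_of_real by simp
  also have "\<dots> = 2 * (\<Sum>j\<le>a + b. of_nat ((a + b) choose j) * (of_nat (?B 0 j) / fact n - of_nat (?B 2 j) / fact n))"
    unfolding circle_moment[OF k]
    by (simp add: sum_divide_distrib sum_distrib_left diff_divide_distrib right_diff_distrib)
  also have "\<dots> = fps_nth (fps_const 2 * Cseries k (a + b)) n"
    unfolding Cseries_def fps_mult_left_const_nth fps_sum_nth fps_of_nat[symmetric] fps_sub_nth Bseries_def fps_nth_Abs_fps
    by simp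
  finally show "fps_nth (circle_fps (Gser k a b)) n = fps_nth (fps_const 2 * Cseries k (a + b)) n" .
qed

theorem weyl_moments:
  assumes k: "k \<ge> 1"
  shows "complex_of_real (wint g (\<lambda>\<theta>. psum g (int k) \<theta> ^ n) / wint g (\<lambda>_. 1)) / fact n =
    fps_nth (Determinant.det (Matrix.mat g g (\<lambda>(a, b). Cseries k (a + b)))) n"
proof -
  let ?C = "Matrix.mat g g (\<lambda>(a, b). Cseries k (a + b))"
  have "Matrix.mat g g (\<lambda>(a, b). circle_fps (Gser k a b)) = fps_const 2 \<cdot>\<^sub>m ?C"
    by (rule eq_matI) (auto simp: circle_fps_Gser[OF k])
  then have "Determinant.det (Matrix.mat g g (\<lambda>(a, b). circle_fps (Gser k a b))) = fps_const (2 ^ g) * Determinant.det ?C"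
    by (simp add: fps_const_power)
  then have "complex_of_real (wint g (\<lambda>\<theta>. psum g (int k) \<theta> ^ n)) / fact n = fact g * 2 ^ g * fps_nth (Determinant.det ?C) n"
    unfolding wint_psum_power by (simp del: fps_const_power)
  then show ?thesis unfolding wint_1 by (simp add: field_simps)
qed

section \<open>The moment generating function\<close>

theorem theorem1:
  fixes M :: "(complex ^ ('g + 'g) ^ ('g::finite + 'g)) measure"
    and k :: nat
  assumes "k \<ge> 1"
    and "is_haar_USp M"
  shows "moment_gf M (power_sum k) =
    Determinant.det (Matrix.mat CARD('g) CARD('g) (\<lambda>(i, j). Cseries k (i + j)))"
proof (rule fps_ext)
  interpret haar M by (rule haar.intro) (rule assms(2))
  fix n
  have "fps_nth (moment_gf M (power_sum k)) n = (LINT A|M. power_sum k A ^ n) / fact n"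
    by (simp add: moment_gf_def)
  also have "\<dots> = fps_nth (Determinant.det (Matrix.mat CARD('g) CARD('g) (\<lambda>(i, j). Cseries k (i + j)))) n"
    unfolding weyl_integration_power_sum by (rule weyl_moments[OF assms(1)])
  finally show "fps_nth (moment_gf M (power_sum k)) n =
    fps_nth (Determinant.det (Matrix.mat CARD('g) CARD('g) (\<lambda>(i, j). Cseries k (i + j)))) n" .
qed

end
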